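(* Assume that $\varphi$ is non-contractive, and let $(S,\iota)$ be a free analytic 1-submanifold of $M$ with $S\cong U(1)$ and $S\notin\mathcal F(S)$. Then: 1) $\mathcal M(S)\neq\emptyset$, and each $\Sigma\in\mathcal M(S)$ is compact with $\Sigma\subset S=\mathrm{int}[S]$. 2) Each $\Sigma\in\mathcal M(S)$ admits a $\Sigma$-decomposition $\Sigma_0,\dots,\Sigma_n$, $[g_0],\dots,[g_n]$ of $S$, and it is unique in the following sense: if $n=1$ there is no other $\Sigma$-decomposition of $S$; if $n\ge2$ the only other $\Sigma$-decomposition of $S$ is $\overline\Sigma_k:=\Sigma_{\zeta(k)}$, $[\overline g_k]:=[g_{\zeta(k)}]$ ($0\le k\le n$) with $\zeta(0):=0$ and $\zeta(k):=n-(k-1)$ for $1\le k\le n$. 3) The length $\mathfrak L_S\in\mathbb N_{\ge1}$ of $S$, defined by $\mathfrak L_S:=n$ for a $\Sigma$-decomposition $\Sigma_0,\dots,\Sigma_n$, $[g_0],\dots,[g_n]$ of $S$ with $\Sigma\in\mathcal M(S)$, is well defined, i.e. does not depend on the choice of $\Sigma\in\mathcal M(S)$ and of the $\Sigma$-decomposition.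
   Context: Manifolds and Lie groups are finite-dimensional, Hausdorff, real analytic, without boundary unless stated otherwise, and not assumed second countable. $\varphi\colon G\times M\to M$, $(g,x)\mapsto g\cdot x$, is a left action of a Lie group $G$ on an analytic manifold $M$ such that $g\mapsto g\cdot x$ is continuous for each $x\in M$. $\varphi$ is analytic in $M$ if $x\mapsto g\cdot x$ is analytic for each $g\in G$; it is non-contractive if it is analytic in $M$ and for each $C\subseteq M$ with $|C|\ge 2$ and each $x\in M\setminus C$ there is a neighbourhood $U$ of $x$ with $g\cdot C\not\subseteq U$ for all $g\in G$. An analytic 1-submanifold $(S,\iota)$ of $M$ consists of a connected, Hausdorff, second countable 1-dimensional analytic manifold $S$ with (possibly empty) boundary and an injective analytic immersion $\iota\colon S\to M$. $S\cong U(1)$ means that $S$ is homeomorphic to $U(1)$. A segment is a connected subset of $S$ with more than one point; $\mathrm{Seg}(S)$ is the set of segments. For $\Sigma\in\mathrm{Seg}(S)$ (with $S\cong U(1)$), $\mathrm{int}[\Sigma]$ is the topological interior of $\Sigma$ in $S$ and $\partial_\Sigma:=\Sigma\setminus\mathrm{int}[\Sigma]$. The symbol $\subset$ means proper inclusion. $g\cdot\iota$ denotes $z\mapsto g\cdot\iota(z)$; $G_S:=\bigcap_{z\in S}G_{\iota(z)}$ (intersection of stabilizers), $\mathcal H(S):=G/G_S$ (left cosets), and $[g]\in\mathcal H(S)$ is the class of $g$. For $\Sigma,\Sigma'\in\mathrm{Seg}(S)$ and $g\in G$, write $g\cdot\iota|_\Sigma\sim_\circ\iota|_{\Sigma'}$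 if $g\cdot\iota(O)=\iota(O')$ for open (in $S$) segments $O\subseteq\Sigma$, $O'\subseteq\Sigma'$ on which $\iota$ is an embedding. $\Sigma\in\mathrm{Seg}(S)$ is a free segment, $\Sigma\in\mathcal F(S)$, if for $g\in G$: $g\cdot\iota|_\Sigma\sim_\circ\iota|_\Sigma\Leftrightarrow g\in G_S$. $\mathcal M(S)$ is the set of inclusion-maximal elements of $\mathcal F(S)$. $(S,\iota)$ is free if $\mathcal F(S)\neq\emptyset$. $\Sigma$-decomposition ($S\cong U(1)$). For $\Sigma\in\mathcal M(S)$, $\Sigma\subset S$: a $\Sigma$-decomposition of $S$ consists of (compact) $\Sigma_0,\dots,\Sigma_n\in\mathcal M(S)$, $n\ge1$, and classes $[g_0],\dots,[g_n]\in\mathcal H(S)$ with $\Sigma_0=\Sigma$, $S=\bigcup_{k=0}^n\Sigma_k$, $g_k\cdot\iota(\Sigma_0)=\iota(\Sigma_k)$ for $0\le k\le n$; if $n=1$, $\Sigma_0\cap\Sigma_1=\partial_{\Sigma_0}\cap\partial_{\Sigma_1}$ consists of the two boundary points of $\Sigma_0$ and $\Sigma_1$; if $n\ge2$, $\Sigma_p\cap\Sigma_q=\partial_{\Sigma_p}\cap\partial_{\Sigma_q}$ is a singleton for $|p-q|\in\{1,n\}$ and empty for $2\le|p-q|\le n-1$. *)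

theory Defs
  imports "HOL-Analysis.Analysis" "HOL-Algebra.Group_Action" "HOL-Algebra.Left_Coset"
begin

section \<open>Real analytic manifolds\<close>

text \<open>
  Coordinates live in \<open>Euclidean_space n\<close>, the functions \<open>nat \<Rightarrow> real\<close> vanishing from index \<open>n\<close> on;
  the case \<open>n = 0\<close> (for instance discrete Lie groups) is included. The multi-indices of length
  \<open>n\<close> are the functions \<open>nat \<Rightarrow> nat\<close> vanishing from \<open>n\<close> on. The set \<open>D\<close> need not be open:
  around each of its points, \<open>f\<close> is required to be the restriction of a function \<open>F\<close> that is
  given by a power series on a full neighbourhood. This covers boundary charts.
\<close>

definition real_analytic_on :: "nat \<Rightarrow> (nat \<Rightarrow> real) set \<Rightarrow> ((nat \<Rightarrow> real) \<Rightarrow> real) \<Rightarrow> bool" where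
  "real_analytic_on n D f \<longleftrightarrow>
     (\<forall>x\<in>D. \<exists>V a F. openin (Euclidean_space n) V \<and> x \<in> V \<and>
        (\<forall>y\<in>V. ((\<lambda>\<alpha>. a \<alpha> * (\<Prod>i<n. (y i - x i) ^ \<alpha> i)) has_sum F y)
                 {\<alpha> :: nat \<Rightarrow> nat. \<forall>i\<ge>n. \<alpha> i = 0}) \<and>
        (\<forall>y\<in>V \<inter> D. f y = F y))"

text \<open>A chart is a pair of its domain and its coordinate map.\<close>

type_synonym 'a chart = "'a set \<times> ('a \<Rightarrow> nat \<Rightarrow> real)"

record 'a manifold =
  mtop :: "'a topology"
  mdim :: nat
  matlas :: "'a chart set"

definition half_line :: "(nat \<Rightarrow> real) topology" where
  "half_line = subtopology (Euclidean_space 1) {x. 0 \<le> x 0}"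

definition analytic_atlas :: "(nat \<Rightarrow> real) topology \<Rightarrow> 'a manifold \<Rightarrow> bool" where
  "analytic_atlas X M \<longleftrightarrow>
     (\<Union>(U, u)\<in>matlas M. U) = topspace (mtop M) \<and>
     (\<forall>(U, u)\<in>matlas M. openin (mtop M) U \<and> openin X (u ` U) \<and>
        homeomorphic_map (subtopology (mtop M) U) (subtopology X (u ` U)) u) \<and>
     (\<forall>(U, u)\<in>matlas M. \<forall>(V, v)\<in>matlas M. \<forall>j<mdim M.
        real_analytic_on (mdim M) (u ` (U \<inter> V)) (\<lambda>x. v (inv_into U u x) j))"

definition analytic_manifold :: "'a manifold \<Rightarrow> bool" where
  "analytic_manifold M \<longleftrightarrow>
     Hausdorff_space (mtop M) \<and> analytic_atlas (Euclidean_space (mdim M)) M"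

definition analytic_1_manifold_with_boundary :: "'a manifold \<Rightarrow> bool" where
  "analytic_1_manifold_with_boundary S \<longleftrightarrow>
     Hausdorff_space (mtop S) \<and> mdim S = 1 \<and> analytic_atlas half_line S"

definition analytic_map :: "'a manifold \<Rightarrow> 'b manifold \<Rightarrow> ('a \<Rightarrow> 'b) \<Rightarrow> bool" where
  "analytic_map M N f \<longleftrightarrow>
     continuous_map (mtop M) (mtop N) f \<and>
     (\<forall>(U, u)\<in>matlas M. \<forall>(V, v)\<in>matlas N. \<forall>j<mdim N.
        real_analytic_on (mdim M) (u ` (U \<inter> f -` V)) (\<lambda>x. v (f (inv_into U u x)) j))"

definition prod_manifold :: "'a manifold \<Rightarrow> 'b manifold \<Rightarrow> ('a \<times> 'b) manifold" where
  "prod_manifold M N =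
     \<lparr>mtop = prod_topology (mtop M) (mtop N),
      mdim = mdim M + mdim N,
      matlas = {(U \<times> V, \<lambda>(p, q) i. if i < mdim M then u p i else v q (i - mdim M)) | U u V v.
                  (U, u) \<in> matlas M \<and> (V, v) \<in> matlas N}\<rparr>"

definition lie_group :: "'g monoid \<Rightarrow> 'g manifold \<Rightarrow> bool" where
  "lie_group G L \<longleftrightarrow>
     group G \<and> analytic_manifold L \<and> topspace (mtop L) = carrier G \<and>
     analytic_map (prod_manifold L L) L (\<lambda>(g, h). g \<otimes>\<^bsub>G\<^esub> h) \<and>
     analytic_map L L (\<lambda>g. inv\<^bsub>G\<^esub> g)"


section \<open>Analytic 1-submanifolds\<close>

definition coord1 :: "real \<Rightarrow> nat \<Rightarrow> real" where
  "coord1 t = (\<lambda>i. if i = 0 then t else 0)"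

text \<open>
  Injectivity of the differential of a map from a 1-dimensional manifold: in charts, some component
  has a nonzero derivative. At boundary points the derivative is one-sided.
\<close>

definition immersion1 :: "'s manifold \<Rightarrow> 'm manifold \<Rightarrow> ('s \<Rightarrow> 'm) \<Rightarrow> bool" where
  "immersion1 S M f \<longleftrightarrow>
     (\<forall>(U, u)\<in>matlas S. \<forall>(V, v)\<in>matlas M. \<forall>z\<in>U \<inter> f -` V. \<exists>j<mdim M. \<exists>d. d \<noteq> 0 \<and>
        ((\<lambda>t. v (f (inv_into U u (coord1 t))) j) has_real_derivative d)
          (at (u z 0) within {t. coord1 t \<in> u ` (U \<inter> f -` V)}))"

definition analytic_1_submanifold :: "'s manifold \<Rightarrow> ('s \<Rightarrow> 'm) \<Rightarrow> 'm manifold \<Rightarrow> bool" where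
  "analytic_1_submanifold S \<iota> M \<longleftrightarrow>
     analytic_1_manifold_with_boundary S \<and>
     connected_space (mtop S) \<and> second_countable (mtop S) \<and>
     analytic_map S M \<iota> \<and> immersion1 S M \<iota> \<and> inj_on \<iota> (topspace (mtop S))"

definition segments :: "'s manifold \<Rightarrow> 's set set" where
  "segments S = {\<Sigma>. connectedin (mtop S) \<Sigma> \<and> (\<exists>a\<in>\<Sigma>. \<exists>b\<in>\<Sigma>. a \<noteq> b)}"

definition seg_boundary :: "'s manifold \<Rightarrow> 's set \<Rightarrow> 's set" where
  "seg_boundary S \<Sigma> = \<Sigma> - mtop S interior_of \<Sigma>"


section \<open>Group actions and free segments\<close>

definition continuous_in_group ::
  "'g monoid \<Rightarrow> 'g manifold \<Rightarrow> ('g \<Rightarrow> 'm \<Rightarrow> 'm) \<Rightarrow> 'm manifold \<Rightarrow> bool" where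
  "continuous_in_group G L act M \<longleftrightarrow>
     (\<forall>x\<in>topspace (mtop M). continuous_map (mtop L) (mtop M) (\<lambda>g. act g x))"

definition analytic_in_manifold :: "'g monoid \<Rightarrow> ('g \<Rightarrow> 'm \<Rightarrow> 'm) \<Rightarrow> 'm manifold \<Rightarrow> bool" where
  "analytic_in_manifold G act M \<longleftrightarrow> (\<forall>g\<in>carrier G. analytic_map M M (act g))"

definition non_contractive :: "'g monoid \<Rightarrow> ('g \<Rightarrow> 'm \<Rightarrow> 'm) \<Rightarrow> 'm manifold \<Rightarrow> bool" where
  "non_contractive G act M \<longleftrightarrow>
     analytic_in_manifold G act M \<and>
     (\<forall>C x. C \<subseteq> topspace (mtop M) \<and> (\<exists>a\<in>C. \<exists>b\<in>C. a \<noteq> b) \<and> x \<in> topspace (mtop M) - C \<longrightarrow>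
        (\<exists>U. openin (mtop M) U \<and> x \<in> U \<and> (\<forall>g\<in>carrier G. \<not> act g ` C \<subseteq> U)))"

definition curve_stabilizer ::
  "'g monoid \<Rightarrow> ('g \<Rightarrow> 'm \<Rightarrow> 'm) \<Rightarrow> 's manifold \<Rightarrow> ('s \<Rightarrow> 'm) \<Rightarrow> 'g set" where
  "curve_stabilizer G act S \<iota> = carrier G \<inter> (\<Inter>z\<in>topspace (mtop S). stabilizer G act (\<iota> z))"

text \<open>\<open>locally_overlap M S \<iota> act g \<Sigma> \<Sigma>'\<close> is the relation between the restriction of
  \<open>g \<cdot> \<iota>\<close> to \<open>\<Sigma>\<close> and that of \<open>\<iota>\<close> to \<open>\<Sigma>'\<close>. Since \<open>\<iota>\<close> is an immersion, being an embedding on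
  an open segment is a purely topological condition.\<close>

definition locally_overlap ::
  "'m manifold \<Rightarrow> 's manifold \<Rightarrow> ('s \<Rightarrow> 'm) \<Rightarrow> ('g \<Rightarrow> 'm \<Rightarrow> 'm) \<Rightarrow> 'g \<Rightarrow> 's set \<Rightarrow> 's set \<Rightarrow> bool" where
  "locally_overlap M S \<iota> act g \<Sigma> \<Sigma>' \<longleftrightarrow>
     (\<exists>P\<in>segments S. \<exists>P'\<in>segments S. openin (mtop S) P \<and> openin (mtop S) P' \<and>
        P \<subseteq> \<Sigma> \<and> P' \<subseteq> \<Sigma>' \<and>
        embedding_map (subtopology (mtop S) P) (mtop M) \<iota> \<and>
        embedding_map (subtopology (mtop S) P') (mtop M) \<iota> \<and>
        act g ` \<iota> ` P = \<iota> ` P')"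

definition free_segments ::
  "'g monoid \<Rightarrow> ('g \<Rightarrow> 'm \<Rightarrow> 'm) \<Rightarrow> 'm manifold \<Rightarrow> 's manifold \<Rightarrow> ('s \<Rightarrow> 'm) \<Rightarrow> 's set set" where
  "free_segments G act M S \<iota> =
     {\<Sigma> \<in> segments S. \<forall>g\<in>carrier G.
        locally_overlap M S \<iota> act g \<Sigma> \<Sigma> \<longleftrightarrow> g \<in> curve_stabilizer G act S \<iota>}"

definition max_free_segments ::
  "'g monoid \<Rightarrow> ('g \<Rightarrow> 'm \<Rightarrow> 'm) \<Rightarrow> 'm manifold \<Rightarrow> 's manifold \<Rightarrow> ('s \<Rightarrow> 'm) \<Rightarrow> 's set set" where
  "max_free_segments G act M S \<iota> =
     {\<Sigma> \<in> free_segments G act M S \<iota>.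
        \<forall>\<Sigma>'\<in>free_segments G act M S \<iota>. \<Sigma> \<subseteq> \<Sigma>' \<longrightarrow> \<Sigma>' = \<Sigma>}"

definition free_submanifold ::
  "'g monoid \<Rightarrow> ('g \<Rightarrow> 'm \<Rightarrow> 'm) \<Rightarrow> 'm manifold \<Rightarrow> 's manifold \<Rightarrow> ('s \<Rightarrow> 'm) \<Rightarrow> bool" where
  "free_submanifold G act M S \<iota> \<longleftrightarrow> free_segments G act M S \<iota> \<noteq> {}"

text \<open>
  The decompositions \<open>(n, \<Sigma>\<^sub>0, \<dots>, \<Sigma>\<^sub>n, [g\<^sub>0], \<dots>, [g\<^sub>n])\<close> belonging to \<open>\<Sigma>\<close>. The two families are
  extensional functions on \<open>{..n}\<close>, so that equality of triples is equality of decompositions.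
\<close>

definition decompositions ::
  "'g monoid \<Rightarrow> ('g \<Rightarrow> 'm \<Rightarrow> 'm) \<Rightarrow> 'm manifold \<Rightarrow> 's manifold \<Rightarrow> ('s \<Rightarrow> 'm) \<Rightarrow> 's set \<Rightarrow>
     (nat \<times> (nat \<Rightarrow> 's set) \<times> (nat \<Rightarrow> 'g set)) set" where
  "decompositions G act M S \<iota> \<Sigma> =
     {(n, \<sigma>, c). 1 \<le> n \<and>
        \<Sigma> \<in> max_free_segments G act M S \<iota> \<and> \<Sigma> \<subset> topspace (mtop S) \<and>
        \<sigma> \<in> {..n} \<rightarrow>\<^sub>E max_free_segments G act M S \<iota> \<and>
        c \<in> {..n} \<rightarrow>\<^sub>E lcosets\<^bsub>G\<^esub> (curve_stabilizer G act S \<iota>) \<and>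
        (\<forall>k\<le>n. compactin (mtop S) (\<sigma> k)) \<and>
        \<sigma> 0 = \<Sigma> \<and>
        topspace (mtop S) = (\<Union>k\<le>n. \<sigma> k) \<and>
        (\<forall>k\<le>n. \<exists>g\<in>carrier G.
           c k = g <#\<^bsub>G\<^esub> curve_stabilizer G act S \<iota> \<and> act g ` \<iota> ` \<sigma> 0 = \<iota> ` \<sigma> k) \<and>
        (n = 1 \<longrightarrow>
           \<sigma> 0 \<inter> \<sigma> 1 = seg_boundary S (\<sigma> 0) \<inter> seg_boundary S (\<sigma> 1) \<and>
           \<sigma> 0 \<inter> \<sigma> 1 = seg_boundary S (\<sigma> 0) \<and> \<sigma> 0 \<inter> \<sigma> 1 = seg_boundary S (\<sigma> 1) \<and>
           card (\<sigma> 0 \<inter> \<sigma> 1) = 2) \<and>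
        (2 \<le> n \<longrightarrow> (\<forall>p\<le>n. \<forall>q\<le>n.
           (\<bar>int p - int q\<bar> \<in> {1, int n} \<longrightarrow>
              \<sigma> p \<inter> \<sigma> q = seg_boundary S (\<sigma> p) \<inter> seg_boundary S (\<sigma> q) \<and> is_singleton (\<sigma> p \<inter> \<sigma> q)) \<and>
           (2 \<le> \<bar>int p - int q\<bar> \<and> \<bar>int p - int q\<bar> \<le> int n - 1 \<longrightarrow> \<sigma> p \<inter> \<sigma> q = {})))}"

definition reversal_index :: "nat \<Rightarrow> nat \<Rightarrow> nat" where
  "reversal_index n k = (if k = 0 then 0 else n - (k - 1))"

definition reversed_decomposition ::
  "nat \<times> (nat \<Rightarrow> 's set) \<times> (nat \<Rightarrow> 'g set) \<Rightarrow> nat \<times> (nat \<Rightarrow> 's set) \<times> (nat \<Rightarrow> 'g set)" where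
  "reversed_decomposition =
     (\<lambda>(n, \<sigma>, c). (n, \<lambda>k\<in>{..n}. \<sigma> (reversal_index n k), \<lambda>k\<in>{..n}. c (reversal_index n k)))"

definition is_length ::
  "'g monoid \<Rightarrow> ('g \<Rightarrow> 'm \<Rightarrow> 'm) \<Rightarrow> 'm manifold \<Rightarrow> 's manifold \<Rightarrow> ('s \<Rightarrow> 'm) \<Rightarrow> nat \<Rightarrow> bool" where
  "is_length G act M S \<iota> n \<longleftrightarrow>
     (\<exists>\<Sigma>\<in>max_free_segments G act M S \<iota>. \<exists>\<sigma> c. (n, \<sigma>, c) \<in> decompositions G act M S \<iota> \<Sigma>)"

definition submanifold_length ::
  "'g monoid \<Rightarrow> ('g \<Rightarrow> 'm \<Rightarrow> 'm) \<Rightarrow> 'm manifold \<Rightarrow> 's manifold \<Rightarrow> ('s \<Rightarrow> 'm) \<Rightarrow> nat" where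
  "submanifold_length G act M S \<iota> = (THE n. is_length G act M S \<iota> n)"

end

theory Submission
  imports Defs "HOL-Complex_Analysis.Complex_Analysis"
begin

text \<open>
  By the identity theorem, a group element \<open>g\<close> that maps an open piece of the curve \<open>K = \<iota>(S)\<close> into \<open>K\<close>
  satisfies \<open>g K = K\<close>. Hence the elements that matter induce a group \<open>Q\<close> of homeomorphisms of the circle
  \<open>S\<close>, isomorphic to \<open>{g. g K = K} / G\<^sub>S\<close>, and a segment is free iff the non-trivial elements of \<open>Q\<close> move
  its interior off itself. Non-contractivity makes \<open>Q\<close> finite, as infinitely many disjoint translates
  of an arc would accumulate.

  A maximal free segment is a compact arc, and each of its end points is also an end point of another
  translate, for otherwise the arc could be enlarged. Starting from \<open>\<Sigma>\<close> and passing from each translate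
  to its right neighbour one walks around the circle, and disjointness of interiors forces the walk to
  close up at the initial point of \<open>\<Sigma>\<close>. In any decomposition every translate of \<open>\<Sigma>\<close> occurs exactly
  once, so \<open>n + 1 = card Q\<close>, and two decompositions with \<open>\<Sigma>\<^sub>0 = \<Sigma>\<close> differ by a permutation of \<open>{0..n}\<close>
  that fixes \<open>0\<close> and preserves cyclic adjacency: the identity or the reversal.
\<close>

section \<open>Real analytic functions of one variable\<close>

text \<open>Only restrictions to curves are ever compared, so analyticity is reduced to one real
  variable and expressed by a holomorphic extension to a disc; the identity theorem is then the
  complex one. Two points need care: the power series on \<open>M\<close> have several variables,
  and two curves coincide only up to a change of parameter. Passing to closures or to unions of
  chains can create new interior points. Freeness survives because the interior of a segment is
  dense in it; this yields maximal free segments by Zorn's lemma and makes them closed. Elements of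
  \<open>Q\<close> may reverse orientation (dihedral groups occur), so the circle cannot be tiled by
  iterating one rotation. Each translate must be shown to have a right neighbour of its own.
  Finiteness of \<open>Q\<close> enters twice here: it gives one \<delta> by which an arc without
  neighbour could be prolonged, and it keeps infinitely many tiles from fitting into one
  turn.\<close>

definition real_analytic_at :: "(real \<Rightarrow> real) \<Rightarrow> real \<Rightarrow> bool" where
  "real_analytic_at f t \<longleftrightarrow>
     (\<exists>r>0. \<exists>F. F holomorphic_on ball (complex_of_real t) r \<and>
        (\<forall>s. \<bar>s - t\<bar> < r \<longrightarrow> F (complex_of_real s) = complex_of_real (f s)))"

lemma real_analytic_at_id: "real_analytic_at (\<lambda>t. t) t"
  unfolding real_analytic_at_def
  by (rule exI[of _ 1], simp, rule exI[of _ "\<lambda>z. z"], simp)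

lemma real_analytic_at_cong:
  assumes "real_analytic_at f t" "eventually (\<lambda>s. f s = g s) (nhds t)"
  shows "real_analytic_at g t"
proof -
  obtain r F where r: "r > 0" "F holomorphic_on ball (complex_of_real t) r"
    "\<And>s. \<bar>s - t\<bar> < r \<Longrightarrow> F (complex_of_real s) = complex_of_real (f s)"
    using assms(1) unfolding real_analytic_at_def by blast
  obtain d where d: "d > 0" "\<And>s. dist s t < d \<Longrightarrow> f s = g s"
    using assms(2) unfolding eventually_nhds_metric by blast
  show ?thesis
    unfolding real_analytic_at_def
  proof (intro exI conjI allI impI)
    show "min r d > 0" using r d by simp
    show "F holomorphic_on ball (complex_of_real t) (min r d)"
      by (rule holomorphic_on_subset[OF r(2)]) auto
    show "F (complex_of_real s) = complex_of_real (g s)" if "\<bar>s - t\<bar> < min r d" for s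
      using that r(3)[of s] d(2)[of s] by (simp add: dist_real_def)
  qed
qed

text \<open>Finitely many positive radii have a positive minimum. It lets all components of a curve
  be treated on one disc.\<close>

lemma uniform_radius:
  fixes P :: "nat \<Rightarrow> real \<Rightarrow> bool"
  assumes "\<And>i. i < n \<Longrightarrow> \<exists>r>0. P i r"
    and "\<And>i r r'. P i r \<Longrightarrow> 0 < r' \<Longrightarrow> r' \<le> r \<Longrightarrow> P i r'"
  shows "\<exists>r>0. \<forall>i<n. P i r"
  using assms(1)
proof (induction n)
  case 0
  show ?case by (rule exI[of _ 1]) simp
next
  case (Suc n)
  obtain r where r: "r > 0" "\<forall>i<n. P i r" using Suc by (meson less_SucI)
  obtain r' where r': "r' > 0" "P n r'" using Suc.prems by blast
  show ?case
    by (rule exI[of _ "min r r'"]) (use r r' assms(2) in \<open>auto simp: less_Suc_eq\<close>)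
qed

lemma real_analytic_at_common_ball:
  fixes f :: "nat \<Rightarrow> real \<Rightarrow> real"
  assumes "\<forall>i<m. real_analytic_at (f i) t"
  shows "\<exists>r>0. \<exists>F. \<forall>i<m. F i holomorphic_on ball (complex_of_real t) r \<and>
    (\<forall>s. \<bar>s - t\<bar> < r \<longrightarrow> F i (complex_of_real s) = complex_of_real (f i s))"
proof -
  define P where "P = (\<lambda>F i r. F holomorphic_on ball (complex_of_real t) r \<and>
        (\<forall>s. \<bar>s - t\<bar> < r \<longrightarrow> F (complex_of_real s) = complex_of_real (f i s)))"
  have "\<exists>F. i < m \<longrightarrow> (\<exists>r>0. P F i r)" for i
    using assms[rule_format, of i] unfolding real_analytic_at_def P_def by blast
  then obtain F where F: "\<And>i. i < m \<Longrightarrow> \<exists>r>0. P (F i) i r" using choice[of "\<lambda>i F. i < m \<longrightarrow> (\<exists>r>0. P F i r)"] by auto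
  have "\<exists>r>0. \<forall>i<m. P (F i) i r"
  proof (rule uniform_radius)
    fix i assume "i < m" then show "\<exists>r>0. P (F i) i r" by (rule F)
  next
    fix i r r' assume *: "P (F i) i r" "0 < r'" "r' \<le> r"
    from *(3) have "ball (complex_of_real t) r' \<subseteq> ball (complex_of_real t) r" by auto
    then have "F i holomorphic_on ball (complex_of_real t) r'"
      using *(1) holomorphic_on_subset[of "F i" "ball (complex_of_real t) r"] unfolding P_def by simp
    then show "P (F i) i r'" using *(1,3) unfolding P_def by auto
  qed
  then show ?thesis unfolding P_def by blast
qed

text \<open>Absolute convergence at the diagonal point x + (\<rho>, ..., \<rho>) majorizes every
  term on the polydisc of radius \<rho> around \<open>x\<close>. Inserting the holomorphic
  extensions of the \<open>c i\<close> therefore gives a uniform limit of holomorphic functions near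
  \<open>t\<close>, which extends \<open>F\<close> along the curve.\<close>

lemma power_series_along_curve:
  assumes V: "openin (Euclidean_space n) V" "x \<in> V"
    and ps: "\<And>y. y \<in> V \<Longrightarrow> ((\<lambda>\<alpha>. a \<alpha> * (\<Prod>i<n. (y i - x i) ^ \<alpha> i)) has_sum F y)
                 {\<alpha> :: nat \<Rightarrow> nat. \<forall>i\<ge>n. \<alpha> i = 0}"
    and c: "\<And>i. i < n \<Longrightarrow> real_analytic_at (c i) t" "\<And>i. i < n \<Longrightarrow> c i t = x i"
    and cV: "eventually (\<lambda>s. (\<lambda>i. if i < n then c i s else 0) \<in> V) (nhds t)"
  shows "real_analytic_at (\<lambda>s. F (\<lambda>i. if i < n then c i s else 0)) t"
proof -
  let ?A = "{\<alpha> :: nat \<Rightarrow> nat. \<forall>i\<ge>n. \<alpha> i = 0}"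
  have x0: "\<And>i. i \<ge> n \<Longrightarrow> x i = 0"
    using openin_subset[OF V(1)] V(2) by (auto simp: topspace_Euclidean_space)
  \<comment> \<open>\<open>line\<close> runs along the diagonal through \<open>x\<close>. As
    \<open>V\<close> is open, it contains a point whose displacements from \<open>x\<close> all
    equal one positive \<rho>.\<close>
  define line where "line = (\<lambda>\<tau> i. if i < n then x i + \<tau> else (0::real))"
  have "continuous_map euclideanreal (Euclidean_space n) line"
    unfolding line_def by (subst continuous_map_componentwise_Euclidean_space)
      (simp add: continuous_intros)
  then have "openin euclideanreal {\<tau> \<in> topspace euclideanreal. line \<tau> \<in> V}"
    using V(1) openin_continuous_map_preimage by blast
  then have "open {\<tau>. line \<tau> \<in> V}" by simp
  moreover have "line 0 = x" using x0 by (auto simp: line_def fun_eq_iff)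
  ultimately obtain e where e: "e > 0" "ball 0 e \<subseteq> {\<tau>. line \<tau> \<in> V}"
    using V(2) open_contains_ball by (metis mem_Collect_eq)
  define \<rho> where "\<rho> = e / 2"
  have \<rho>: "\<rho> > 0" "line \<rho> \<in> V" using e by (auto simp: \<rho>_def subset_iff dist_real_def)
  have "(\<lambda>\<alpha>. a \<alpha> * (\<Prod>i<n. (line \<rho> i - x i) ^ \<alpha> i)) summable_on ?A"
    using ps[OF \<rho>(2)] has_sum_imp_summable by blast
  then have "(\<lambda>\<alpha>. a \<alpha> * (\<Prod>i<n. \<rho> ^ \<alpha> i)) summable_on ?A"
    by (simp add: line_def cong: prod.cong_simp)
  \<comment> \<open>Unconditional summability of a real family is absolute, so these are summable
    constants for the Weierstrass test below.\<close>
  then have M: "(\<lambda>\<alpha>. \<bar>a \<alpha>\<bar> * (\<Prod>i<n. \<rho> ^ \<alpha> i)) summable_on ?A"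
    using \<rho>(1) by (subst (asm) summable_on_iff_abs_summable_on_real)
      (simp add: abs_mult abs_prod power_abs)
  have "\<forall>i<n. real_analytic_at (c i) t" using c(1) by blast
  from real_analytic_at_common_ball[OF this] obtain R C where R_pos: "R > 0"
    and R_all: "\<forall>i < n. C i holomorphic_on ball (complex_of_real t) R \<and> (\<forall>s. \<bar>s - t\<bar> < R \<longrightarrow> C i (complex_of_real s) = complex_of_real (c i s))"
    by (elim exE conjE)
  then have C: "R > 0"
    "\<And>i. i < n \<Longrightarrow> C i holomorphic_on ball (complex_of_real t) R"
    "\<And>i s. i < n \<Longrightarrow> \<bar>s - t\<bar> < R \<Longrightarrow> C i (complex_of_real s) = complex_of_real (c i s)"
    by auto
  have "\<exists>r>0. \<forall>i<n. \<forall>z\<in>ball (complex_of_real t) r. norm (C i z - of_real (x i)) \<le> \<rho>"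
  proof (rule uniform_radius)
    fix i assume i: "i < n"
    have "isCont (C i) (complex_of_real t)"
      using holomorphic_on_imp_continuous_on[OF C(2)[OF i]] C(1)
      by (simp add: continuous_on_eq_continuous_at)
    moreover have "C i (complex_of_real t) = of_real (x i)" using C(1,3) c(2) i by auto
    ultimately obtain d where "d > 0"
      "\<And>z. dist z (complex_of_real t) < d \<Longrightarrow> dist (C i z) (of_real (x i)) < \<rho>"
      using \<rho>(1) unfolding continuous_at_eps_delta by metis
    then show "\<exists>r>0. \<forall>z\<in>ball (complex_of_real t) r. norm (C i z - of_real (x i)) \<le> \<rho>"
      by (intro exI[of _ d]) (auto simp: dist_commute dist_norm less_imp_le)
  qed auto
  then obtain r' where r': "r' > 0"
    "\<And>i z. i < n \<Longrightarrow> z \<in> ball (complex_of_real t) r' \<Longrightarrow> norm (C i z - of_real (x i)) \<le> \<rho>"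
    by blast
  define r where "r = min R r'"
  have r: "r > 0"
    "\<And>i. i < n \<Longrightarrow> C i holomorphic_on ball (complex_of_real t) r"
    "\<And>i s. i < n \<Longrightarrow> \<bar>s - t\<bar> < r \<Longrightarrow> C i (complex_of_real s) = complex_of_real (c i s)"
    "\<And>i z. i < n \<Longrightarrow> z \<in> ball (complex_of_real t) r \<Longrightarrow> norm (C i z - of_real (x i)) \<le> \<rho>"
  proof -
    show "C i holomorphic_on ball (complex_of_real t) r" if "i < n" for i
      by (rule holomorphic_on_subset[OF C(2)[OF that]]) (auto simp: r_def)
  qed (use C(1,3) r' in \<open>auto simp: r_def\<close>)
  define T where "T = (\<lambda>\<alpha> z. of_real (a \<alpha>) * (\<Prod>i<n. (C i z - of_real (x i)) ^ \<alpha> i))"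
  define H where "H = (\<lambda>z. \<Sum>\<^sub>\<infinity>\<alpha>\<in>?A. T \<alpha> z)"
  have sub: "cball (complex_of_real t) (r / 2) \<subseteq> ball (complex_of_real t) r"
    using r(1) by auto
  have Thol: "T \<alpha> holomorphic_on ball (complex_of_real t) r" for \<alpha>
    unfolding T_def using r(2) by (auto intro!: holomorphic_intros)
  have ul: "uniform_limit (cball (complex_of_real t) (r / 2)) (\<lambda>X z. \<Sum>\<alpha>\<in>X. T \<alpha> z) H
     (finite_subsets_at_top ?A)"
    unfolding H_def
  proof (rule Weierstrass_m_test_general[OF _ M])
    fix \<alpha> z assume z: "z \<in> cball (complex_of_real t) (r / 2)"
    have "norm (T \<alpha> z) = \<bar>a \<alpha>\<bar> * (\<Prod>i<n. norm (C i z - of_real (x i)) ^ \<alpha> i)"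
      by (simp add: T_def norm_mult prod_norm[symmetric] norm_power)
    also have "\<dots> \<le> \<bar>a \<alpha>\<bar> * (\<Prod>i<n. \<rho> ^ \<alpha> i)"
      by (intro mult_left_mono prod_mono conjI power_mono) (use r(4) z sub in auto)
    finally show "norm (T \<alpha> z) \<le> \<bar>a \<alpha>\<bar> * (\<Prod>i<n. \<rho> ^ \<alpha> i)" .
  qed
  have "H holomorphic_on ball (complex_of_real t) (r / 2)"
  proof (rule holomorphic_uniform_limit[OF _ ul])
    show "\<forall>\<^sub>F X in finite_subsets_at_top ?A.
       continuous_on (cball (complex_of_real t) (r / 2)) (\<lambda>z. \<Sum>\<alpha>\<in>X. T \<alpha> z) \<and>
       (\<lambda>z. \<Sum>\<alpha>\<in>X. T \<alpha> z) holomorphic_on ball (complex_of_real t) (r / 2)"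
    proof (intro always_eventually allI)
      fix X
      have "(\<lambda>z. \<Sum>\<alpha>\<in>X. T \<alpha> z) holomorphic_on ball (complex_of_real t) r"
        using Thol by (intro holomorphic_on_sum) auto
      then show "continuous_on (cball (complex_of_real t) (r / 2)) (\<lambda>z. \<Sum>\<alpha>\<in>X. T \<alpha> z) \<and>
       (\<lambda>z. \<Sum>\<alpha>\<in>X. T \<alpha> z) holomorphic_on ball (complex_of_real t) (r / 2)"
        using sub ball_subset_cball holomorphic_on_imp_continuous_on holomorphic_on_subset
        by (metis (no_types, lifting) continuous_on_subset order_trans)
    qed
  qed auto
  moreover obtain d where d: "d > 0" "\<And>s. dist s t < d \<Longrightarrow> (\<lambda>i. if i < n then c i s else 0) \<in> V"
    using cV unfolding eventually_nhds_metric by blast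
  ultimately show ?thesis
    unfolding real_analytic_at_def
  proof (intro exI conjI allI impI)
    show "min (r / 2) d > 0" using r d by simp
    show "H holomorphic_on ball (complex_of_real t) (min (r / 2) d)"
      if "H holomorphic_on ball (complex_of_real t) (r / 2)"
      by (rule holomorphic_on_subset[OF that]) auto
    fix s assume s: "\<bar>s - t\<bar> < min (r / 2) d"
    let ?y = "\<lambda>i. if i < n then c i s else 0"
    have "((\<lambda>\<alpha>. a \<alpha> * (\<Prod>i<n. (?y i - x i) ^ \<alpha> i)) has_sum F ?y) ?A"
      using s by (intro ps d(2)) (simp add: dist_real_def)
    then have "((\<lambda>\<alpha>. complex_of_real (a \<alpha> * (\<Prod>i<n. (?y i - x i) ^ \<alpha> i))) has_sum
       complex_of_real (F ?y)) ?A"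
      by (rule has_sum_of_real)
    moreover have "complex_of_real (a \<alpha> * (\<Prod>i<n. (?y i - x i) ^ \<alpha> i)) = T \<alpha> (of_real s)" for \<alpha>
      unfolding T_def using s r(1) r(3)[of _ s] by (simp cong: prod.cong_simp)
    ultimately show "H (complex_of_real s) = complex_of_real (F ?y)"
      unfolding H_def by (simp add: infsumI)
  qed
qed

lemma real_analytic_at_isCont:
  assumes "real_analytic_at f t"
  shows "isCont f t"
proof -
  obtain r F where r: "r > 0" "F holomorphic_on ball (complex_of_real t) r"
    "\<And>s. \<bar>s - t\<bar> < r \<Longrightarrow> F (complex_of_real s) = complex_of_real (f s)"
    using assms unfolding real_analytic_at_def by blast
  have F: "isCont F (complex_of_real t)"
    using holomorphic_on_imp_continuous_on[OF r(2)] r(1)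
    by (simp add: continuous_on_eq_continuous_at)
  have "isCont (\<lambda>s. F (complex_of_real s)) t"
    by (rule isCont_o2[where f = complex_of_real and g = F]) (simp_all add: F)
  then have "isCont (\<lambda>s. Re (F (complex_of_real s))) t"
    by (rule isCont_Re)
  moreover have "eventually (\<lambda>s. Re (F (complex_of_real s)) = f s) (nhds t)"
    unfolding eventually_nhds_metric using r by (auto simp: dist_real_def)
  ultimately show ?thesis using isCont_cong[of "\<lambda>s. Re (F (complex_of_real s))" f t] by simp
qed

text \<open>The inverse of the complexification of \<open>f j\<close> expresses the parameter \<open>r\<close> as a holomorphic
  function of \<open>t\<close>, so that the identity theorem applies to the remaining coordinates.\<close>

lemma real_analytic_curves_coincide:
  fixes f g :: "nat \<Rightarrow> real \<Rightarrow> real"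
  assumes f: "\<And>i. i < m \<Longrightarrow> real_analytic_at (f i) r0"
    and g: "\<And>i. i < m \<Longrightarrow> real_analytic_at (g i) t0"
    and j: "j < m" "f j r0 = g j t0" "(f j has_real_derivative d) (at r0)" "d \<noteq> 0"
    and meet: "\<And>\<epsilon>. \<epsilon> > 0 \<Longrightarrow> \<exists>t r. t \<noteq> t0 \<and> \<bar>t - t0\<bar> < \<epsilon> \<and> \<bar>r - r0\<bar> < \<epsilon> \<and> (\<forall>i<m. f i r = g i t)"
    and \<epsilon>: "\<epsilon> > 0"
  shows "eventually (\<lambda>t. \<exists>r. \<bar>r - r0\<bar> < \<epsilon> \<and> (\<forall>i<m. f i r = g i t)) (nhds t0)"
proof -
  have "\<forall>i<m. real_analytic_at (f i) r0" using f by blast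
  from real_analytic_at_common_ball[OF this] obtain R F where R_pos: "R > 0"
    and R_all: "\<forall>i < m. F i holomorphic_on ball (complex_of_real r0) R \<and> (\<forall>s. \<bar>s - r0\<bar> < R \<longrightarrow> F i (complex_of_real s) = complex_of_real (f i s))"
    by (elim exE conjE)
  then have R: "R > 0"
    "\<And>i. i < m \<Longrightarrow> F i holomorphic_on ball (complex_of_real r0) R"
    "\<And>i s. i < m \<Longrightarrow> \<bar>s - r0\<bar> < R \<Longrightarrow> F i (complex_of_real s) = complex_of_real (f i s)"
    by auto
  have "\<forall>i<m. real_analytic_at (g i) t0" using g by blast
  from real_analytic_at_common_ball[OF this] obtain Q H where Q_pos: "Q > 0"
    and Q_all: "\<forall>i < m. H i holomorphic_on ball (complex_of_real t0) Q \<and> (\<forall>s. \<bar>s - t0\<bar> < Q \<longrightarrow> H i (complex_of_real s) = complex_of_real (g i s))"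
    by (elim exE conjE)
  then have Q: "Q > 0"
    "\<And>i. i < m \<Longrightarrow> H i holomorphic_on ball (complex_of_real t0) Q"
    "\<And>i s. i < m \<Longrightarrow> \<bar>s - t0\<bar> < Q \<Longrightarrow> H i (complex_of_real s) = complex_of_real (g i s)"
    by auto
  \<comment> \<open>On the real line the complex derivative of \<open>F j\<close> is the real
    derivative \<open>d\<close>, hence nonzero, and \<open>F j\<close> is locally
    invertible.\<close>
  have Fder: "(F j has_field_derivative deriv (F j) (complex_of_real r0)) (at (complex_of_real r0))"
    using R(2)[OF j(1)] R(1) by (intro holomorphic_derivI[of _ "ball (complex_of_real r0) R"]) auto
  have "((\<lambda>s. F j (complex_of_real s)) has_vector_derivative deriv (F j) (complex_of_real r0)) (at r0)"
    using has_vector_derivative_real_field[OF Fder] by simp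
  then have "((\<lambda>s. F j (complex_of_real s)) has_vector_derivative complex_of_real d) (at r0) \<longrightarrow>
      deriv (F j) (complex_of_real r0) = complex_of_real d"
    using vector_derivative_unique_at by blast
  moreover have "((\<lambda>s. F j (complex_of_real s)) has_vector_derivative complex_of_real d) (at r0)"
  proof (rule has_vector_derivative_transform_within_open[of "\<lambda>s. complex_of_real (f j s)" _ _ "ball r0 R"])
    show "((\<lambda>s. complex_of_real (f j s)) has_vector_derivative complex_of_real d) (at r0)"
      using has_vector_derivative_of_real[of "f j" d "at r0"] j(3)
      by (simp add: has_real_derivative_iff_has_vector_derivative)
  qed (use R(1) R(3)[OF j(1)] in \<open>auto simp: dist_real_def abs_minus_commute\<close>)
  ultimately have "deriv (F j) (complex_of_real r0) \<noteq> 0"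
    using j(4) by simp
  then obtain q where q: "q > 0" "ball (complex_of_real r0) q \<subseteq> ball (complex_of_real r0) R"
     "open (F j ` ball (complex_of_real r0) q)" "inj_on (F j) (ball (complex_of_real r0) q)"
    using has_complex_derivative_locally_invertible[OF R(2)[OF j(1)], of "complex_of_real r0"] R(1)
    by (metis centre_in_ball open_ball)
  define B where "B = ball (complex_of_real r0) q"
  have FB: "F j holomorphic_on B"
    unfolding B_def using R(2)[OF j(1)] q(2) by (rule holomorphic_on_subset)
  obtain k where k: "k holomorphic_on F j ` B" "\<And>z. z \<in> B \<Longrightarrow> k (F j z) = z"
    by (rule holomorphic_has_inverse[OF FB]) (use q(4) in \<open>auto simp: B_def\<close>)
  have r0B: "complex_of_real r0 \<in> B" using q by (simp add: B_def)
  have Hj: "H j (complex_of_real t0) = F j (complex_of_real r0)"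
    using R(1,3) Q(1,3) j by auto
  have "isCont (H j) (complex_of_real t0)"
    using holomorphic_on_imp_continuous_on[OF Q(2)[OF j(1)]] Q(1)
    by (simp add: continuous_on_eq_continuous_at)
  moreover have "open (F j ` B)" "H j (complex_of_real t0) \<in> F j ` B"
    using q(3) r0B Hj by (auto simp: B_def)
  ultimately obtain U where U: "open U" "complex_of_real t0 \<in> U" "\<forall>z\<in>U. H j z \<in> F j ` B"
    unfolding continuous_at_open by blast
  then obtain p where p: "p > 0" "\<And>z. dist z (complex_of_real t0) < p \<Longrightarrow> H j z \<in> F j ` B"
    unfolding open_dist by blast
  define P where "P = ball (complex_of_real t0) (min p Q)"
  have P: "open P" "connected P" "complex_of_real t0 \<in> P" "H j ` P \<subseteq> F j ` B"
    using p Q(1) by (auto simp: P_def dist_commute)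
  have q': "\<bar>s - r0\<bar> < R" "complex_of_real s \<in> B" if "\<bar>s - r0\<bar> < q" for s
  proof -
    have "complex_of_real s \<in> ball (complex_of_real r0) q"
      using that by (simp add: dist_of_real dist_real_def abs_minus_commute)
    moreover from this have "complex_of_real s \<in> ball (complex_of_real r0) R"
      using q(2) by (rule subsetD[rotated])
    ultimately show "\<bar>s - r0\<bar> < R" "complex_of_real s \<in> B"
      by (simp_all add: B_def dist_of_real dist_real_def abs_minus_commute)
  qed
  \<comment> \<open>\<open>k (H j z)\<close> is the parameter at which the first curve has
    \<open>j\<close>-th coordinate \<open>H j z\<close>. Both sides are holomorphic on the disc
    \<open>P\<close> and agree at the parameters supplied by \<open>meet\<close>, which accumulate
    at \<open>t0\<close>.\<close>
  have key: "F i (k (H j z)) = H i z" if i: "i < m" and z: "z \<in> P" for i z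
  proof -
    define \<Phi> where "\<Phi> = (\<lambda>z. F i (k (H j z)) - H i z)"
    have PQ: "P \<subseteq> ball (complex_of_real t0) Q" by (auto simp: P_def)
    have HP: "H i holomorphic_on P" "H j holomorphic_on P"
      using holomorphic_on_subset[OF Q(2)[OF i] PQ] holomorphic_on_subset[OF Q(2)[OF j(1)] PQ]
      by simp_all
    have kH: "(\<lambda>z. k (H j z)) holomorphic_on P"
      using holomorphic_on_compose_gen[OF HP(2) k(1)] P(4) by (auto simp: o_def)
    have "k ` H j ` P \<subseteq> ball (complex_of_real r0) R"
    proof clarify
      fix w assume "w \<in> P"
      then obtain b where b: "b \<in> B" "H j w = F j b" using P(4) by blast
      then show "k (H j w) \<in> ball (complex_of_real r0) R" using k(2)[OF b(1)] q(2) by (auto simp: B_def)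
    qed
    then have "(\<lambda>z. F i (k (H j z))) holomorphic_on P"
      using holomorphic_on_compose_gen[OF kH R(2)[OF i]] by (auto simp: o_def)
    then have hol: "\<Phi> holomorphic_on P"
      unfolding \<Phi>_def using HP(1) by (intro holomorphic_intros)
    define Z where "Z = {z \<in> P. \<Phi> z = 0}"
    have lim: "complex_of_real t0 islimpt Z"
      unfolding islimpt_approachable
    proof (intro allI impI)
      fix e :: real assume e: "e > 0"
      define e' where "e' = min (min e q) (min p Q)"
      have "e' > 0" using e q p Q by (simp add: e'_def)
      then obtain t r where tr: "t \<noteq> t0" "\<bar>t - t0\<bar> < e'" "\<bar>r - r0\<bar> < e'" "\<forall>i<m. f i r = g i t"
        using meet by blast
      have r: "\<bar>r - r0\<bar> < R" "complex_of_real r \<in> B" using q' tr(3) by (auto simp: e'_def)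
      have t: "\<bar>t - t0\<bar> < Q" using tr(2) by (auto simp: e'_def)
      have "H j (complex_of_real t) = F j (complex_of_real r)"
        using Q(3)[OF j(1) t] R(3)[OF j(1) r(1)] tr(4) j(1) by simp
      then have "\<Phi> (complex_of_real t) = 0"
        using k(2)[OF r(2)] Q(3)[OF i t] R(3)[OF i r(1)] tr(4) i by (simp add: \<Phi>_def)
      moreover have "complex_of_real t \<in> P"
        using tr(2) by (auto simp: P_def e'_def dist_of_real dist_real_def abs_minus_commute)
      ultimately show "\<exists>x'\<in>Z. x' \<noteq> complex_of_real t0 \<and> dist x' (complex_of_real t0) < e"
        using tr by (intro bexI[of _ "complex_of_real t"])
          (auto simp: Z_def e'_def dist_of_real dist_real_def)
    qed
    have "\<Phi> z = 0"
      by (rule analytic_continuation[OF hol P(1,2) _ P(3) lim _ z]) (auto simp: Z_def)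
    then show ?thesis by (simp add: \<Phi>_def)
  qed
  \<comment> \<open>The parameter \<open>k (H j t)\<close> must be real. The real map
    \<open>f j\<close> is continuous and injective on the interval \<open>I\<close>, so its image is
    open and contains \<open>g j t\<close> for all \<open>t\<close> near \<open>t0\<close>.\<close>
  define I where "I = ball r0 (min \<epsilon> q)"
  have I: "\<bar>s - r0\<bar> < \<epsilon>" "\<bar>s - r0\<bar> < R" "complex_of_real s \<in> B" if "s \<in> I" for s
  proof -
    have s: "\<bar>s - r0\<bar> < \<epsilon>" "\<bar>s - r0\<bar> < q"
      using that by (simp_all add: I_def dist_real_def abs_minus_commute)
    show "\<bar>s - r0\<bar> < \<epsilon>" "\<bar>s - r0\<bar> < R" "complex_of_real s \<in> B"
      by (rule s(1), rule q'(1)[OF s(2)], rule q'(2)[OF s(2)])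
  qed
  have Ij: "complex_of_real (f j s) = F j (complex_of_real s)" if "s \<in> I" for s
    using R(3)[OF j(1)] I(2)[OF that] by simp
  have "continuous_on I (\<lambda>s. F j (complex_of_real s))"
  proof (rule continuous_on_compose2[where g = "F j" and f = complex_of_real and t = B])
    show "continuous_on B (F j)" using FB by (rule holomorphic_on_imp_continuous_on)
    show "continuous_on I complex_of_real" by (intro continuous_on_of_real continuous_on_id)
    show "complex_of_real ` I \<subseteq> B" using I(3) by blast
  qed
  then have "continuous_on I (\<lambda>s. Re (F j (complex_of_real s)))"
    by (rule continuous_on_Re)
  then have "continuous_on I (f j)"
    by (rule continuous_on_eq) (metis Ij Re_complex_of_real)
  moreover have "inj_on (f j) I"
  proof (rule inj_onI)
    fix x y assume xy: "x \<in> I" "y \<in> I" "f j x = f j y"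
    then have "F j (complex_of_real x) = F j (complex_of_real y)"
      using Ij[OF xy(1)] Ij[OF xy(2)] by simp
    moreover have "complex_of_real x \<in> ball (complex_of_real r0) q"
        "complex_of_real y \<in> ball (complex_of_real r0) q"
      using I(3)[OF xy(1)] I(3)[OF xy(2)] unfolding B_def by blast+
    ultimately have "complex_of_real x = complex_of_real y" by (rule inj_onD[OF q(4)])
    then show "x = y" by simp
  qed
  ultimately have "open (f j ` I)"
    by (intro invariance_of_domain) (auto simp: I_def)
  moreover have "g j t0 \<in> f j ` I"
    using j(2) \<epsilon> q(1) by (intro image_eqI[of _ _ r0]) (auto simp: I_def)
  ultimately have "eventually (\<lambda>t. g j t \<in> f j ` I) (nhds t0)"
    using real_analytic_at_isCont[OF g[OF j(1)]]
    unfolding continuous_at_open eventually_nhds by blast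
  moreover have "eventually (\<lambda>t. \<bar>t - t0\<bar> < min p Q) (nhds t0)"
    unfolding eventually_nhds_metric using p(1) Q(1)
    by (intro exI[of _ "min p Q"]) (auto simp: dist_real_def)
  ultimately show ?thesis
  proof eventually_elim
    case (elim t)
    then obtain r where r: "r \<in> I" "g j t = f j r" by blast
    have t: "complex_of_real t \<in> P" "\<bar>t - t0\<bar> < Q"
      using elim(2) by (auto simp: P_def dist_of_real dist_real_def abs_minus_commute)
    have "H j (complex_of_real t) = F j (complex_of_real r)"
      using Q(3)[OF j(1) t(2)] Ij[OF r(1)] r(2) by simp
    then have "f i r = g i t" if "i < m" for i
      using key[OF that t(1)] k(2)[OF I(3)[OF r(1)]] R(3)[OF that I(2)[OF r(1)]] Q(3)[OF that t(2)]
      by simp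
    then show ?case using I(1)[OF r(1)] by blast
  qed
qed

section \<open>Segments of the circle\<close>

text \<open>The model is the covering of the circle by the line, \<open>t\<close> going to exp(2 pi
  i t), with period 1. Arcs are then handled as real intervals, up to integer shifts.\<close>

locale circle_parametrization =
  fixes X :: "'s topology" and e :: "real \<Rightarrow> 's"
  assumes e_continuous: "continuous_map euclideanreal X e"
    and e_open: "open_map euclideanreal X e"
    and e_surj: "range e = topspace X"
    and e_eq_iff: "e s = e t \<longleftrightarrow> s - t \<in> \<int>"
    and Hausdorff: "Hausdorff_space X"
begin

lemma e_in [simp]: "e t \<in> topspace X"
  using e_surj by auto

lemma e_image_subset [simp]: "e ` I \<subseteq> topspace X"
  by auto

lemma e_plus_int: "e (t + of_int k) = e t"
  by (simp add: e_eq_iff)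

lemma openin_e_image: "open U \<Longrightarrow> openin X (e ` U)"
  using e_open by (auto simp: open_map_def)

lemma open_e_preimage: "openin X U \<Longrightarrow> open {t. e t \<in> U}"
  using openin_continuous_map_preimage[OF e_continuous] by auto

lemma closed_e_preimage: "closedin X U \<Longrightarrow> closed {t. e t \<in> U}"
  using closedin_continuous_map_preimage[OF e_continuous] by auto

lemma e_mem_image_iff: "e t \<in> e ` I \<longleftrightarrow> (\<exists>k::int. t + of_int k \<in> I)"
proof
  assume "e t \<in> e ` I"
  then obtain s where s: "s \<in> I" "e s = e t" by force
  then obtain k where "s - t = of_int k" using e_eq_iff by (metis Ints_cases)
  then have "s = t + of_int k" by simp
  with s show "\<exists>k::int. t + of_int k \<in> I" by blast
qed (metis e_plus_int imageI)

lemma e_inj_on: "(\<And>s t. s \<in> I \<Longrightarrow> t \<in> I \<Longrightarrow> \<bar>s - t\<bar> < 1) \<Longrightarrow> inj_on e I"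
  by (rule inj_onI) (metis e_eq_iff Ints_nonzero_abs_less1 eq_iff_diff_eq_0)

lemma e_lift:
  assumes "x \<in> topspace X"
  obtains t where "a \<le> t" "t < a + 1" "e t = x"
proof -
  obtain s where s: "e s = x" using assms e_surj by force
  show ?thesis
  proof (rule that)
    show "e (s + of_int (- \<lfloor>s - a\<rfloor>)) = x" by (simp only: e_plus_int s)
  qed linarith+
qed

lemma compactin_arc: "compactin X (e ` {a..b})"
  using image_compactin[OF _ e_continuous, of "{a..b}"] by simp

lemma closedin_arc: "closedin X (e ` {a..b})"
  by (rule compactin_imp_closedin[OF Hausdorff compactin_arc])

lemma connectedin_e_image: "connected I \<Longrightarrow> connectedin X (e ` I)"
  using connectedin_continuous_map_image[OF e_continuous, of I] by simp

lemma topspace_eq_arc: "topspace X = e ` {a..a + 1}"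
proof
  show "topspace X \<subseteq> e ` {a..a + 1}"
  proof
    fix x assume "x \<in> topspace X"
    then obtain t where "a \<le> t" "t < a + 1" "e t = x" by (rule e_lift)
    then show "x \<in> e ` {a..a + 1}" by force
  qed
qed auto

lemma compact_space: "compact_space X"
  using compactin_arc[of 0 1] topspace_eq_arc[of 0] by (simp add: compact_space_def)

text \<open>The complementary arc has parameter length \<open>a + 1 - b > 0\<close>. A parameter
  slightly beyond an end falls into this gap: an integer shifting it into \<open>{a..b}\<close>
  would lie strictly between two consecutive integers.\<close>

lemma end_notin_interior:
  assumes "a < b" "b < a + 1"
  shows "e a \<notin> X interior_of (e ` {a..b})" "e b \<notin> X interior_of (e ` {a..b})"
proof -
  have op: "open {t. e t \<in> X interior_of (e ` {a..b})}" (is "open ?U")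
    by (rule open_e_preimage) simp
  have *: "t \<in> ?U \<Longrightarrow> \<exists>k::int. a \<le> t + of_int k \<and> t + of_int k \<le> b" for t
    using interior_of_subset[of X "e ` {a..b}"] e_mem_image_iff[of t "{a..b}"] by auto
  define d where "d = a + 1 - b"
  have d: "d > 0" using assms by (simp add: d_def)
  show "e a \<notin> X interior_of (e ` {a..b})"
  proof
    assume "e a \<in> X interior_of (e ` {a..b})"
    then obtain r where r: "r > 0" "ball a r \<subseteq> ?U" using op open_contains_ball by (metis mem_Collect_eq)
    obtain \<delta> where \<delta>: "0 < \<delta>" "\<delta> < min r d" using dense[of 0 "min r d"] r(1) d by auto
    let ?t = "a - \<delta>"
    have "?t \<in> ball a r" using \<delta> by (simp add: dist_real_def)
    then obtain k :: int where k: "a \<le> ?t + of_int k" "?t + of_int k \<le> b" using * r by blast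
    then have "real_of_int 0 < real_of_int k" "real_of_int k < real_of_int 1"
      using \<delta> by (simp_all add: d_def)
    then show False by (simp only: of_int_less_iff)
  qed
  show "e b \<notin> X interior_of (e ` {a..b})"
  proof
    assume "e b \<in> X interior_of (e ` {a..b})"
    then obtain r where r: "r > 0" "ball b r \<subseteq> ?U" using op open_contains_ball by (metis mem_Collect_eq)
    obtain \<delta> where \<delta>: "0 < \<delta>" "\<delta> < min r d" using dense[of 0 "min r d"] r(1) d by auto
    let ?t = "b + \<delta>"
    have "?t \<in> ball b r" using \<delta> by (simp add: dist_real_def)
    then obtain k :: int where k: "a \<le> ?t + of_int k" "?t + of_int k \<le> b" using * r by blast
    then have "real_of_int k < real_of_int 0" "real_of_int (- 1) < real_of_int k"
      using \<delta> by (simp_all add: d_def)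
    then show False by (simp only: of_int_less_iff)
  qed
qed

lemma interior_of_arc:
  assumes "a < b" "b < a + 1"
  shows "X interior_of (e ` {a..b}) = e ` {a<..<b}"
proof
  show "e ` {a<..<b} \<subseteq> X interior_of (e ` {a..b})"
    by (rule interior_of_maximal) (auto intro: openin_e_image)
  show "X interior_of (e ` {a..b}) \<subseteq> e ` {a<..<b}"
  proof
    fix x assume x: "x \<in> X interior_of (e ` {a..b})"
    then obtain t where t: "t \<in> {a..b}" "x = e t" using interior_of_subset[of X] by blast
    then have "t \<noteq> a" "t \<noteq> b" using end_notin_interior[OF assms] x by auto
    with t show "x \<in> e ` {a<..<b}" by auto
  qed
qed

definition segment :: "'s set \<Rightarrow> bool" where
  "segment \<Sigma> \<longleftrightarrow> connectedin X \<Sigma> \<and> (\<exists>a\<in>\<Sigma>. \<exists>b\<in>\<Sigma>. a \<noteq> b)"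

lemma segment_subset_topspace: "segment \<Sigma> \<Longrightarrow> \<Sigma> \<subseteq> topspace X"
  by (auto simp: segment_def dest: connectedin_subset_topspace)

lemma e_image_segment:
  assumes "connected I" "s \<in> I" "t \<in> I" "e s \<noteq> e t"
  shows "segment (e ` I)"
  using assms connectedin_e_image unfolding segment_def by blast

lemma segment_arc:
  assumes "a < b"
  shows "segment (e ` {a..b})" "segment (e ` {a<..<b})"
proof -
  obtain u where u: "a < u" "u < min b (a + 1)" using dense[of a "min b (a + 1)"] assms by auto
  obtain v where v: "u < v" "v < min b (a + 1)" using dense[OF u(2)] by auto
  have uv: "a < u" "u < v" "v < b" "v - u < 1" using u v by auto
  have "e u \<noteq> e v"
    using uv e_eq_iff[of v u] Ints_nonzero_abs_less1[of "v - u"] by auto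
  with uv show "segment (e ` {a..b})" "segment (e ` {a<..<b})"
    by (auto intro!: e_image_segment[of _ u v])
qed

text \<open>Cutting the circle at the omitted point \<open>e q\<close> makes \<open>e\<close>
  injective on the remaining open unit interval, so connectedness of \<Sigma> becomes order
  convexity of its parameters.\<close>

lemma proper_segment_lift:
  assumes \<Sigma>: "segment \<Sigma>" and q: "e q \<notin> \<Sigma>"
  defines "I \<equiv> {t \<in> {q<..<q + 1}. e t \<in> \<Sigma>}"
  shows "\<Sigma> = e ` I" "is_interval I" "\<exists>s\<in>I. \<exists>t\<in>I. s < t"
proof -
  show eq: "\<Sigma> = e ` I"
  proof
    show "\<Sigma> \<subseteq> e ` I"
    proof
      fix x assume x: "x \<in> \<Sigma>"
      then obtain t where t: "q \<le> t" "t < q + 1" "e t = x"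
        using segment_subset_topspace[OF \<Sigma>] by (metis e_lift subsetD)
      with x q have "t \<noteq> q" by auto
      with t x show "x \<in> e ` I" by (auto simp: I_def)
    qed
  qed (auto simp: I_def)
  show "is_interval I"
    unfolding is_interval_1
  proof (intro ballI allI impI, elim conjE)
    fix x y z assume x: "x \<in> I" and y: "y \<in> I" and z: "x \<le> z" "z \<le> y"
    show "z \<in> I"
    proof (rule ccontr)
      assume "z \<notin> I"
      with x y z have z': "e z \<notin> \<Sigma>" "q < z" "z < q + 1" "x < z" "z < y"
        by (auto simp: I_def order_le_less)
      \<comment> \<open>A gap at \<open>z\<close> would separate \<Sigma> into its parts over
        \<open>{q<..<z}\<close> and \<open>{z<..<q + 1}\<close>.\<close>
      have conn: "connectedin X \<Sigma>" using \<Sigma> by (simp add: segment_def)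
      show False
      proof (rule connectedinD[OF conn, of "e ` {q<..<z}" "e ` {z<..<q + 1}"])
        show "\<Sigma> \<subseteq> e ` {q<..<z} \<union> e ` {z<..<q + 1}"
        proof
          fix w assume w: "w \<in> \<Sigma>"
          then obtain t where t: "t \<in> I" "w = e t" using eq by blast
          with w z' have "t \<noteq> z" by auto
          with t show "w \<in> e ` {q<..<z} \<union> e ` {z<..<q + 1}" by (auto simp: I_def neq_iff)
        qed
        have inj: "inj_on e {q<..<q + 1}" by (rule e_inj_on) auto
        have "e ` {q<..<z} \<inter> e ` {z<..<q + 1} = e ` ({q<..<z} \<inter> {z<..<q + 1})"
          by (rule inj_on_image_Int[OF inj, symmetric]) (use z' in auto)
        then show "e ` {q<..<z} \<inter> e ` {z<..<q + 1} \<inter> \<Sigma> = {}" by auto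
        have "x \<in> {q<..<z}" "e x \<in> \<Sigma>" "y \<in> {z<..<q + 1}" "e y \<in> \<Sigma>"
          using x y z' by (auto simp: I_def)
        then show "e ` {q<..<z} \<inter> \<Sigma> \<noteq> {}" "e ` {z<..<q + 1} \<inter> \<Sigma> \<noteq> {}"
          by blast+
      qed (auto intro: openin_e_image)
    qed
  qed
  obtain x y where "x \<in> \<Sigma>" "y \<in> \<Sigma>" "x \<noteq> y" using \<Sigma> by (auto simp: segment_def)
  then obtain s t where "s \<in> I" "t \<in> I" "s \<noteq> t" using eq by blast
  then show "\<exists>s\<in>I. \<exists>t\<in>I. s < t" by (metis neq_iff)
qed

lemma proper_segment_omits:
  assumes "segment \<Sigma>" "\<Sigma> \<noteq> topspace X"
  shows "\<exists>q. e q \<notin> \<Sigma>"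
proof (rule ccontr)
  assume "\<not> (\<exists>q. e q \<notin> \<Sigma>)"
  then have "range e \<subseteq> \<Sigma>" by auto
  then show False using assms segment_subset_topspace[OF assms(1)] e_surj by simp
qed

text \<open>In an interval with more than one point, every point is a limit of interior points. This
  density carries freeness, a condition on interiors, over to closures and unions of chains.\<close>

lemma segment_subset_closure_interior:
  assumes "segment \<Sigma>"
  shows "\<Sigma> \<subseteq> X closure_of (X interior_of \<Sigma>)"
proof (cases "\<Sigma> = topspace X")
  case True
  then show ?thesis by (simp add: interior_of_topspace closure_of_topspace)
next
  case False
  then obtain q where q: "e q \<notin> \<Sigma>" using proper_segment_omits[OF assms] by blast
  define I where "I = {t \<in> {q<..<q + 1}. e t \<in> \<Sigma>}"
  note I = proper_segment_lift[OF assms q, folded I_def]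
  show ?thesis
  proof
    fix x assume "x \<in> \<Sigma>"
    then obtain t where t: "t \<in> I" "x = e t" using I(1) by blast
    obtain s where s: "s \<in> I" "s \<noteq> t" using I(3) by (metis less_irrefl)
    define J where "J = {min s t<..<max s t}"
    have "min s t \<in> I" "max s t \<in> I" using s t by (auto simp: min_def max_def)
    then have "J \<subseteq> I"
      using I(2)[unfolded is_interval_1, rule_format, of "min s t" "max s t"] by (auto simp: J_def)
    then have sub: "e ` J \<subseteq> X interior_of \<Sigma>"
      using I(1) by (intro interior_of_maximal openin_e_image) (auto simp: J_def)
    have "t \<in> closure J" using s by (auto simp: J_def closure_greaterThanLessThan)
    show "x \<in> X closure_of (X interior_of \<Sigma>)"
      unfolding in_closure_of
    proof (intro conjI allI impI)
      fix T assume "x \<in> T \<and> openin X T"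
      then have "open {t. e t \<in> T}" "t \<in> {t. e t \<in> T}" using open_e_preimage t by auto
      with \<open>t \<in> closure J\<close> obtain u where "u \<in> J" "e u \<in> T"
        by (metis (no_types, lifting) disjoint_iff mem_Collect_eq open_Int_closure_eq_empty)
      then show "\<exists>y. y \<in> X interior_of \<Sigma> \<and> y \<in> T" using sub by blast
    qed (simp add: t)
  qed
qed

lemma segment_interior_nonempty: "segment \<Sigma> \<Longrightarrow> X interior_of \<Sigma> \<noteq> {}"
  using segment_subset_closure_interior[of \<Sigma>] by (auto simp: segment_def)

lemma compact_proper_segment:
  assumes "segment \<Sigma>" "compactin X \<Sigma>" "\<Sigma> \<noteq> topspace X"
  obtains a b where "\<Sigma> = e ` {a..b}" "a < b" "b < a + 1"
proof -
  obtain q where q: "e q \<notin> \<Sigma>" using proper_segment_omits[OF assms(1,3)] by blast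
  define I where "I = {t \<in> {q<..<q + 1}. e t \<in> \<Sigma>}"
  note I = proper_segment_lift[OF assms(1) q, folded I_def]
  have "e (q + 1) = e q" using e_plus_int[of q 1] by simp
  \<comment> \<open>Both \<open>q\<close> and \<open>q + 1\<close> map to the omitted point, so the
    open interval may be replaced by the closed one, which makes \<open>I\<close> compact.\<close>
  then have "I = {t. e t \<in> \<Sigma>} \<inter> {q..q + 1}" using q by (auto simp: I_def order_le_less)
  then have "compact I"
    using closed_e_preimage[OF compactin_imp_closedin[OF Hausdorff assms(2)]]
    by (simp add: closed_Int_compact)
  then obtain a b where ab: "I = {a..b}"
    using I(2) connected_compact_interval_1 is_interval_connected_1 by blast
  have "a < b" using I(3) unfolding ab by force
  moreover have "a \<in> I" "b \<in> I" using ab \<open>a < b\<close> by auto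
  then have "b < a + 1" by (auto simp: I_def)
  ultimately show ?thesis using that I(1) ab by blast
qed

lemma openin_contains_segment:
  assumes "openin X U" "x \<in> U"
  obtains P where "segment P" "openin X P" "x \<in> P" "P \<subseteq> U"
proof -
  obtain t where t: "x = e t" using assms openin_subset e_surj by blast
  obtain r where r: "r > 0" "ball t r \<subseteq> {t. e t \<in> U}"
    using open_e_preimage[OF assms(1)] assms(2) t open_contains_ball by (metis mem_Collect_eq)
  show ?thesis
  proof (rule that[of "e ` {t - r<..<t + r}"])
    show "segment (e ` {t - r<..<t + r})" using r by (intro segment_arc) auto
    show "e ` {t - r<..<t + r} \<subseteq> U" using r by (auto simp: ball_eq_greaterThanLessThan)
  qed (use t r in \<open>auto intro: openin_e_image\<close>)
qed

end

section \<open>Analytic curves in charts\<close>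

lemma analytic_atlas_chart:
  assumes "analytic_atlas X M" "(V, v) \<in> matlas M"
  shows "openin (mtop M) V" "inj_on v V" "v ` V \<subseteq> topspace X"
    "openin X W \<Longrightarrow> openin (mtop M) {y \<in> V. v y \<in> W}"
proof -
  have V: "openin (mtop M) V" "openin X (v ` V)"
    "homeomorphic_map (subtopology (mtop M) V) (subtopology X (v ` V)) v"
    using assms unfolding analytic_atlas_def by auto
  have top: "topspace (subtopology (mtop M) V) = V"
    using openin_subset[OF V(1)] by auto
  show "openin (mtop M) V" by (rule V(1))
  show "inj_on v V" using homeomorphic_imp_injective_map[OF V(3)] top by simp
  show "v ` V \<subseteq> topspace X" using openin_subset[OF V(2)] .
  assume W: "openin X W"
  have "continuous_map (subtopology (mtop M) V) X v"
    using homeomorphic_imp_continuous_map[OF V(3)] by (simp add: continuous_map_in_subtopology)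
  then have "openin (subtopology (mtop M) V) {y \<in> topspace (subtopology (mtop M) V). v y \<in> W}"
    using W by (rule openin_continuous_map_preimage)
  then show "openin (mtop M) {y \<in> V. v y \<in> W}"
    unfolding top using V(1) openin_open_subtopology by blast
qed

lemma analytic_atlas_chart_at:
  assumes "analytic_atlas X M" "y \<in> topspace (mtop M)"
  obtains V v where "(V, v) \<in> matlas M" "y \<in> V"
proof -
  have "y \<in> (\<Union>(U, u)\<in>matlas M. U)" using assms unfolding analytic_atlas_def by simp
  then show ?thesis using that by blast
qed

lemma real_analytic_onE:
  assumes "real_analytic_on n D f" "x \<in> D"
  obtains V a F where "openin (Euclidean_space n) V" "x \<in> V"
    "\<forall>y\<in>V. ((\<lambda>\<alpha>. a \<alpha> * (\<Prod>i<n. (y i - x i) ^ \<alpha> i)) has_sum F y)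
        {\<alpha> :: nat \<Rightarrow> nat. \<forall>i\<ge>n. \<alpha> i = 0}"
    "\<forall>y\<in>V \<inter> D. f y = F y"
  using assms(1)[unfolded real_analytic_on_def, rule_format, OF assms(2)]
  by (elim exE conjE)

lemma coord1_in_half_line: "x \<in> topspace half_line \<Longrightarrow> x = coord1 (x 0)"
  by (auto simp: half_line_def topspace_Euclidean_space coord1_def fun_eq_iff)

definition chart_curve :: "'s chart \<Rightarrow> real \<Rightarrow> 's" where
  "chart_curve = (\<lambda>(U, u) t. inv_into U u (coord1 t))"

text \<open>In a manifold homeomorphic to the circle, the coordinate of a chart ranges over a full
  neighbourhood \<open>T\<close> of each of its values, also when the chart takes values in the half line.\<close>

definition two_sided_chart :: "'s manifold \<Rightarrow> 's chart \<Rightarrow> 's \<Rightarrow> real set \<Rightarrow> bool" where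
  "two_sided_chart S = (\<lambda>(U, u) z T. (U, u) \<in> matlas S \<and> z \<in> U \<and> open T \<and> u z 0 \<in> T \<and>
     (\<forall>t\<in>T. coord1 t \<in> u ` U) \<and> chart_curve (U, u) (u z 0) = z \<and>
     (\<forall>T'. open T' \<longrightarrow> T' \<subseteq> T \<longrightarrow> openin (mtop S) (chart_curve (U, u) ` T')) \<and>
     (\<forall>W. openin (mtop S) W \<longrightarrow> open {t \<in> T. chart_curve (U, u) t \<in> W}))"

text \<open>The chart takes values in a half line, but its coordinate read along \<open>e\<close> is
  continuous and injective on an open interval. Invariance of domain makes the range open: a circle
  has no boundary points.\<close>

lemma ex_two_sided_chart:
  fixes S :: "'s manifold"
  assumes circle: "circle_parametrization (mtop S) e"
    and S: "analytic_1_manifold_with_boundary S" and z: "z \<in> topspace (mtop S)"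
  obtains U u T where "two_sided_chart S (U, u) z T"
proof -
  interpret circle_parametrization "mtop S" e by (rule circle)
  have atlas: "analytic_atlas half_line S" using S by (simp add: analytic_1_manifold_with_boundary_def)
  obtain U u where U: "(U, u) \<in> matlas S" "z \<in> U" using analytic_atlas_chart_at[OF atlas z] .
  note chart = analytic_atlas_chart[OF atlas U(1)]
  obtain x0 where x0: "z = e x0" using z e_surj by blast
  have "open {x. e x \<in> U}" "x0 \<in> {x. e x \<in> U}" using open_e_preimage[OF chart(1)] U(2) x0 by auto
  then obtain r where r: "r > 0" "ball x0 r \<subseteq> {x. e x \<in> U}" using open_contains_ball by metis
  \<comment> \<open>A radius of at most 1/2 keeps \<open>e\<close> injective on
    \<open>J\<close>.\<close>
  define J where "J = ball x0 (min r (1 / 2))"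
  have J: "open J" "x0 \<in> J" "\<And>x. x \<in> J \<Longrightarrow> e x \<in> U" using r by (auto simp: J_def)
  define k where "k = (\<lambda>x. u (e x) 0)"
  have uk: "u (e x) = coord1 (k x)" if "x \<in> J" for x
    using coord1_in_half_line[of "u (e x)"] chart(3) J(3)[OF that] by (auto simp: k_def)
  have curve: "chart_curve (U, u) (k x) = e x" if "x \<in> J" for x
    using uk[OF that, symmetric] inv_into_f_f[OF chart(2) J(3)[OF that]] by (simp add: chart_curve_def)
  have "inj_on e J"
  proof (rule e_inj_on)
    fix s t assume "s \<in> J" "t \<in> J"
    then have "\<bar>x0 - s\<bar> < 1 / 2" "\<bar>x0 - t\<bar> < 1 / 2" by (simp_all add: J_def dist_real_def)
    then show "\<bar>s - t\<bar> < 1" by linarith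
  qed
  have inj: "inj_on k J"
  proof (rule inj_onI)
    fix x y assume xy: "x \<in> J" "y \<in> J" "k x = k y"
    then have "e x = e y" using curve[OF xy(1)] curve[OF xy(2)] by simp
    then show "x = y" using inj_onD[OF \<open>inj_on e J\<close>] xy by blast
  qed
  have "open {x \<in> J. k x \<in> A}" if A: "open A" for A
  proof -
    have "openin (powertop_real UNIV) {x. x 0 \<in> A}"
      using openin_continuous_map_preimage[OF continuous_map_product_projection[of 0 UNIV "\<lambda>_. euclideanreal"], of A] A
      by simp
    then have "openin half_line ({x. x 0 \<in> A} \<inter> topspace half_line)"
      unfolding half_line_def Euclidean_space_def subtopology_subtopology openin_subtopology by auto
    then have "openin (mtop S) {y \<in> U. u y \<in> {x. x 0 \<in> A} \<inter> topspace half_line}" by (rule chart(4))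
    then have "open {x. e x \<in> {y \<in> U. u y \<in> {x. x 0 \<in> A} \<inter> topspace half_line}}" by (rule open_e_preimage)
    moreover have "{x \<in> J. k x \<in> A} = J \<inter> {x. e x \<in> {y \<in> U. u y \<in> {x. x 0 \<in> A} \<inter> topspace half_line}}"
      using chart(3) J(3) by (auto simp: k_def)
    ultimately show ?thesis using J(1) by auto
  qed
  note preimage = this
  then have cont: "continuous_on J k"
    using continuous_on_open_vimage[OF J(1), of k] by (auto simp: vimage_def Int_def conj_commute)
  have open_image: "open (k ` A)" if "open A" "A \<subseteq> J" for A
    using continuous_on_subset[OF cont that(2)] that(1) inj_on_subset[OF inj that(2)]
    by (rule invariance_of_domain)
  have "two_sided_chart S (U, u) z (k ` J)"
    unfolding two_sided_chart_def case_prod_conv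
  proof (intro conjI allI impI ballI)
    show "open (k ` J)" using open_image J(1) by blast
    show "u z 0 \<in> k ` J" "chart_curve (U, u) (u z 0) = z"
      using J(2) curve[OF J(2)] by (auto simp: k_def x0)
    show "coord1 t \<in> u ` U" if "t \<in> k ` J" for t
    proof -
      from that obtain x where "x \<in> J" "t = k x" by (elim imageE)
      then show ?thesis using uk[of x, symmetric] J(3)[of x] by auto
    qed
    show "openin (mtop S) (chart_curve (U, u) ` T')" if T': "open T'" "T' \<subseteq> k ` J" for T'
    proof -
      have "chart_curve (U, u) ` T' = e ` {x \<in> J. k x \<in> T'}"
        using T'(2) curve by (force simp: image_iff)
      then show ?thesis using openin_e_image[OF preimage[OF T'(1)]] by simp
    qed
    show "open {t \<in> k ` J. chart_curve (U, u) t \<in> W}" if W: "openin (mtop S) W" for W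
    proof -
      have "{t \<in> k ` J. chart_curve (U, u) t \<in> W} = k ` (J \<inter> {x. e x \<in> W})" using curve by auto
      then show ?thesis using open_image[of "J \<inter> {x. e x \<in> W}"] J(1) open_e_preimage[OF W] by auto
    qed
  qed (use U in auto)
  then show ?thesis by (rule that)
qed

lemma two_sided_chartD:
  assumes "two_sided_chart S (U, u) z T"
  shows "(U, u) \<in> matlas S" "z \<in> U" "open T" "u z 0 \<in> T" "t \<in> T \<Longrightarrow> coord1 t \<in> u ` U"
    "t \<in> T \<Longrightarrow> chart_curve (U, u) t \<in> U" "t \<in> T \<Longrightarrow> u (chart_curve (U, u) t) = coord1 t"
    "chart_curve (U, u) (u z 0) = z"
    "open T' \<Longrightarrow> T' \<subseteq> T \<Longrightarrow> openin (mtop S) (chart_curve (U, u) ` T')"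
    "openin (mtop S) W \<Longrightarrow> open {t \<in> T. chart_curve (U, u) t \<in> W}"
  using assms unfolding two_sided_chart_def
  by (auto simp: chart_curve_def inv_into_into f_inv_into_f)

lemma eventually_chart_curve:
  assumes "two_sided_chart S (U, u) z T" "openin (mtop S) W" "z \<in> W"
  shows "eventually (\<lambda>t. t \<in> T \<and> chart_curve (U, u) t \<in> W) (nhds (u z 0))"
proof -
  have "open {t \<in> T. chart_curve (U, u) t \<in> W}" "u z 0 \<in> {t \<in> T. chart_curve (U, u) t \<in> W}"
    using two_sided_chartD[OF assms(1)] assms(2,3) by auto
  then show ?thesis using eventually_nhds by (metis (mono_tags, lifting) mem_Collect_eq)
qed

lemma openin_analytic_map_preimage:
  assumes "analytic_map S M f" "openin (mtop M) W"
  shows "openin (mtop S) {z \<in> topspace (mtop S). f z \<in> W}"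
  using assms openin_continuous_map_preimage unfolding analytic_map_def by blast

text \<open>This is \<open>power_series_along_curve\<close> in one variable with the identity as
  curve. The series agrees with the chart expression on a full neighbourhood of \<open>u z 0\<close>
  because the chart is two-sided.\<close>

lemma real_analytic_at_chart_curve:
  assumes ch: "two_sided_chart S (U, u) z T" and S: "mdim S = 1" "z \<in> topspace (mtop S)"
    and M: "analytic_atlas X M" "(V, v) \<in> matlas M" "f z \<in> V" and f: "analytic_map S M f" and i: "i < mdim M"
  shows "real_analytic_at (\<lambda>t. v (f (chart_curve (U, u) t)) i) (u z 0)"
proof -
  note D = two_sided_chartD[OF ch]
  have uz: "u z = coord1 (u z 0)" using D(7)[OF D(4)] D(8) by simp
  let ?D = "u ` (U \<inter> f -` V)"
  have "real_analytic_on 1 ?D (\<lambda>x. v (f (inv_into U u x)) i)"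
    using f D(1) M(2) i S(1) unfolding analytic_map_def by fastforce
  moreover have "u z \<in> ?D" using D(2) M(3) by blast
  ultimately obtain W a F where W0: "openin (Euclidean_space 1) W" "u z \<in> W"
    "\<forall>y\<in>W. ((\<lambda>\<alpha>. a \<alpha> * (\<Prod>i<1. (y i - u z i) ^ \<alpha> i)) has_sum F y) {\<alpha> :: nat \<Rightarrow> nat. \<forall>i\<ge>1. \<alpha> i = 0}"
    "\<forall>y\<in>W \<inter> ?D. v (f (inv_into U u y)) i = F y"
    by (rule real_analytic_onE)
  note W = W0(1,2) W0(3,4)[rule_format]
  have c1: "coord1 = (\<lambda>t i. if i < 1 then t else 0)" by (auto simp: coord1_def fun_eq_iff)
  have "continuous_map euclideanreal (Euclidean_space 1) coord1"
    unfolding c1 by (subst continuous_map_componentwise_Euclidean_space) simp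
  then have "openin euclideanreal {t \<in> topspace euclideanreal. coord1 t \<in> W}"
    using W(1) by (rule openin_continuous_map_preimage)
  then have "open {t. coord1 t \<in> W}" by simp
  moreover have "u z 0 \<in> {t. coord1 t \<in> W}" using W(2) uz by simp
  ultimately have evW: "eventually (\<lambda>t. coord1 t \<in> W) (nhds (u z 0))"
    using eventually_nhds by (metis (mono_tags, lifting) mem_Collect_eq)
  have "real_analytic_at (\<lambda>t. F (\<lambda>i. if i < 1 then t else 0)) (u z 0)"
    by (rule power_series_along_curve[OF W(1,2,3)])
      (use evW in \<open>auto simp: real_analytic_at_id c1\<close>)
  moreover have "eventually (\<lambda>t. t \<in> T \<and> chart_curve (U, u) t \<in> {z \<in> topspace (mtop S). f z \<in> V}) (nhds (u z 0))"
    by (rule eventually_chart_curve[OF ch openin_analytic_map_preimage[OF f analytic_atlas_chart(1)[OF M(1,2)]]])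
      (use S M in auto)
  with evW have "eventually (\<lambda>t. F (\<lambda>i. if i < 1 then t else 0) = v (f (chart_curve (U, u) t)) i) (nhds (u z 0))"
  proof eventually_elim
    case (elim t)
    then have "coord1 t \<in> W \<inter> ?D" using D(6,7)[of t] by (metis (no_types, lifting) IntI image_eqI mem_Collect_eq vimageI)
    then show ?case using W(4)[of "coord1 t"] by (simp add: chart_curve_def c1)
  qed
  ultimately show ?thesis by (rule real_analytic_at_cong)
qed

text \<open>A chart \<open>(W, w)\<close> around \<open>f z\<close> is inserted: the power series of
  \<open>\<phi>\<close> in this chart is composed with the coordinates of \<open>f\<close>, which
  are analytic by \<open>real_analytic_at_chart_curve\<close>.\<close>

lemma real_analytic_at_chart_curve_compose:
  assumes ch: "two_sided_chart S (U, u) z T" and S: "mdim S = 1" "z \<in> topspace (mtop S)"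
    and M: "analytic_manifold M" "(V, v) \<in> matlas M" "\<phi> (f z) \<in> V"
    and f: "analytic_map S M f" and \<phi>: "analytic_map M M \<phi>" and i: "i < mdim M"
  shows "real_analytic_at (\<lambda>t. v (\<phi> (f (chart_curve (U, u) t))) i) (u z 0)"
proof -
  have atlas: "analytic_atlas (Euclidean_space (mdim M)) M" using M(1) by (simp add: analytic_manifold_def)
  note D = two_sided_chartD[OF ch]
  have fz: "f z \<in> topspace (mtop M)"
    using f S(2) continuous_map_image_subset_topspace[of "mtop S" "mtop M" f] unfolding analytic_map_def by blast
  obtain W w where W: "(W, w) \<in> matlas M" "f z \<in> W" using analytic_atlas_chart_at[OF atlas fz] .
  note chart = analytic_atlas_chart[OF atlas W(1)]
  let ?D = "w ` (W \<inter> \<phi> -` V)"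
  have "real_analytic_on (mdim M) ?D (\<lambda>x. v (\<phi> (inv_into W w x)) i)"
    using \<phi> W(1) M(2) i unfolding analytic_map_def by fastforce
  moreover have "w (f z) \<in> ?D" using W(2) M(3) by blast
  ultimately obtain N a F where N0: "openin (Euclidean_space (mdim M)) N" "w (f z) \<in> N"
    "\<forall>y\<in>N. ((\<lambda>\<alpha>. a \<alpha> * (\<Prod>i<mdim M. (y i - w (f z) i) ^ \<alpha> i)) has_sum F y)
        {\<alpha> :: nat \<Rightarrow> nat. \<forall>i\<ge>mdim M. \<alpha> i = 0}"
    "\<forall>y\<in>N \<inter> ?D. v (\<phi> (inv_into W w y)) i = F y"
    by (rule real_analytic_onE)
  note N = N0(1,2) N0(3,4)[rule_format]
  define B where "B = {y \<in> W. w y \<in> N} \<inter> {y \<in> topspace (mtop M). \<phi> y \<in> V}"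
  have "openin (mtop M) B"
    unfolding B_def using chart(4)[OF N(1)] openin_analytic_map_preimage[OF \<phi> analytic_atlas_chart(1)[OF atlas M(2)]]
    by (rule openin_Int)
  then have "openin (mtop S) {z \<in> topspace (mtop S). f z \<in> B}" by (rule openin_analytic_map_preimage[OF f])
  moreover have "z \<in> {z \<in> topspace (mtop S). f z \<in> B}" using S(2) W(2) N(2) M(3) fz by (auto simp: B_def)
  ultimately have "eventually (\<lambda>t. t \<in> T \<and> chart_curve (U, u) t \<in> {z \<in> topspace (mtop S). f z \<in> B}) (nhds (u z 0))"
    by (rule eventually_chart_curve[OF ch])
  then have ev: "eventually (\<lambda>t. f (chart_curve (U, u) t) \<in> B) (nhds (u z 0))"
    by eventually_elim auto
  \<comment> \<open>Chart coordinates vanish from the dimension on, so filling up with 0 changes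
    nothing.\<close>
  have ext: "(\<lambda>k. if k < mdim M then w y k else 0) = w y" if "y \<in> W" for y
    using chart(3) that by (fastforce simp: topspace_Euclidean_space fun_eq_iff)
  have "real_analytic_at (\<lambda>t. F (\<lambda>k. if k < mdim M then w (f (chart_curve (U, u) t)) k else 0)) (u z 0)"
  proof (rule power_series_along_curve[OF N(1,2,3)])
    show "real_analytic_at (\<lambda>t. w (f (chart_curve (U, u) t)) k) (u z 0)" if "k < mdim M" for k
      by (rule real_analytic_at_chart_curve[OF ch S atlas W f that])
    show "w (f (chart_curve (U, u) (u z 0))) k = w (f z) k" for k using D(8) by simp
    show "\<forall>\<^sub>F t in nhds (u z 0). (\<lambda>k. if k < mdim M then w (f (chart_curve (U, u) t)) k else 0) \<in> N"
      using ev by eventually_elim (use ext in \<open>auto simp: B_def\<close>)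
  qed
  moreover have "eventually (\<lambda>t. F (\<lambda>k. if k < mdim M then w (f (chart_curve (U, u) t)) k else 0) =
      v (\<phi> (f (chart_curve (U, u) t))) i) (nhds (u z 0))"
    using ev
  proof eventually_elim
    case (elim t)
    let ?y = "f (chart_curve (U, u) t)"
    have y: "?y \<in> W" "w ?y \<in> N \<inter> ?D" using elim by (auto simp: B_def)
    have "inv_into W w (w ?y) = ?y" using y(1) by (rule inv_into_f_f[OF chart(2)])
    then show ?case using N(4)[OF y(2)] ext[OF y(1)] by simp
  qed
  ultimately show ?thesis by (rule real_analytic_at_cong)
qed

text \<open>The derivative in \<open>immersion1\<close> may be one-sided. On a two-sided chart the
  admissible parameters contain a neighbourhood of \<open>u z 0\<close>, so it is an ordinary
  derivative.\<close>

lemma immersion1_chart_curve: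
  assumes ch: "two_sided_chart S (U, u) z T" and z: "z \<in> topspace (mtop S)"
    and M: "analytic_atlas X M" "(V, v) \<in> matlas M" "f z \<in> V" and f: "analytic_map S M f" "immersion1 S M f"
  obtains j d where "j < mdim M" "d \<noteq> 0"
    "((\<lambda>t. v (f (chart_curve (U, u) t)) j) has_real_derivative d) (at (u z 0))"
proof -
  note D = two_sided_chartD[OF ch]
  let ?A = "{t. coord1 t \<in> u ` (U \<inter> f -` V)}"
  have "z \<in> U \<inter> f -` V" using D(2) M(3) by blast
  moreover from bspec[OF f(2)[unfolded immersion1_def] D(1)]
  have "\<forall>(V, v)\<in>matlas M. \<forall>z\<in>U \<inter> f -` V. \<exists>j<mdim M. \<exists>d. d \<noteq> 0 \<and>
        ((\<lambda>t. v (f (inv_into U u (coord1 t))) j) has_real_derivative d)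
          (at (u z 0) within {t. coord1 t \<in> u ` (U \<inter> f -` V)})" by (simp only: case_prod_conv)
  from bspec[OF this M(2)]
  have "\<forall>z\<in>U \<inter> f -` V. \<exists>j<mdim M. \<exists>d. d \<noteq> 0 \<and>
        ((\<lambda>t. v (f (inv_into U u (coord1 t))) j) has_real_derivative d)
          (at (u z 0) within {t. coord1 t \<in> u ` (U \<inter> f -` V)})" by (simp only: case_prod_conv)
  ultimately obtain j d where jd: "j < mdim M" "d \<noteq> 0"
    "((\<lambda>t. v (f (inv_into U u (coord1 t))) j) has_real_derivative d) (at (u z 0) within ?A)"
    by blast
  let ?B = "{t \<in> T. chart_curve (U, u) t \<in> {z \<in> topspace (mtop S). f z \<in> V}}"
  have "open ?B"
    by (rule D(10)[OF openin_analytic_map_preimage[OF f(1) analytic_atlas_chart(1)[OF M(1,2)]]])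
  moreover have "?B \<subseteq> ?A"
  proof
    fix t assume t: "t \<in> ?B"
    then have "chart_curve (U, u) t \<in> U \<inter> f -` V" "coord1 t = u (chart_curve (U, u) t)"
      using D(6)[of t] D(7)[of t] by auto
    then show "t \<in> ?A" by auto
  qed
  moreover have "u z 0 \<in> ?B" using D(4,8) z M(3) by auto
  ultimately have "u z 0 \<in> interior ?A" using interior_maximal by blast
  then have "at (u z 0) within ?A = at (u z 0)" by (rule at_within_interior)
  with jd show ?thesis using that by (simp add: chart_curve_def)
qed

text \<open>The set of points near which \<open>\<phi> \<circ> \<iota>\<close> stays in the curve is open; by the identity theorem it is
  also closed.\<close>

lemma analytic_overlap_extends:
  fixes S :: "'s manifold" and M :: "'m manifold"
  assumes circle: "circle_parametrization (mtop S) e"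
    and sub: "analytic_1_submanifold S \<iota> M" and M: "analytic_manifold M"
    and \<phi>: "analytic_map M M \<phi>"
    and emb: "embedding_map (mtop S) (mtop M) \<iota>"
    and P: "openin (mtop S) P" "P \<noteq> {}" "\<phi> ` \<iota> ` P \<subseteq> \<iota> ` topspace (mtop S)"
  shows "\<phi> ` \<iota> ` topspace (mtop S) \<subseteq> \<iota> ` topspace (mtop S)"
proof -
  interpret circle_parametrization "mtop S" e by (rule circle)
  let ?X = "mtop S" and ?m = "mdim M"
  define K where "K = \<iota> ` topspace ?X"
  have S1: "analytic_1_manifold_with_boundary S" and \<iota>: "analytic_map S M \<iota>" "immersion1 S M \<iota>"
    and conn: "connected_space ?X"
    using sub by (auto simp: analytic_1_submanifold_def)
  have mdim: "mdim S = 1" using S1 by (simp add: analytic_1_manifold_with_boundary_def)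
  have MH: "Hausdorff_space (mtop M)" and atlas: "analytic_atlas (Euclidean_space ?m) M"
    using M by (auto simp: analytic_manifold_def)
  have \<iota>c: "continuous_map ?X (mtop M) \<iota>" and \<phi>c: "continuous_map (mtop M) (mtop M) \<phi>"
    using \<iota>(1) \<phi> by (auto simp: analytic_map_def)
  have \<phi>\<iota>c: "continuous_map ?X (mtop M) (\<lambda>z. \<phi> (\<iota> z))"
    using continuous_map_compose[OF \<iota>c \<phi>c] by (simp add: o_def)
  have "compactin (mtop M) K"
    unfolding K_def using image_compactin[OF _ \<iota>c] compact_space by (simp add: compact_space_def)
  then have Kcl: "closedin (mtop M) K" by (rule compactin_imp_closedin[OF MH])
  define Z where "Z = {z \<in> topspace ?X. \<phi> (\<iota> z) \<in> K}"
  have Zcl: "closedin ?X Z" unfolding Z_def by (rule closedin_continuous_map_preimage[OF \<phi>\<iota>c Kcl])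
  define W where "W = ?X interior_of Z"
  have "?X closure_of W \<subseteq> W"
  proof
    fix z assume z: "z \<in> ?X closure_of W"
    then have "z \<in> Z" using closure_of_minimal[OF interior_of_subset Zcl] W_def by blast
    then obtain z' where zt: "z \<in> topspace ?X" "z' \<in> topspace ?X" "\<phi> (\<iota> z) = \<iota> z'"
      by (auto simp: Z_def K_def)
    have "\<iota> z' \<in> topspace (mtop M)" using \<iota>c zt(2) continuous_map_image_subset_topspace by blast
    then obtain V v where V: "(V, v) \<in> matlas M" "\<iota> z' \<in> V" using analytic_atlas_chart_at[OF atlas] by blast
    note chart = analytic_atlas_chart[OF atlas V(1)]
    obtain U u T where ch: "two_sided_chart S (U, u) z T" using ex_two_sided_chart[OF circle S1 zt(1)] .
    obtain U' u' T' where ch': "two_sided_chart S (U', u') z' T'" using ex_two_sided_chart[OF circle S1 zt(2)] .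
    note D = two_sided_chartD[OF ch] and D' = two_sided_chartD[OF ch']
    define p where "p = chart_curve (U, u)"
    define p' where "p' = chart_curve (U', u')"
    define t0 where "t0 = u z 0"
    define r0 where "r0 = u' z' 0"
    have p0: "p t0 = z" "p' r0 = z'" using D(8) D'(8) by (simp_all add: p_def p'_def t0_def r0_def)
    have evV: "eventually (\<lambda>r. r \<in> T' \<and> p' r \<in> {z \<in> topspace ?X. \<iota> z \<in> V}) (nhds r0)"
      unfolding p'_def r0_def
      by (rule eventually_chart_curve[OF ch' openin_analytic_map_preimage[OF \<iota>(1) chart(1)]])
        (use V zt in auto)
    then obtain \<epsilon> where \<epsilon>: "\<epsilon> > 0" "\<And>r. \<bar>r - r0\<bar> < \<epsilon> \<Longrightarrow> r \<in> T' \<and> p' r \<in> topspace ?X \<and> \<iota> (p' r) \<in> V"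
      unfolding eventually_nhds_metric dist_real_def by auto
    obtain j d where jd: "j < ?m" "d \<noteq> 0" "((\<lambda>r. v (\<iota> (p' r)) j) has_real_derivative d) (at r0)"
      using immersion1_chart_curve[OF ch' zt(2) atlas V \<iota>] unfolding p'_def r0_def by blast
    have \<phi>V: "\<phi> (\<iota> z) \<in> V" using V(2) zt(3) by simp
    have "eventually (\<lambda>t. \<exists>r. \<bar>r - r0\<bar> < \<epsilon> \<and> (\<forall>i<?m. v (\<iota> (p' r)) i = v (\<phi> (\<iota> (p t))) i)) (nhds t0)"
    proof (rule real_analytic_curves_coincide[where f = "\<lambda>i r. v (\<iota> (p' r)) i"
          and g = "\<lambda>i t. v (\<phi> (\<iota> (p t))) i" and j = j and d = d])
      show "j < ?m" "d \<noteq> 0" "((\<lambda>r. v (\<iota> (p' r)) j) has_real_derivative d) (at r0)" "\<epsilon> > 0"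
        by (fact jd(1), fact jd(2), fact jd(3), fact \<epsilon>(1))
      show "real_analytic_at (\<lambda>r. v (\<iota> (p' r)) i) r0" if "i < ?m" for i
        unfolding p'_def r0_def
        by (rule real_analytic_at_chart_curve[OF ch' mdim zt(2) atlas V \<iota>(1) that])
      show "real_analytic_at (\<lambda>t. v (\<phi> (\<iota> (p t))) i) t0" if "i < ?m" for i
        unfolding p_def t0_def
        by (rule real_analytic_at_chart_curve_compose[OF ch mdim zt(1) M V(1) \<phi>V \<iota>(1) \<phi> that])
      show "v (\<iota> (p' r0)) j = v (\<phi> (\<iota> (p t0))) j" using p0 zt(3) by simp
      fix \<delta> :: real assume \<delta>: "\<delta> > 0"
      \<comment> \<open>Here the embedding property enters: points of \<open>K\<close> close to
        \<open>\<iota> z'\<close> come from parameters close to \<open>r0\<close>. Otherwise another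
        branch of the curve could approach the same point.\<close>
      define R where "R = T' \<inter> ball r0 \<delta>"
      have R: "openin ?X (p' ` R)" unfolding p'_def R_def by (rule D'(9)) (use D'(3) in auto)
      have "homeomorphic_map ?X (subtopology (mtop M) K) \<iota>" using emb by (simp add: embedding_map_def K_def)
      then have "openin (subtopology (mtop M) K) (\<iota> ` p' ` R)"
        using homeomorphic_imp_open_map R by (auto simp: open_map_def)
      then obtain B where B: "openin (mtop M) B" "\<iota> ` p' ` R = B \<inter> K" by (auto simp: openin_subtopology)
      have "r0 \<in> R" using \<delta> D'(4) by (simp add: R_def r0_def)
      then have "\<phi> (\<iota> z) \<in> B" using B(2) p0(2) zt(3) by blast
      then have "eventually (\<lambda>t. t \<in> T \<and> p t \<in> {z \<in> topspace ?X. \<phi> (\<iota> z) \<in> B}) (nhds t0)"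
        unfolding p_def t0_def
        using eventually_chart_curve[OF ch openin_continuous_map_preimage[OF \<phi>\<iota>c B(1)]] zt(1) by simp
      then obtain \<eta> where \<eta>: "\<eta> > 0" "\<And>t. \<bar>t - t0\<bar> < \<eta> \<Longrightarrow> t \<in> T \<and> \<phi> (\<iota> (p t)) \<in> B"
        unfolding eventually_nhds_metric dist_real_def by auto
      define T1 where "T1 = ball t0 (min \<eta> \<delta>)"
      have T1: "open T1" "t0 \<in> T1" "T1 \<subseteq> T" "\<And>t. t \<in> T1 \<Longrightarrow> \<bar>t - t0\<bar> < \<delta> \<and> \<phi> (\<iota> (p t)) \<in> B"
        using \<eta> \<delta> by (auto simp: T1_def dist_real_def abs_minus_commute)
      have "openin ?X (p ` T1)" unfolding p_def by (rule D(9)[OF T1(1,3)])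
      moreover have "z \<in> p ` T1" using T1(2) p0(1) by blast
      ultimately obtain w where w: "w \<in> W" "w \<in> p ` T1" using z by (auto simp: in_closure_of)
      \<comment> \<open>A nonempty open set of parameters is not contained in \<open>{t0}\<close>;
        this yields the required \<open>t \<noteq> t0\<close>.\<close>
      define N where "N = T1 \<inter> {t \<in> T. p t \<in> W}"
      have "open N" unfolding N_def p_def W_def using T1(1) D(10)[OF openin_interior_of] by blast
      moreover have "N \<noteq> {}" using w T1(3) by (auto simp: N_def)
      ultimately have "\<not> N \<subseteq> {t0}" using not_open_singleton[of t0] by (auto simp: subset_singleton_iff)
      then obtain t where t: "t \<in> N" "t \<noteq> t0" by blast
      have "p t \<in> Z" using t(1) interior_of_subset[of ?X Z] by (auto simp: N_def W_def)
      then have "\<phi> (\<iota> (p t)) \<in> B \<inter> K" using T1(4) t(1) by (auto simp: N_def Z_def)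
      then obtain r where r: "r \<in> R" "\<phi> (\<iota> (p t)) = \<iota> (p' r)" unfolding B(2)[symmetric] by blast
      show "\<exists>t r. t \<noteq> t0 \<and> \<bar>t - t0\<bar> < \<delta> \<and> \<bar>r - r0\<bar> < \<delta> \<and>
          (\<forall>i<?m. v (\<iota> (p' r)) i = v (\<phi> (\<iota> (p t))) i)"
        using t r T1(4)[of t]
        by (intro exI[of _ t] exI[of _ r]) (auto simp: N_def R_def dist_real_def abs_minus_commute)
    qed
    moreover have "eventually (\<lambda>t. t \<in> T \<and> p t \<in> {z \<in> topspace ?X. \<phi> (\<iota> z) \<in> V}) (nhds t0)"
      unfolding p_def t0_def
      by (rule eventually_chart_curve[OF ch openin_continuous_map_preimage[OF \<phi>\<iota>c chart(1)]])
        (use zt \<phi>V in auto)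
    ultimately have "eventually (\<lambda>t. t \<in> T \<and> p t \<in> Z) (nhds t0)"
    proof eventually_elim
      case (elim t)
      then obtain r where r: "\<bar>r - r0\<bar> < \<epsilon>" "\<And>i. i < ?m \<Longrightarrow> v (\<iota> (p' r)) i = v (\<phi> (\<iota> (p t))) i" by blast
      have rV: "\<iota> (p' r) \<in> V" "p' r \<in> topspace ?X" using \<epsilon>(2)[OF r(1)] by auto
      have tV: "\<phi> (\<iota> (p t)) \<in> V" "p t \<in> topspace ?X" "t \<in> T" using elim(2) by auto
      \<comment> \<open>Components from \<open>?m\<close> on vanish for both points, so agreement of
        the first \<open>?m\<close> components makes the points equal.\<close>
      have "v (\<iota> (p' r)) i = v (\<phi> (\<iota> (p t))) i" for i
      proof (cases "i < ?m")
        case False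
        have "v (\<iota> (p' r)) \<in> topspace (Euclidean_space ?m)" "v (\<phi> (\<iota> (p t))) \<in> topspace (Euclidean_space ?m)"
          using chart(3) rV(1) tV(1) by blast+
        then show ?thesis using False by (simp add: topspace_Euclidean_space)
      qed (rule r(2))
      then have "\<iota> (p' r) = \<phi> (\<iota> (p t))" using inj_onD[OF chart(2)] rV(1) tV(1) by (meson ext)
      then have "\<phi> (\<iota> (p t)) \<in> K" using rV(2) by (metis K_def imageI)
      then show ?case using tV by (simp add: Z_def)
    qed
    then obtain N where N: "open N" "t0 \<in> N" "\<And>t. t \<in> N \<Longrightarrow> t \<in> T \<and> p t \<in> Z"
      unfolding eventually_nhds by blast
    have "openin ?X (p ` N)" unfolding p_def by (rule D(9)) (use N in auto)
    then have "p ` N \<subseteq> W" unfolding W_def using N(3) by (intro interior_of_maximal) auto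
    then show "z \<in> W" using N(2) p0(1) by blast
  qed
  then have "closedin ?X W"
    using closure_of_subset[of W ?X] interior_of_subset_topspace[of ?X Z]
    by (metis W_def closure_of_eq subset_antisym)
  moreover have "openin ?X W" by (simp add: W_def)
  ultimately have "W = {} \<or> W = topspace ?X" using conn connected_space_clopen_in by blast
  moreover have "P \<subseteq> W" unfolding W_def Z_def
    by (rule interior_of_maximal[OF _ P(1)]) (use P(3) openin_subset[OF P(1)] in \<open>auto simp: K_def\<close>)
  ultimately have "W = topspace ?X" using P(2) by blast
  then have "topspace ?X \<subseteq> Z" using interior_of_subset[of ?X Z] by (simp add: W_def)
  then show ?thesis by (auto simp: Z_def K_def)
qed

section \<open>The circle as a quotient of the line\<close>

lemma ex_circle_parametrization:
  assumes "X homeomorphic_space top_of_set (sphere (0::complex) 1)" "Hausdorff_space X"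
  shows "\<exists>e. circle_parametrization X e"
proof -
  define C where "C = top_of_set (sphere (0::complex) 1)"
  obtain h where h: "homeomorphic_map C X h"
    using assms(1) homeomorphic_space_sym homeomorphic_space unfolding C_def by metis
  have Ctop: "topspace C = sphere 0 1" by (simp add: C_def)
  define w where "w = (\<lambda>t. cis (2 * pi * t))"
  have w_in: "w t \<in> sphere 0 1" for t by (simp add: w_def)
  have w_int: "w (t + of_int k) = w t" for t k
    by (simp add: w_def distrib_left cis_mult[symmetric] cis_multiple_2pi)
  have w_eq: "w s = w t \<longleftrightarrow> s - t \<in> \<int>" for s t
  proof
    assume "w s = w t"
    then have "cis (2 * pi * (s - t)) = 1"
      by (simp add: w_def right_diff_distrib cis_divide[symmetric])
    then have "cos (2 * pi * (s - t)) = 1" by (metis cis.simps(1) one_complex.simps(1))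
    then obtain k :: int where "2 * pi * (s - t) = of_int k * (2 * pi)" using cos_one_2pi_int by auto
    then show "s - t \<in> \<int>" by simp
  next
    assume "s - t \<in> \<int>"
    then obtain k where "s - t = of_int k" by (rule Ints_cases)
    then have "s = t + of_int k" by simp
    then show "w s = w t" using w_int by simp
  qed
  have w_cont: "continuous_on A w" for A unfolding w_def by (intro continuous_intros)
  have w_surj: "range w = sphere 0 1"
  proof
    show "sphere 0 1 \<subseteq> range w"
    proof
      fix z :: complex assume "z \<in> sphere 0 1"
      then have "norm z = 1" by simp
      moreover from this have "z \<noteq> 0" by auto
      ultimately have "cis (Arg z) = z" by (simp add: cis_Arg sgn_eq)
      then have "z = w (Arg z / (2 * pi))" by (simp add: w_def)
      then show "z \<in> range w" by blast
    qed
  qed (use w_in in auto)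
  have w_open: "openin C (w ` U)" if U: "open U" for U
  proof -
    \<comment> \<open>\<open>V\<close> is the saturation of \<open>U\<close> under integer shifts.
      The complement of the image of \<open>U\<close> is the image of the compact set
      \<open>{0..1} - V\<close>, hence closed.\<close>
    define V where "V = {t. \<exists>k::int. t + of_int k \<in> U}"
    have "V = (\<Union>k::int. {t. t + of_int k \<in> U})" by (auto simp: V_def)
    moreover have "open {t. t + of_int k \<in> U}" for k :: int
      using open_vimage[OF U, of "\<lambda>t. t + of_int k"] by (simp add: vimage_def continuous_intros)
    ultimately have "open V" by auto
    have mem: "w t \<in> w ` U \<longleftrightarrow> t \<in> V" for t
    proof
      assume "w t \<in> w ` U"
      then obtain s where s: "s \<in> U" "w s = w t" by force
      then have "s - t \<in> \<int>" using w_eq by simp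
      then obtain k where "s - t = of_int k" by (rule Ints_cases)
      then have "s = t + of_int k" by simp
      with s show "t \<in> V" by (auto simp: V_def)
    next
      assume "t \<in> V"
      then obtain k :: int where "t + of_int k \<in> U" by (auto simp: V_def)
      then show "w t \<in> w ` U" using w_int[of t k] by (metis imageI)
    qed
    have eq: "w ` U = sphere 0 1 - w ` ({0..1} - V)"
    proof
      show "w ` U \<subseteq> sphere 0 1 - w ` ({0..1} - V)"
      proof (rule subsetI, rule DiffI, goal_cases)
        case (1 z)
        then show ?case using w_in by (elim imageE) simp
      next
        case (2 z)
        show ?case
        proof
          assume "z \<in> w ` ({0..1} - V)"
          then obtain t where "z = w t" "t \<notin> V" by (elim imageE DiffE)
          with 2 show False using mem[of t] by simp
        qed
      qed
      show "sphere 0 1 - w ` ({0..1} - V) \<subseteq> w ` U"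
      proof
        fix z assume z: "z \<in> sphere 0 1 - w ` ({0..1} - V)"
        then have "z \<in> range w" using w_surj by simp
        then obtain s where "z = w s" by (elim rangeE)
        then have zs: "z = w (s + of_int (- \<lfloor>s\<rfloor>))" by (simp only: w_int)
        have "s + of_int (- \<lfloor>s\<rfloor>) \<in> {0..1}" by (simp, linarith)
        then have "s + of_int (- \<lfloor>s\<rfloor>) \<in> V" using z zs by blast
        then show "z \<in> w ` U" using mem zs by simp
      qed
    qed
    have "compact ({0..1} - V)" using \<open>open V\<close> by (simp add: compact_diff)
    then have "closed (w ` ({0..1} - V))" using compact_continuous_image[OF w_cont] compact_imp_closed by blast
    then show ?thesis unfolding eq C_def Diff_eq by (intro openin_open_Int open_Compl)
  qed
  have "circle_parametrization X (h \<circ> w)"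
  proof
    have wc: "continuous_map euclideanreal C w"
      using w_cont[of UNIV] w_in by (simp add: C_def continuous_map_in_subtopology image_subset_iff)
    show "continuous_map euclideanreal X (h \<circ> w)"
      by (rule continuous_map_compose[OF wc homeomorphic_imp_continuous_map[OF h]])
    have "open_map euclideanreal C w" using w_open by (simp add: open_map_def)
    then show "open_map euclideanreal X (h \<circ> w)"
      by (rule open_map_compose[OF _ homeomorphic_imp_open_map[OF h]])
    show "range (h \<circ> w) = topspace X"
      using w_surj homeomorphic_imp_surjective_map[OF h] Ctop by (metis image_comp)
    show "(h \<circ> w) s = (h \<circ> w) t \<longleftrightarrow> s - t \<in> \<int>" for s t
      using w_eq[of s t] inj_onD[OF homeomorphic_imp_injective_map[OF h], of "w s" "w t"] w_in Ctop by auto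
    show "Hausdorff_space X" by (rule assms(2))
  qed
  then show ?thesis by blast
qed

section \<open>Group actions on the circle\<close>

locale circle_action = circle_parametrization X e
  for X :: "'s topology" and e :: "real \<Rightarrow> 's" +
  fixes Q :: "('s \<Rightarrow> 's) set"
  assumes Q_homeomorphic: "f \<in> Q \<Longrightarrow> homeomorphic_map X X f"
    and Q_id: "id \<in> Q"
    and Q_comp: "f \<in> Q \<Longrightarrow> g \<in> Q \<Longrightarrow> f \<circ> g \<in> Q"
    and Q_inverse: "f \<in> Q \<Longrightarrow> \<exists>g\<in>Q. g \<circ> f = id \<and> f \<circ> g = id"
begin

text \<open>Only interiors enter, because the overlap relation speaks of open subsegments.
  \<open>free_segments_eq\<close> identifies this notion with the given one.\<close>

definition free :: "'s set \<Rightarrow> bool" where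
  "free \<Sigma> \<longleftrightarrow> segment \<Sigma> \<and>
     (\<forall>f\<in>Q. f \<noteq> id \<longrightarrow> f ` (X interior_of \<Sigma>) \<inter> X interior_of \<Sigma> = {})"

definition max_free :: "'s set \<Rightarrow> bool" where
  "max_free \<Sigma> \<longleftrightarrow> free \<Sigma> \<and> (\<forall>\<Sigma>'. free \<Sigma>' \<longrightarrow> \<Sigma> \<subseteq> \<Sigma>' \<longrightarrow> \<Sigma>' = \<Sigma>)"

lemma free_segment: "free \<Sigma> \<Longrightarrow> segment \<Sigma>"
  by (simp add: free_def)

lemma max_free_free: "max_free \<Sigma> \<Longrightarrow> free \<Sigma>"
  by (simp add: max_free_def)

lemma Q_in: "f \<in> Q \<Longrightarrow> x \<in> topspace X \<Longrightarrow> f x \<in> topspace X"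
  using Q_homeomorphic homeomorphic_imp_surjective_map by blast

lemma Q_inj: "f \<in> Q \<Longrightarrow> inj f"
  using Q_inverse by (metis inj_on_id inj_on_imageI2)

lemma interior_of_Q_image:
  "f \<in> Q \<Longrightarrow> \<Sigma> \<subseteq> topspace X \<Longrightarrow> X interior_of (f ` \<Sigma>) = f ` (X interior_of \<Sigma>)"
  using Q_homeomorphic homeomorphic_map_interior_of by blast

text \<open>If the interior of \<open>D\<close> met its image, density of \<open>B\<close> would
  apply twice: first to find a point of \<open>B\<close> in the intersection, then, near its
  preimage, a point of \<open>B\<close> whose image is again in \<open>B\<close>.\<close>

lemma disjoint_from_image_dense:
  assumes f: "f \<in> Q" and B: "openin X B" "f ` B \<inter> B = {}" and D: "D \<subseteq> X closure_of B"
  shows "f ` (X interior_of D) \<inter> X interior_of D = {}"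
proof (rule ccontr)
  let ?U = "X interior_of D"
  have U: "openin X ?U" "?U \<subseteq> X closure_of B" using D interior_of_subset[of X D] by auto
  have fU: "openin X (f ` ?U)"
    using homeomorphic_imp_open_map[OF Q_homeomorphic[OF f]] U(1) by (simp add: open_map_def)
  assume "f ` ?U \<inter> ?U \<noteq> {}"
  then obtain y where "y \<in> f ` ?U \<inter> ?U" by blast
  then obtain b where b: "b \<in> B" "b \<in> f ` ?U"
    using U fU in_closure_of[of y X B] by (metis IntD1 IntD2 subsetD)
  then obtain u where u: "u \<in> ?U" "f u = b" by blast
  define V where "V = ?U \<inter> {u \<in> topspace X. f u \<in> B}"
  have V: "openin X V" unfolding V_def
    by (intro openin_Int U(1)
        openin_continuous_map_preimage[OF homeomorphic_imp_continuous_map[OF Q_homeomorphic[OF f]] B(1)])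
  have uV: "u \<in> V" using u b openin_subset[OF U(1)] unfolding V_def by auto
  have "u \<in> X closure_of B" using U(2) u(1) by (rule subsetD)
  with V uV have "\<exists>b'. b' \<in> B \<and> b' \<in> V" by (simp add: in_closure_of)
  then have "\<exists>b'\<in>B. b' \<in> ?U \<and> f b' \<in> B" unfolding V_def by blast
  then show False using B(2) by blast
qed

text \<open>The closure can have a larger interior, as for a circle minus a point, so disjointness
  is transferred by density. Consequently a maximal free segment is closed.\<close>

lemma free_closure_of:
  assumes "free \<Sigma>"
  shows "free (X closure_of \<Sigma>)"
  unfolding free_def
proof (intro conjI ballI impI)
  have \<Sigma>: "segment \<Sigma>" using assms by (rule free_segment)
  then show "segment (X closure_of \<Sigma>)"
    using closure_of_subset[OF segment_subset_topspace[OF \<Sigma>]]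
    unfolding segment_def by (blast intro: connectedin_closure_of)
  fix f assume f: "f \<in> Q" "f \<noteq> id"
  have "X closure_of \<Sigma> \<subseteq> X closure_of (X interior_of \<Sigma>)"
    by (rule closure_of_minimal[OF segment_subset_closure_interior[OF \<Sigma>]]) simp
  then show "f ` (X interior_of (X closure_of \<Sigma>)) \<inter> X interior_of (X closure_of \<Sigma>) = {}"
    using assms f by (intro disjoint_from_image_dense[OF f(1)]) (auto simp: free_def)
qed

text \<open>Any two members lie in a common one, so the union of the interiors is disjoint from its
  nontrivial images. It is dense in \<open>\<Union>C\<close>, which settles the possibly larger
  interior of \<open>\<Union>C\<close>. This is the chain condition for Zorn's lemma.\<close>

lemma free_chain_Union:
  assumes C: "C \<noteq> {}" "subset.chain {\<Sigma>. free \<Sigma>} C"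
  shows "free (\<Union>C)"
  unfolding free_def
proof (intro conjI ballI impI)
  obtain \<Sigma>0 where \<Sigma>0: "\<Sigma>0 \<in> C" using C(1) by blast
  have Cfree: "\<Sigma> \<in> C \<Longrightarrow> free \<Sigma>" for \<Sigma> using C(2) by (auto simp: subset_chain_def)
  have lin: "A \<in> C \<Longrightarrow> B \<in> C \<Longrightarrow> A \<subseteq> B \<or> B \<subseteq> A" for A B using C(2) by (auto simp: subset_chain_def)
  obtain a b where ab: "a \<in> \<Sigma>0" "b \<in> \<Sigma>0" "a \<noteq> b"
    using free_segment[OF Cfree[OF \<Sigma>0]] by (auto simp: segment_def)
  \<comment> \<open>Dropping the members that do not contain \<open>\<Sigma>0\<close> keeps the
    union and leaves connected sets with a common point.\<close>
  have "\<Union>C = \<Union>{\<Sigma> \<in> C. \<Sigma>0 \<subseteq> \<Sigma>}" using lin \<Sigma>0 by blast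
  moreover have "connectedin X (\<Union>{\<Sigma> \<in> C. \<Sigma>0 \<subseteq> \<Sigma>})"
    by (rule connectedin_Union) (use Cfree free_segment ab in \<open>auto simp: segment_def\<close>)
  ultimately show "segment (\<Union>C)" using ab \<Sigma>0 unfolding segment_def by auto
  fix f assume f: "f \<in> Q" "f \<noteq> id"
  let ?B = "\<Union>\<Sigma>\<in>C. X interior_of \<Sigma>"
  show "f ` (X interior_of \<Union>C) \<inter> X interior_of \<Union>C = {}"
  proof (rule disjoint_from_image_dense[OF f(1), of ?B])
    show "openin X ?B" by auto
    show "f ` ?B \<inter> ?B = {}"
    proof (rule ccontr)
      assume "f ` ?B \<inter> ?B \<noteq> {}"
      then obtain x A B where x: "A \<in> C" "B \<in> C" "x \<in> X interior_of A" "f x \<in> X interior_of B" by blast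
      obtain D where D: "D \<in> C" "A \<subseteq> D" "B \<subseteq> D" using lin[OF x(1,2)] x(1,2) by blast
      then have "x \<in> X interior_of D" "f x \<in> X interior_of D"
        using x(3,4) interior_of_mono by blast+
      then show False using Cfree[OF D(1)] f by (auto simp: free_def)
    qed
    show "\<Union>C \<subseteq> X closure_of ?B"
    proof
      fix x assume "x \<in> \<Union>C"
      then obtain A where A: "A \<in> C" "x \<in> A" by blast
      then have "x \<in> X closure_of (X interior_of A)"
        using segment_subset_closure_interior[OF free_segment[OF Cfree[OF A(1)]]] by blast
      then show "x \<in> X closure_of ?B" using A(1) closure_of_mono[of "X interior_of A" ?B X] by blast
    qed
  qed
qed

lemma ex_max_free:
  assumes "free \<Sigma>"
  shows "\<exists>\<Sigma>'. max_free \<Sigma>'"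
proof -
  have "\<exists>M\<in>{\<Sigma>. free \<Sigma>}. \<forall>Y\<in>{\<Sigma>. free \<Sigma>}. M \<subseteq> Y \<longrightarrow> Y = M"
    by (rule subset_Zorn_nonempty) (use assms free_chain_Union in auto)
  then show ?thesis by (auto simp: max_free_def)
qed

text \<open>Conjugation by \<open>f\<close> preserves the nontrivial elements of \<open>Q\<close>,
  so the freeness of \<Sigma> can be applied to \<open>g \<circ> h \<circ> f\<close>.\<close>

lemma free_Q_image:
  assumes "free \<Sigma>" "f \<in> Q"
  shows "free (f ` \<Sigma>)"
  unfolding free_def
proof (intro conjI ballI impI)
  have \<Sigma>: "segment \<Sigma>" using assms(1) by (rule free_segment)
  have "connectedin X (f ` \<Sigma>)"
    using connectedin_continuous_map_image[OF homeomorphic_imp_continuous_map[OF Q_homeomorphic[OF assms(2)]]] \<Sigma>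
    by (simp add: segment_def)
  then show "segment (f ` \<Sigma>)"
    using \<Sigma> injD[OF Q_inj[OF assms(2)]] unfolding segment_def by blast
  fix h assume h: "h \<in> Q" "h \<noteq> id"
  obtain g where g: "g \<in> Q" "g \<circ> f = id" "f \<circ> g = id" using Q_inverse[OF assms(2)] by blast
  let ?k = "g \<circ> h \<circ> f"
  have "?k \<noteq> id"
  proof
    assume "?k = id"
    then have "f \<circ> ?k \<circ> g = id" using g(3) by simp
    moreover have "f \<circ> ?k \<circ> g = (f \<circ> g) \<circ> h \<circ> (f \<circ> g)" by (simp add: o_assoc)
    ultimately show False using g(3) h(2) by simp
  qed
  moreover have "?k \<in> Q" using g(1) h(1) assms(2) Q_comp by blast
  ultimately have disj: "?k ` (X interior_of \<Sigma>) \<inter> X interior_of \<Sigma> = {}" using assms(1) unfolding free_def by blast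
  have gf: "g (f x) = x" for x using fun_cong[OF g(2), of x] by simp
  show "h ` (X interior_of (f ` \<Sigma>)) \<inter> X interior_of (f ` \<Sigma>) = {}"
    unfolding interior_of_Q_image[OF assms(2) segment_subset_topspace[OF \<Sigma>]]
  proof (intro equals0I)
    fix z assume "z \<in> h ` f ` (X interior_of \<Sigma>) \<inter> f ` (X interior_of \<Sigma>)"
    then obtain x y where xy: "x \<in> X interior_of \<Sigma>" "y \<in> X interior_of \<Sigma>" "h (f x) = f y" by blast
    then have "?k x = y" by (simp add: gf)
    with xy disj show False by blast
  qed
qed

lemma max_free_Q_image:
  assumes "max_free \<Sigma>" "f \<in> Q"
  shows "max_free (f ` \<Sigma>)"
  unfolding max_free_def
proof (intro conjI allI impI)
  show "free (f ` \<Sigma>)" using assms max_free_free free_Q_image by blast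
  fix \<Sigma>' assume \<Sigma>': "free \<Sigma>'" "f ` \<Sigma> \<subseteq> \<Sigma>'"
  obtain g where g: "g \<in> Q" "g \<circ> f = id" "f \<circ> g = id" using Q_inverse[OF assms(2)] by blast
  have "g ` f ` \<Sigma> = \<Sigma>" using g(2) by (simp add: image_comp)
  then have "\<Sigma> \<subseteq> g ` \<Sigma>'" using \<Sigma>'(2) by blast
  then have "g ` \<Sigma>' = \<Sigma>" using assms(1) free_Q_image[OF \<Sigma>'(1) g(1)] by (auto simp: max_free_def)
  moreover have "f ` g ` \<Sigma>' = \<Sigma>'" using g(3) by (simp add: image_comp)
  ultimately show "\<Sigma>' = f ` \<Sigma>" by simp
qed

text \<open>Applying the inverse of \<open>f\<close> to both images reduces this to the defining
  condition of freeness. Thus an interior point of a translate determines the element of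
  \<open>Q\<close>.\<close>

lemma translates_disjoint:
  assumes "free \<Sigma>" "f \<in> Q" "g \<in> Q" "f ` (X interior_of \<Sigma>) \<inter> g ` (X interior_of \<Sigma>) \<noteq> {}"
  shows "f = g"
proof -
  obtain h where h: "h \<in> Q" "h \<circ> f = id" "f \<circ> h = id" using Q_inverse[OF assms(2)] by blast
  obtain x y where xy: "x \<in> X interior_of \<Sigma>" "y \<in> X interior_of \<Sigma>" "f x = g y" using assms(4) by blast
  then have "(h \<circ> g) y = x" using fun_cong[OF h(2), of x] by simp
  then have "(h \<circ> g) ` (X interior_of \<Sigma>) \<inter> X interior_of \<Sigma> \<noteq> {}" using xy by blast
  moreover have "h \<circ> g \<in> Q" using h(1) assms(3) Q_comp by blast
  ultimately have "h \<circ> g = id" using assms(1) unfolding free_def by blast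
  then have "f \<circ> (h \<circ> g) = f" by simp
  then show "f = g" using h(3) by (simp add: o_assoc)
qed

end

text \<open>Non-contractivity is stated for pairs: a translate of a segment leaves \<open>U\<close>
  as soon as the images of two of its points are not both in \<open>U\<close>.\<close>

locale free_circle_action = circle_action +
  assumes noncontractive: "c \<in> topspace X \<Longrightarrow> d \<in> topspace X \<Longrightarrow> c \<noteq> d \<Longrightarrow> x \<in> topspace X - {c, d} \<Longrightarrow>
       \<exists>U. openin X U \<and> x \<in> U \<and> (\<forall>f\<in>Q. \<not> f ` {c, d} \<subseteq> U)"
    and ex_free: "\<exists>\<Sigma>. free \<Sigma>"
    and not_free: "\<not> free (topspace X)"
begin

text \<open>Infinitely many disjoint translates of an open arc would accumulate at a point \<open>x\<close>. A small arc
  around \<open>x\<close> contains all of them but the two that pass through one of its end points.\<close>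

lemma finite_Q: "finite Q"
proof (rule ccontr)
  assume inf: "infinite Q"
  obtain \<Sigma> where \<Sigma>: "free \<Sigma>" using ex_free by blast
  obtain c where c: "c \<in> X interior_of \<Sigma>" using segment_interior_nonempty[OF free_segment[OF \<Sigma>]] by blast
  obtain A where A: "segment A" "openin X A" "c \<in> A" "A \<subseteq> X interior_of \<Sigma>"
    using openin_contains_segment[OF openin_interior_of c] by blast
  have Atop: "A \<subseteq> topspace X" using A(1) by (rule segment_subset_topspace)
  have disj: "f = g" if "f \<in> Q" "g \<in> Q" "f ` A \<inter> g ` A \<noteq> {}" for f g
    using translates_disjoint[OF \<Sigma> that(1,2)] that(3) A(4) by blast
  have "inj_on (\<lambda>f. f c) Q" using disj A(3) by (intro inj_onI) blast
  then have "infinite ((\<lambda>f. f c) ` Q)" using inf finite_image_iff by blast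
  moreover have "(\<lambda>f. f c) ` Q \<subseteq> topspace X" using Q_in A(3) Atop by auto
  ultimately have "topspace X \<inter> X derived_set_of ((\<lambda>f. f c) ` Q) \<noteq> {}"
    using compactin_imp_Bolzano_Weierstrass compact_space by (metis compact_space_def)
  then obtain x where x: "x \<in> topspace X"
      "\<And>U. x \<in> U \<Longrightarrow> openin X U \<Longrightarrow> infinite ((\<lambda>f. f c) ` Q \<inter> U)"
    using derived_set_of_infinite_openin[OF Hausdorff] by auto
  have "infinite A"
  proof
    assume "finite A"
    obtain t where t: "c = e t" using A(3) Atop e_surj by blast
    have "open {s. e s \<in> A}" "t \<in> {s. e s \<in> A}" using open_e_preimage[OF A(2)] A(3) t by auto
    then obtain r where r: "r > 0" "ball t r \<subseteq> {s. e s \<in> A}" using open_contains_ball by metis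
    have "inj_on e {t..<t + min r 1}" by (rule e_inj_on) auto
    moreover have "e ` {t..<t + min r 1} \<subseteq> A" using r(2) by (auto simp: dist_real_def subset_iff)
    ultimately have "finite {t..<t + min r 1}" using \<open>finite A\<close> finite_imageD finite_subset by blast
    then show False using r(1) infinite_Ico[of t "t + min r 1"] by simp
  qed
  \<comment> \<open>Two points \<open>a\<close> and \<open>b\<close> of \<open>A\<close> other than
    \<open>x\<close> are chosen. Non-contractivity then gives a neighbourhood \<open>U\<close> of
    \<open>x\<close> that contains no translate of \<open>A\<close>.\<close>
  then have "infinite (A - {x})" by simp
  then obtain a where a: "a \<in> A - {x}" by (metis ex_in_conv finite.emptyI)
  have "infinite (A - {x} - {a})" using \<open>infinite (A - {x})\<close> by simp
  then obtain b where b: "b \<in> A - {x} - {a}" by (metis ex_in_conv finite.emptyI)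
  have "a \<in> topspace X" "b \<in> topspace X" "a \<noteq> b" "x \<in> topspace X - {a, b}"
    using a b x(1) Atop by auto
  then obtain U where U: "openin X U" "x \<in> U" "\<And>f. f \<in> Q \<Longrightarrow> \<not> f ` {a, b} \<subseteq> U"
    using noncontractive by metis
  obtain t where t: "x = e t" using x(1) e_surj by blast
  obtain r where r: "r > 0" "ball t r \<subseteq> {s. e s \<in> U}"
    using open_e_preimage[OF U(1)] U(2) t open_contains_ball by (metis mem_Collect_eq)
  define V where "V = e ` {t - r / 2<..<t + r / 2}"
  have V: "openin X V" "x \<in> V" "V \<subseteq> U"
    using r by (auto simp: V_def t dist_real_def subset_iff intro!: openin_e_image)
  define F where "F = {f \<in> Q. f c \<in> V}"
  have "(\<lambda>f. f c) ` Q \<inter> V \<subseteq> (\<lambda>f. f c) ` F" by (auto simp: F_def)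
  then have "infinite F" using x(2)[OF V(2,1)] finite_subset by blast
  have cl: "X closure_of V \<subseteq> e ` {t - r / 2..t + r / 2}"
    by (rule closure_of_minimal[OF _ closedin_arc]) (auto simp: V_def)
  have front: "X frontier_of V \<subseteq> {e (t - r / 2), e (t + r / 2)}"
  proof
    fix z assume "z \<in> X frontier_of V"
    then have z: "z \<in> X closure_of V" "z \<notin> V"
      using V(1) by (auto simp: frontier_of_def interior_of_openin)
    then obtain s where s: "s \<in> {t - r / 2..t + r / 2}" "z = e s" using cl by blast
    with z(2) have "s \<notin> {t - r / 2<..<t + r / 2}" unfolding V_def by blast
    with s(1) have "s = t - r / 2 \<or> s = t + r / 2" by auto
    with s(2) show "z \<in> {e (t - r / 2), e (t + r / 2)}" by blast
  qed
  \<comment> \<open>A connected translate that meets \<open>V\<close> without being contained in it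
    crosses the frontier.\<close>
  have "e (t - r / 2) \<in> f ` A \<or> e (t + r / 2) \<in> f ` A" if "f \<in> F" for f
  proof -
    have f: "f \<in> Q" "f c \<in> V" using that by (auto simp: F_def)
    have "connectedin X (f ` A)"
      using connectedin_continuous_map_image[OF homeomorphic_imp_continuous_map[OF Q_homeomorphic[OF f(1)]]] A(1)
      by (simp add: segment_def)
    moreover have "f ` A \<inter> V \<noteq> {}" using f(2) A(3) by blast
    moreover have "f ` A - V \<noteq> {}" using U(3)[OF f(1)] V(3) a b by blast
    ultimately have "f ` A \<inter> X frontier_of V \<noteq> {}" by (rule connectedin_Int_frontier_of)
    then obtain z where "z \<in> f ` A" "z \<in> X frontier_of V" by blast
    moreover from this(2) front have "z = e (t - r / 2) \<or> z = e (t + r / 2)" by blast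
    ultimately show ?thesis by metis
  qed
  then have "F \<subseteq> {f \<in> Q. e (t - r / 2) \<in> f ` A} \<union> {f \<in> Q. e (t + r / 2) \<in> f ` A}"
    by (auto simp: F_def)
  \<comment> \<open>Translates of \<open>A\<close> by different elements are disjoint, so each point
    lies in at most one of them.\<close>
  moreover have "finite {f \<in> Q. z \<in> f ` A}" for z
  proof (cases "{f \<in> Q. z \<in> f ` A} = {}")
    case False
    then obtain g where "g \<in> Q" "z \<in> g ` A" by blast
    then have "{f \<in> Q. z \<in> f ` A} \<subseteq> {g}" using disj by blast
    then show ?thesis using finite_subset by blast
  next
    case True
    then show ?thesis by (simp only: finite.emptyI)
  qed
  ultimately show False using \<open>infinite F\<close> finite_subset by blast
qed

text \<open>The closure is free as well, so maximality makes \<Sigma> closed, hence compact. It is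
  proper because the whole circle is not free.\<close>

lemma max_free_arc:
  assumes "max_free \<Sigma>"
  obtains a b where "\<Sigma> = e ` {a..b}" "a < b" "b < a + 1"
proof -
  have \<Sigma>: "free \<Sigma>" "segment \<Sigma>" using assms max_free_free free_segment by auto
  have "\<Sigma> \<subseteq> X closure_of \<Sigma>" using \<Sigma>(2) by (simp add: closure_of_subset segment_subset_topspace)
  then have "X closure_of \<Sigma> = \<Sigma>" using assms free_closure_of[OF \<Sigma>(1)] by (auto simp: max_free_def)
  then have "closedin X \<Sigma>" by (metis closedin_closure_of)
  then have "compactin X \<Sigma>" using compact_space closedin_compact_space by blast
  moreover have "\<Sigma> \<noteq> topspace X" using \<Sigma>(1) not_free by auto
  ultimately show ?thesis using compact_proper_segment[OF \<Sigma>(2)] that by blast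
qed

end

section \<open>Tilings of the circle by translates\<close>

text \<open>The image of 1 must be a neighbour of 0 in the cycle, that is 1 or \<open>n\<close>.
  From then on injectivity forbids stepping back, so every further value is forced.\<close>

lemma cyclic_adjacency_rigid:
  fixes \<pi> :: "nat \<Rightarrow> nat"
  assumes n: "2 \<le> n" and inj: "inj_on \<pi> {..n}" and le: "\<And>k. k \<le> n \<Longrightarrow> \<pi> k \<le> n" and "\<pi> 0 = 0"
    and adj: "\<And>k. k < n \<Longrightarrow> \<bar>int (\<pi> k) - int (\<pi> (Suc k))\<bar> \<in> {1, int n}"
  shows "(\<forall>k\<le>n. \<pi> k = k) \<or> (\<forall>k\<le>n. \<pi> k = reversal_index n k)"
proof -
  have ne: "\<pi> p \<noteq> \<pi> q" if "p \<le> n" "q \<le> n" "p \<noteq> q" for p q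
    using inj that by (auto simp: inj_on_def)
  have "\<pi> 1 = 1 \<or> \<pi> 1 = n" using adj[of 0] \<open>\<pi> 0 = 0\<close> n by auto
  then show ?thesis
  proof
    assume 1: "\<pi> 1 = 1"
    have up: "\<pi> k = k \<and> \<pi> (Suc k) = Suc k" if "k < n" for k
      using that
    proof (induction k)
      case (Suc k)
      then have "\<pi> k = k" "\<pi> (Suc k) = Suc k" by auto
      then show ?case
        using adj[of "Suc k"] ne[of k "Suc (Suc k)"] le[of "Suc (Suc k)"] Suc.prems by auto
    qed (use 1 \<open>\<pi> 0 = 0\<close> in auto)
    have "\<pi> k = k" if "k \<le> n" for k
      using up[of "k - 1"] that \<open>\<pi> 0 = 0\<close> by (cases k) auto
    then show ?thesis by blast
  next
    assume 1: "\<pi> 1 = n"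
    \<comment> \<open>Each step uses the two preceding values, hence complete induction. The value
      before \<open>n\<close> is 0, where the decreasing pattern would give n + 1.\<close>
    have down: "\<pi> (Suc k) = n - k" if "k < n" for k
      using that
    proof (induction k rule: less_induct)
      case (less k)
      show ?case
      proof (cases k)
        case (Suc j)
        have j: "\<pi> (Suc j) = n - j" using less Suc by auto
        have "\<pi> j = (if j = 0 then 0 else n - (j - 1))"
          using less.IH[of "j - 1"] less.prems Suc \<open>\<pi> 0 = 0\<close> by (cases j) auto
        then show ?thesis
          using adj[of "Suc j"] j ne[of j "Suc (Suc j)"] le[of "Suc (Suc j)"] less.prems Suc
          by (auto split: if_splits)
      qed (use 1 in simp)
    qed
    have "\<pi> k = reversal_index n k" if "k \<le> n" for k
      using down[of "k - 1"] that \<open>\<pi> 0 = 0\<close> by (cases k) (auto simp: reversal_index_def)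
    then show ?thesis by blast
  qed
qed

lemma reversal_index_le: "k \<le> n \<Longrightarrow> reversal_index n k \<le> n"
  by (auto simp: reversal_index_def)

lemma reversal_index_involutive: "k \<le> n \<Longrightarrow> reversal_index n (reversal_index n k) = k"
  by (auto simp: reversal_index_def)

text \<open>Reversal is k to n + 1 - k modulo n + 1, so it preserves distance in the cycle. The two
  ranges of index differences in a decomposition, {1, n} and {2, ..., n - 1}, are stable under d to
  n + 1 - d.\<close>

lemma reversal_index_diff:
  assumes "p \<le> n" "q \<le> n" "p \<noteq> q"
  defines "d \<equiv> \<bar>int (reversal_index n p) - int (reversal_index n q)\<bar>"
  shows "d = \<bar>int p - int q\<bar> \<or> d = int n + 1 - \<bar>int p - int q\<bar>"
  using assms(1-3) unfolding d_def by (auto simp: reversal_index_def of_nat_diff)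

section \<open>Intersections and boundaries of arcs within one turn\<close>

context circle_parametrization
begin

lemma arc_shift: "e ` {a + of_int k..b + of_int k} = e ` {a..b}"
proof -
  have "{a + of_int k..b + of_int k} = (\<lambda>t. t + of_int k) ` {a..b}" by simp
  then show ?thesis by (simp only: image_image e_plus_int)
qed

text \<open>Both parameter intervals lie in one turn, so two parameters of a common point differ by
  0 or 1. Difference 0 means a shared end; difference 1 means the base point, reached from both
  sides.\<close>

lemma arc_Int_arc:
  assumes "a \<le> u" "u < v" "v \<le> w" "w < z" "z \<le> a + 1"
  shows "e ` {u..v} \<inter> e ` {w..z} =
    (if v = w then {e v} else {}) \<union> (if u = a \<and> z = a + 1 then {e a} else {})" (is "?L = ?R")
proof
  show "?L \<subseteq> ?R"
  proof
    fix x assume "x \<in> ?L"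
    then obtain s s' where s: "s \<in> {u..v}" "s' \<in> {w..z}" "x = e s" "e s' = e s" by force
    then obtain k where k: "s' - s = of_int k" using e_eq_iff by (metis Ints_cases)
    have "0 \<le> s' - s" "s' - s \<le> 1" using s assms by auto
    then have "k = 0 \<or> k = 1" unfolding k by auto
    then show "x \<in> ?R"
    proof
      assume "k = 0"
      then have "s = v" "v = w" using k s(1,2) assms by auto
      then show ?thesis using s(3) by simp
    next
      assume "k = 1"
      then have "s = a" "u = a" "z = a + 1" using k s(1,2) assms by auto
      then show ?thesis using s(3) by simp
    qed
  qed
  have "e (a + 1) = e a" using e_plus_int[of a 1] by simp
  have mem: "e v \<in> e ` {u..v}" "e w \<in> e ` {w..z}" "e u \<in> e ` {u..v}" "e z \<in> e ` {w..z}"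
    using assms by auto
  have "e v \<in> ?L" if "v = w" using mem(1,2) that by blast
  moreover have "e a \<in> ?L" if "u = a" "z = a + 1"
    using mem(3,4) \<open>e (a + 1) = e a\<close> unfolding that by auto
  ultimately show "?R \<subseteq> ?L" by (auto split: if_splits)
qed

definition boundary :: "'s set \<Rightarrow> 's set" where
  "boundary \<Sigma> = \<Sigma> - X interior_of \<Sigma>"

lemma boundary_arc:
  assumes "a < b" "b < a + 1"
  shows "boundary (e ` {a..b}) = {e a, e b}"
proof -
  have "e ` {a..b} = e ` {a<..<b} \<union> {e a, e b}" using assms by (force simp: order_le_less)
  moreover have "A \<union> {x, y} - A = {x, y}" if "x \<notin> A" "y \<notin> A" for A and x y :: 's using that by auto
  ultimately show ?thesis
    using end_notin_interior[OF assms] unfolding boundary_def interior_of_arc[OF assms] by simp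
qed

end

section \<open>Walking around the circle from tile to tile\<close>

context free_circle_action
begin

text \<open>If no nontrivial element took \<open>e b\<close> into the arc, the arc could be
  prolonged beyond \<open>b\<close>. So some \<open>f\<close> does, possibly a reflection fixing
  \<open>e b\<close>. Its inverse gives a translate containing \<open>e b\<close>, and disjointness
  of interiors makes that translate start at \<open>b\<close>.\<close>

lemma right_neighbour:
  assumes max: "max_free (e ` {a..b})" and ab: "a < b" "b < a + 1"
  shows "\<exists>f\<in>Q. \<exists>d. b < d \<and> d < b + 1 \<and> f ` e ` {a..b} = e ` {b..d}"
proof -
  let ?\<Sigma> = "e ` {a..b}"
  have fr: "free ?\<Sigma>" using max by (rule max_free_free)
  have inj: "inj_on e {a..<a + 1}" by (rule e_inj_on) auto
  have "\<exists>f\<in>Q. f \<noteq> id \<and> f (e b) \<in> ?\<Sigma>"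
  proof (rule ccontr)
    assume none: "\<not> ?thesis"
    have ev: "eventually (\<lambda>\<delta>. f ` e ` {b..b + \<delta>} \<inter> e ` {a..b + \<delta>} = {}) (at_right 0)"
      if f: "f \<in> Q - {id}" for f
    proof -
      obtain y where y: "a \<le> y" "y < a + 1" "e y = f (e b)"
        using e_lift[of "f (e b)" a] Q_in f by (metis DiffD1 e_in)
      have "e y \<notin> ?\<Sigma>" using none f y(3) by auto
      with y(1) have "b < y" by force
      \<comment> \<open>\<open>m\<close> separates the parameter \<open>y\<close> of
        \<open>f (e b)\<close> from the arc: images of points near \<open>b\<close> stay beyond
        \<open>m\<close>, while the prolonged arc ends before it.\<close>
      define m where "m = (b + y) / 2"
      have m: "b < m" "m < y" using \<open>b < y\<close> by (auto simp: m_def)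
      have "continuous_map euclideanreal X (f \<circ> e)"
        using continuous_map_compose[OF e_continuous] homeomorphic_imp_continuous_map[OF Q_homeomorphic] f
        by blast
      then have "openin euclideanreal {x \<in> topspace euclideanreal. (f \<circ> e) x \<in> e ` {m<..<a + 1}}"
        by (rule openin_continuous_map_preimage) (auto intro: openin_e_image)
      then have "open {x. f (e x) \<in> e ` {m<..<a + 1}}" by simp
      moreover have "b \<in> {x. f (e x) \<in> e ` {m<..<a + 1}}" using y m by (auto simp flip: y(3))
      ultimately obtain r where r: "r > 0" "ball b r \<subseteq> {x. f (e x) \<in> e ` {m<..<a + 1}}"
        using open_contains_ball by metis
      show ?thesis
        unfolding eventually_at_right_field
      proof (intro exI conjI allI impI)
        show "min r (m - b) > 0" using r m by simp
        fix \<delta> assume \<delta>: "0 < \<delta>" "\<delta> < min r (m - b)"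
        have "{b..b + \<delta>} \<subseteq> ball b r" using \<delta> by (auto simp: dist_real_def)
        then have "f ` e ` {b..b + \<delta>} \<subseteq> e ` {m<..<a + 1}" using r(2) by blast
        moreover have "e ` {m<..<a + 1} \<inter> e ` {a..b + \<delta>} = e ` ({m<..<a + 1} \<inter> {a..b + \<delta>})"
          by (rule inj_on_image_Int[OF inj, symmetric]) (use m y \<delta> ab in auto)
        moreover have "{m<..<a + 1} \<inter> {a..b + \<delta>} = {}" using \<delta> by auto
        ultimately show "f ` e ` {b..b + \<delta>} \<inter> e ` {a..b + \<delta>} = {}" by auto
      qed
    qed
    \<comment> \<open>Finiteness of \<open>Q\<close> makes one \<delta> serve all nontrivial
      elements.\<close>
    have "eventually (\<lambda>\<delta>. \<forall>f\<in>Q - {id}. f ` e ` {b..b + \<delta>} \<inter> e ` {a..b + \<delta>} = {}) (at_right 0)"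
      using finite_Q ev by (intro eventually_ball_finite) auto
    moreover have "eventually (\<lambda>\<delta>. 0 < \<delta> \<and> \<delta> < a + 1 - b) (at_right (0::real))"
      unfolding eventually_at_right_field using ab by (intro exI[of _ "a + 1 - b"]) auto
    ultimately have "eventually (\<lambda>\<delta>. (\<forall>f\<in>Q - {id}. f ` e ` {b..b + \<delta>} \<inter> e ` {a..b + \<delta>} = {}) \<and>
        0 < \<delta> \<and> \<delta> < a + 1 - b) (at_right 0)"
      by (rule eventually_conj)
    then have "\<exists>\<delta>. (\<forall>f\<in>Q - {id}. f ` e ` {b..b + \<delta>} \<inter> e ` {a..b + \<delta>} = {}) \<and>
        0 < \<delta> \<and> \<delta> < a + 1 - b"
      by (rule eventually_happens'[OF trivial_limit_at_right_real])
    then obtain \<delta> where \<delta>0: "\<forall>f\<in>Q - {id}. f ` e ` {b..b + \<delta>} \<inter> e ` {a..b + \<delta>} = {}"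
      and \<delta>': "0 < \<delta>" "\<delta> < a + 1 - b"
      by (elim exE conjE)
    have "f ` e ` {b..b + \<delta>} \<inter> e ` {a..b + \<delta>} = {}" if "f \<in> Q" "f \<noteq> id" for f
      using \<delta>0 that by simp
    note \<delta> = this \<delta>'
    let ?\<Sigma>' = "e ` {a..b + \<delta>}"
    have ab': "a < b + \<delta>" "b + \<delta> < a + 1" using \<delta> ab by auto
    have "free ?\<Sigma>'"
      unfolding free_def interior_of_arc[OF ab']
    proof (intro conjI ballI impI equals0I)
      show "segment ?\<Sigma>'" using ab'(1) by (rule segment_arc)
      fix f z assume f: "f \<in> Q" "f \<noteq> id" and "z \<in> f ` e ` {a<..<b + \<delta>} \<inter> e ` {a<..<b + \<delta>}"
      then obtain x y where xy: "a < x" "x < b + \<delta>" "a < y" "y < b + \<delta>" "f (e x) = e y" by auto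
      obtain g where g: "g \<in> Q" "g \<circ> f = id" "f \<circ> g = id" using Q_inverse[OF f(1)] by blast
      have gy: "g (e y) = e x" using fun_cong[OF g(2), of "e x"] xy(5) by simp
      have "g \<noteq> id" using g(3) f(2) by auto
      \<comment> \<open>By the choice of \<delta>, no point of the added piece is moved into the
        prolonged arc. Applied to \<open>f\<close> for \<open>x\<close> and to its inverse for
        \<open>y\<close>, this confines both to the old arc, which is free.\<close>
      have "x < b"
      proof (rule ccontr)
        assume "\<not> x < b"
        then have "f (e x) \<in> f ` e ` {b..b + \<delta>}" using xy by (intro imageI) auto
        moreover have "f (e x) \<in> ?\<Sigma>'" using xy by auto
        ultimately show False using \<delta>(1)[OF f] by blast
      qed
      have "y < b"
      proof (rule ccontr)
        assume "\<not> y < b"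
        then have "g (e y) \<in> g ` e ` {b..b + \<delta>}" using xy by (intro imageI) auto
        moreover have "g (e y) \<in> ?\<Sigma>'" using xy gy by auto
        ultimately show False using \<delta>(1)[OF g(1) \<open>g \<noteq> id\<close>] by blast
      qed
      have "f ` e ` {a<..<b} \<inter> e ` {a<..<b} = {}"
        using fr f unfolding free_def interior_of_arc[OF ab] by blast
      moreover have "e x \<in> e ` {a<..<b}" "e y \<in> e ` {a<..<b}" using xy \<open>x < b\<close> \<open>y < b\<close> by auto
      ultimately show False using xy(5) by (metis IntI empty_iff imageI)
    qed
    moreover have "?\<Sigma> \<subseteq> ?\<Sigma>'" using \<delta>(2) by auto
    ultimately have "?\<Sigma>' = ?\<Sigma>" using max by (auto simp: max_free_def)
    then have "e ` {a<..<b + \<delta>} = e ` {a<..<b}"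
      using interior_of_arc[OF ab] interior_of_arc[OF ab'] by simp
    moreover have "e b \<in> e ` {a<..<b + \<delta>}" using ab \<delta> by auto
    ultimately show False using end_notin_interior(2)[OF ab] interior_of_arc[OF ab] by simp
  qed
  then obtain f where f: "f \<in> Q" "f \<noteq> id" "f (e b) \<in> ?\<Sigma>" by blast
  obtain h where h: "h \<in> Q" "h \<circ> f = id" "f \<circ> h = id" using Q_inverse[OF f(1)] by blast
  have "h \<noteq> id" using h(3) f(2) by auto
  have hb: "e b \<in> h ` ?\<Sigma>" using fun_cong[OF h(2), of "e b"] f(3) by (metis comp_apply id_apply imageI)
  obtain c d where cd: "h ` ?\<Sigma> = e ` {c..d}" "c < d" "d < c + 1"
    using max_free_arc[OF max_free_Q_image[OF max h(1)]] by blast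
  obtain k :: int where k: "b + of_int k \<in> {c..d}" using hb e_mem_image_iff unfolding cd(1) by blast
  \<comment> \<open>The integer shift makes the parameter interval contain \<open>b\<close>
    itself.\<close>
  define u v where "u = c - of_int k" and "v = d - of_int k"
  have uv: "u \<le> b" "b \<le> v" "u < v" "v < u + 1" using k cd by (auto simp: u_def v_def)
  have hS: "h ` ?\<Sigma> = e ` {u..v}" using arc_shift[of u k v] cd(1) by (simp add: u_def v_def)
  \<comment> \<open>A translate starting before \<open>b\<close> would overlap the given arc just to
    the left of \<open>b\<close>.\<close>
  have "u = b"
  proof (rule ccontr)
    assume "u \<noteq> b"
    then have "max a u < b" using uv ab by auto
    then obtain z where z: "max a u < z" "z < b" using dense by blast
    have "e z \<in> id ` (X interior_of ?\<Sigma>)" using z by (simp add: interior_of_arc[OF ab])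
    moreover have "e z \<in> h ` (X interior_of ?\<Sigma>)"
      using z uv interior_of_Q_image[OF h(1), of ?\<Sigma>] by (auto simp: hS interior_of_arc[OF uv(3,4)])
    ultimately show False
      using translates_disjoint[OF fr Q_id h(1)] \<open>h \<noteq> id\<close> by blast
  qed
  then show ?thesis using h(1) hS uv by auto
qed

text \<open>Lifted to the line, the chain of right neighbours is an increasing sequence
  \<open>t\<close>. It cannot jump over \<open>a + 1\<close>, since no tile overlaps the first one,
  and it cannot stay below, since \<open>Q\<close> is finite.\<close>

lemma closed_walk:
  assumes max: "max_free (e ` {a..b})" and ab: "a < b" "b < a + 1"
  obtains n and t :: "nat \<Rightarrow> real" and f where "1 \<le> n" "t 0 = a" "t (Suc 0) = b" "t (Suc n) = a + 1" "strict_mono t"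
    "\<And>k. t (Suc k) < t k + 1" "\<And>k. f k \<in> Q" "\<And>k. f k ` e ` {a..b} = e ` {t k..t (Suc k)}"
proof -
  let ?\<Sigma> = "e ` {a..b}"
  have fr: "free ?\<Sigma>" using max by (rule max_free_free)
  define tile where "tile = (\<lambda>p. fst p < snd p \<and> snd p < fst p + 1 \<and>
    (\<exists>f\<in>Q. f ` ?\<Sigma> = e ` {fst p..snd p}))"
  have "\<exists>p. \<forall>k. (tile (p k) \<and> (k = 0 \<longrightarrow> p k = (a, b))) \<and> fst (p (Suc k)) = snd (p k)"
  proof (rule dependent_nat_choice)
    show "\<exists>x. tile x \<and> ((0::nat) = 0 \<longrightarrow> x = (a, b))"
      using ab Q_id by (auto simp: tile_def intro!: bexI[of _ id])
    fix x and k :: nat assume "tile x \<and> (k = 0 \<longrightarrow> x = (a, b))"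
    then obtain f where f: "f \<in> Q" "f ` ?\<Sigma> = e ` {fst x..snd x}" "fst x < snd x" "snd x < fst x + 1"
      by (auto simp: tile_def)
    have "max_free (e ` {fst x..snd x})" using max_free_Q_image[OF max f(1)] f(2) by simp
    then obtain h d where h: "h \<in> Q" "snd x < d" "d < snd x + 1" "h ` e ` {fst x..snd x} = e ` {snd x..d}"
      using right_neighbour[OF _ f(3,4)] by blast
    have "(h \<circ> f) ` ?\<Sigma> = e ` {snd x..d}" using h(4) f(2) by (metis image_comp)
    then have "\<exists>g\<in>Q. g ` ?\<Sigma> = e ` {snd x..d}" using Q_comp[OF h(1) f(1)] by blast
    then have "tile (snd x, d)" using h(2,3) by (simp add: tile_def)
    then show "\<exists>y. (tile y \<and> (Suc k = 0 \<longrightarrow> y = (a, b))) \<and> fst y = snd x" by auto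
  qed
  then obtain p where p: "\<And>k. tile (p k)" "p 0 = (a, b)" "\<And>k. fst (p (Suc k)) = snd (p k)" by auto
  define t where "t = (\<lambda>k. fst (p k))"
  have t: "t 0 = a" "t (Suc 0) = b" "\<And>k. t k < t (Suc k)" "\<And>k. t (Suc k) < t k + 1"
    using p unfolding t_def tile_def by auto
  have "\<exists>f\<in>Q. f ` ?\<Sigma> = e ` {t k..t (Suc k)}" for k
    using p(1)[of k] p(3)[of k] unfolding tile_def t_def by auto
  then obtain f where f: "\<And>k. f k \<in> Q" "\<And>k. f k ` ?\<Sigma> = e ` {t k..t (Suc k)}" by metis
  have mono: "strict_mono t" using t(3) by (simp add: strict_mono_Suc_iff)
  have t_ge: "a \<le> t k" for k using strict_mono_leD[OF mono, of 0 k] t(1) by simp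
  have inter: "f k ` (X interior_of ?\<Sigma>) = e ` {t k<..<t (Suc k)}" for k
    using interior_of_Q_image[OF f(1)[of k], of ?\<Sigma>] f(2)[of k] interior_of_arc[OF t(3,4)[of k]]
    by auto
  \<comment> \<open>A tile passing \<open>a + 1\<close> would overlap the first tile in interior
    points and hence be the first tile; but then its end point \<open>e a\<close> would be interior
    to it.\<close>
  have step: "t (Suc k) \<le> a + 1" if "t k < a + 1" for k
  proof (rule ccontr)
    assume "\<not> t (Suc k) \<le> a + 1"
    then have gt: "a + 1 < t (Suc k)" by simp
    then obtain \<delta> where \<delta>: "0 < \<delta>" "\<delta> < min (b - a) (t (Suc k) - (a + 1))"
      using ab dense[of 0 "min (b - a) (t (Suc k) - (a + 1))"] by auto
    have "e (a + \<delta>) \<in> id ` (X interior_of ?\<Sigma>)" using \<delta> by (simp add: interior_of_arc[OF ab])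
    moreover have "e (a + \<delta> + 1) \<in> f k ` (X interior_of ?\<Sigma>)"
      unfolding inter using \<delta> that by auto
    moreover have "e (a + \<delta> + 1) = e (a + \<delta>)" using e_plus_int[of "a + \<delta>" 1] by simp
    ultimately have "id = f k" using translates_disjoint[OF fr Q_id f(1)[of k]] by auto
    then have "f k = id" by simp
    then have "X interior_of ?\<Sigma> = e ` {t k<..<t (Suc k)}" using inter[of k] by simp
    moreover have "e (a + 1) \<in> e ` {t k<..<t (Suc k)}" using that gt by auto
    moreover have "e (a + 1) = e a" using e_plus_int[of a 1] by simp
    ultimately show False using end_notin_interior(1)[OF ab] by simp
  qed
  have "\<exists>m. a + 1 \<le> t m"
  proof (rule ccontr)
    assume "\<not> (\<exists>m. a + 1 \<le> t m)"
    then have lt: "t m < a + 1" for m by (simp add: not_le)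
    have inj: "inj_on e {a..<a + 1}" by (rule e_inj_on) auto
    \<comment> \<open>Below \<open>a + 1\<close> all tiles lie in a single turn and have disjoint
      interiors, so they belong to infinitely many different elements of \<open>Q\<close>.\<close>
    have "inj f"
    proof (rule linorder_injI)
      fix i j :: nat assume "i < j"
      then have "t (Suc i) \<le> t j" using strict_mono_leD[OF mono] by simp
      then have "{t i<..<t (Suc i)} \<inter> {t j<..<t (Suc j)} = {}" by auto
      moreover have "e ` {t i<..<t (Suc i)} \<inter> e ` {t j<..<t (Suc j)} = e ` ({t i<..<t (Suc i)} \<inter> {t j<..<t (Suc j)})"
        by (rule inj_on_image_Int[OF inj, symmetric])
          (use t_ge[of i] t_ge[of j] lt[of "Suc i"] lt[of "Suc j"] in auto)
      ultimately have "e ` {t i<..<t (Suc i)} \<inter> e ` {t j<..<t (Suc j)} = {}" by simp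
      moreover have "e ` {t i<..<t (Suc i)} \<noteq> {}" using t(3)[of i] by simp
      ultimately show "f i \<noteq> f j" using inter[of i] inter[of j] by auto
    qed
    moreover have "range f \<subseteq> Q" using f(1) by blast
    ultimately show False using finite_Q finite_subset range_inj_infinite by blast
  qed
  define m where "m = (LEAST m. a + 1 \<le> t m)"
  have m: "a + 1 \<le> t m" "\<And>k. k < m \<Longrightarrow> t k < a + 1"
    using LeastI_ex[OF \<open>\<exists>m. a + 1 \<le> t m\<close>] not_less_Least[of _ "\<lambda>m. a + 1 \<le> t m"]
    unfolding m_def by (simp_all only: not_le)
  \<comment> \<open>One tile is shorter than a full turn, so at least two are needed. With
    \<open>m = Suc n\<close> the tiles are numbered from 0 to \<open>n\<close>, where
    \<open>1 \<le> n\<close>.\<close>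
  have "m \<noteq> 0" by (rule notI) (use m(1) t(1) in simp)
  moreover have "m \<noteq> Suc 0" by (rule notI) (use m(1) t(2) ab in simp)
  ultimately obtain n where n: "m = Suc n" "1 \<le> n" by (cases m) auto
  have "t (Suc n) = a + 1" using step[OF m(2), of n] m(1) n by simp
  then show ?thesis using that[of n t f] n(2) t f mono by blast
qed

end

section \<open>Counting and uniqueness of tilings\<close>

context circle_action
begin

text \<open>The part of a decomposition that is visible on the circle. The cosets are left out
  because the tiles determine them, see \<open>coset_of_translate_unique\<close>.\<close>

definition tiling :: "nat \<Rightarrow> (nat \<Rightarrow> 's set) \<Rightarrow> bool" where
  "tiling n \<sigma> \<longleftrightarrow> 1 \<le> n \<and> (\<forall>k\<le>n. max_free (\<sigma> k) \<and> (\<exists>f\<in>Q. f ` \<sigma> 0 = \<sigma> k)) \<and>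
     topspace X = (\<Union>k\<le>n. \<sigma> k) \<and>
     (n = 1 \<longrightarrow> \<sigma> 0 \<inter> \<sigma> 1 = boundary (\<sigma> 0) \<and> \<sigma> 0 \<inter> \<sigma> 1 = boundary (\<sigma> 1) \<and> card (\<sigma> 0 \<inter> \<sigma> 1) = 2) \<and>
     (2 \<le> n \<longrightarrow> (\<forall>p\<le>n. \<forall>q\<le>n.
        (\<bar>int p - int q\<bar> \<in> {1, int n} \<longrightarrow>
           \<sigma> p \<inter> \<sigma> q = boundary (\<sigma> p) \<inter> boundary (\<sigma> q) \<and> is_singleton (\<sigma> p \<inter> \<sigma> q)) \<and>
        (2 \<le> \<bar>int p - int q\<bar> \<and> \<bar>int p - int q\<bar> \<le> int n - 1 \<longrightarrow> \<sigma> p \<inter> \<sigma> q = {})))"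

lemma tiling_cong:
  assumes "\<And>k. k \<le> n \<Longrightarrow> \<sigma> k = \<sigma>' k" "tiling n \<sigma>"
  shows "tiling n \<sigma>'"
proof -
  have n: "1 \<le> n" using assms(2) by (simp add: tiling_def)
  have eq: "\<sigma> 0 = \<sigma>' 0" "\<sigma> 1 = \<sigma>' 1" using assms(1) n by auto
  have U: "(\<Union>k\<le>n. \<sigma> k) = (\<Union>k\<le>n. \<sigma>' k)" using assms(1) by auto
  show ?thesis
    using assms(2) unfolding tiling_def U eq by (simp add: assms(1) cong: conj_cong)
qed

text \<open>Brings the separate clauses for \<open>n = 1\<close> and \<open>2 \<le> n\<close> into
  one form; each pair of distinct indices falls under one of them.\<close>

lemma tiling_Int_subset_boundary:
  assumes "tiling n \<sigma>" "p \<le> n" "q \<le> n" "p \<noteq> q"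
  shows "\<sigma> p \<inter> \<sigma> q \<subseteq> boundary (\<sigma> p)"
proof (cases "n = 1")
  case True
  then have "(p = 0 \<and> q = 1) \<or> (p = 1 \<and> q = 0)" using assms(2-4) by auto
  then show ?thesis using assms(1) True unfolding tiling_def by auto
next
  case False
  then have n: "2 \<le> n" using assms(1) by (auto simp: tiling_def)
  show ?thesis
  proof (cases "\<bar>int p - int q\<bar> \<in> {1, int n}")
    case True
    then have "\<sigma> p \<inter> \<sigma> q = boundary (\<sigma> p) \<inter> boundary (\<sigma> q)"
      using assms(1-3) n unfolding tiling_def by blast
    then show ?thesis by blast
  next
    case False
    then have "2 \<le> \<bar>int p - int q\<bar> \<and> \<bar>int p - int q\<bar> \<le> int n - 1" using assms(2-4) by auto
    then have "\<sigma> p \<inter> \<sigma> q = {}" using assms(1-3) n unfolding tiling_def by blast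
    then show ?thesis by blast
  qed
qed

text \<open>A tile occurring twice would be contained in its own boundary and have no interior
  points.\<close>

lemma tiling_inj_on:
  assumes "tiling n \<sigma>"
  shows "inj_on \<sigma> {..n}"
proof (rule inj_onI, rule ccontr)
  fix p q assume pq: "p \<in> {..n}" "q \<in> {..n}" "\<sigma> p = \<sigma> q" "p \<noteq> q"
  then have "\<sigma> p \<subseteq> boundary (\<sigma> p)" using tiling_Int_subset_boundary[OF assms, of p q] by auto
  then have "X interior_of (\<sigma> p) = {}" using interior_of_subset[of X "\<sigma> p"] unfolding boundary_def by blast
  moreover have "segment (\<sigma> p)" using assms pq(1) free_segment max_free_free by (auto simp: tiling_def)
  ultimately show False using segment_interior_nonempty by blast
qed

text \<open>A translate of \<open>\<sigma> 0\<close> has interior points, hence meets the interior of one of the tiles, which is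
  then the same translate.\<close>

lemma translate_in_tiling:
  assumes t: "tiling n \<sigma>" and f: "f \<in> Q"
  shows "\<exists>k\<le>n. \<forall>g\<in>Q. g ` \<sigma> 0 = \<sigma> k \<longrightarrow> f = g"
proof -
  let ?I = "X interior_of (\<sigma> 0)"
  have mf: "max_free (\<sigma> k)" if "k \<le> n" for k using t that by (simp add: tiling_def)
  have fr: "free (\<sigma> 0)" using mf max_free_free by blast
  have sub: "\<sigma> 0 \<subseteq> topspace X" using fr free_segment segment_subset_topspace by blast
  obtain x where x: "x \<in> ?I" using segment_interior_nonempty[OF free_segment[OF fr]] by blast
  have "f x \<in> topspace X" using x sub interior_of_subset[of X "\<sigma> 0"] Q_in[OF f] by blast
  then obtain k where k: "k \<le> n" "f x \<in> \<sigma> k" using t by (auto simp: tiling_def)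
  have "f x \<in> X closure_of (X interior_of (\<sigma> k))"
    using segment_subset_closure_interior[OF free_segment[OF max_free_free[OF mf[OF k(1)]]]] k(2) by blast
  moreover have "openin X (f ` ?I)"
    using homeomorphic_imp_open_map[OF Q_homeomorphic[OF f]] by (simp add: open_map_def)
  moreover have "f x \<in> f ` ?I" using x by blast
  ultimately have "\<exists>y. y \<in> X interior_of (\<sigma> k) \<and> y \<in> f ` ?I" by (simp only: in_closure_of)
  then have meet: "f ` ?I \<inter> X interior_of (\<sigma> k) \<noteq> {}" by blast
  have "f = g" if g: "g \<in> Q" "g ` \<sigma> 0 = \<sigma> k" for g
  proof (rule translates_disjoint[OF fr f g(1)])
    show "f ` ?I \<inter> g ` ?I \<noteq> {}" using meet interior_of_Q_image[OF g(1) sub] g(2) by simp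
  qed
  then show ?thesis using k(1) by blast
qed

text \<open>Choosing for each index an element that carries the first tile to the tile in question
  gives a bijection from \<open>{..n}\<close> to \<open>Q\<close>. As \<open>Q\<close> does not
  depend on the first tile, neither does \<open>n\<close>.\<close>

lemma tiling_card:
  assumes t: "tiling n \<sigma>"
  shows "card Q = Suc n"
proof -
  have "\<exists>f. k \<le> n \<longrightarrow> f \<in> Q \<and> f ` \<sigma> 0 = \<sigma> k" for k using t by (auto simp: tiling_def)
  then obtain F where F: "\<And>k. k \<le> n \<Longrightarrow> F k \<in> Q" "\<And>k. k \<le> n \<Longrightarrow> F k ` \<sigma> 0 = \<sigma> k" by metis
  have "inj_on F {..n}"
  proof (rule inj_onI)
    fix p q assume pq: "p \<in> {..n}" "q \<in> {..n}" "F p = F q"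
    then have "\<sigma> p = \<sigma> q" using F(2)[of p] F(2)[of q] by simp
    then show "p = q" using inj_onD[OF tiling_inj_on[OF t]] pq by blast
  qed
  moreover have "F ` {..n} = Q"
  proof
    show "F ` {..n} \<subseteq> Q" using F(1) by auto
    show "Q \<subseteq> F ` {..n}"
    proof
      fix f assume "f \<in> Q"
      then obtain k where "k \<le> n" "\<forall>g\<in>Q. g ` \<sigma> 0 = \<sigma> k \<longrightarrow> f = g" using translate_in_tiling[OF t] by blast
      then have "f = F k" using F by blast
      then show "f \<in> F ` {..n}" using \<open>k \<le> n\<close> by blast
    qed
  qed
  ultimately show ?thesis using card_image by fastforce
qed

text \<open>Each tile of the second tiling is a translate of the common first tile and so occurs in
  the first tiling; this defines an index map \<open>\<pi>\<close>. Consecutive tiles meet and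
  non-adjacent ones do not, so \<open>\<pi>\<close> preserves cyclic adjacency.\<close>

lemma tiling_unique:
  assumes t: "tiling n \<sigma>" "tiling n' \<sigma>'" and 0: "\<sigma>' 0 = \<sigma> 0"
  shows "n' = n"
    "(\<forall>k\<le>n. \<sigma>' k = \<sigma> k) \<or> (2 \<le> n \<and> (\<forall>k\<le>n. \<sigma>' k = \<sigma> (reversal_index n k)))"
proof -
  show n': "n' = n" using tiling_card[OF t(1)] tiling_card[OF t(2)] by simp
  have n: "1 \<le> n" using t(1) by (simp add: tiling_def)
  have "\<exists>j. k \<le> n \<longrightarrow> j \<le> n \<and> \<sigma>' k = \<sigma> j" for k
  proof (cases "k \<le> n")
    case True
    then obtain f where f: "f \<in> Q" "f ` \<sigma> 0 = \<sigma>' k" using t(2) 0 n' by (auto simp: tiling_def)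
    obtain j where j: "j \<le> n" "\<forall>g\<in>Q. g ` \<sigma> 0 = \<sigma> j \<longrightarrow> f = g" using translate_in_tiling[OF t(1) f(1)] by blast
    obtain g where "g \<in> Q" "g ` \<sigma> 0 = \<sigma> j" using t(1) j(1) by (auto simp: tiling_def)
    then have "\<sigma>' k = \<sigma> j" using j(2) f(2) by blast
    then show ?thesis using j(1) by blast
  qed auto
  then obtain \<pi> where \<pi>: "\<And>k. k \<le> n \<Longrightarrow> \<pi> k \<le> n" "\<And>k. k \<le> n \<Longrightarrow> \<sigma>' k = \<sigma> (\<pi> k)" by metis
  have inj: "inj_on \<pi> {..n}"
  proof (rule inj_onI)
    fix p q assume pq: "p \<in> {..n}" "q \<in> {..n}" "\<pi> p = \<pi> q"
    then have "\<sigma>' p = \<sigma>' q" using \<pi>(2)[of p] \<pi>(2)[of q] by simp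
    then show "p = q" using inj_onD[OF tiling_inj_on[OF t(2)]] pq n' by blast
  qed
  have \<pi>0: "\<pi> 0 = 0" using inj_onD[OF tiling_inj_on[OF t(1)], of "\<pi> 0" 0] \<pi>[of 0] 0 by simp
  show "(\<forall>k\<le>n. \<sigma>' k = \<sigma> k) \<or> (2 \<le> n \<and> (\<forall>k\<le>n. \<sigma>' k = \<sigma> (reversal_index n k)))"
  proof (cases "n = 1")
    case True
    have "\<pi> 1 \<noteq> \<pi> 0" using inj True by (auto simp: inj_on_def)
    then have "\<pi> 1 = 1" using \<pi>(1)[of 1] \<pi>0 True by auto
    have "\<sigma>' k = \<sigma> k" if "k \<le> n" for k
    proof -
      have "k = 0 \<or> k = 1" using that True by auto
      then have "\<pi> k = k" using \<pi>0 \<open>\<pi> 1 = 1\<close> by auto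
      then show ?thesis using \<pi>(2)[OF that] by simp
    qed
    then show ?thesis by blast
  next
    case False
    then have n: "2 \<le> n" using n by simp
    have "\<bar>int (\<pi> k) - int (\<pi> (Suc k))\<bar> \<in> {1, int n}" if k: "k < n" for k
    proof (rule ccontr)
      assume no: "\<bar>int (\<pi> k) - int (\<pi> (Suc k))\<bar> \<notin> {1, int n}"
      have "\<pi> k \<noteq> \<pi> (Suc k)" using inj_onD[OF inj, of k "Suc k"] k by auto
      moreover have le: "\<pi> k \<le> n" "\<pi> (Suc k) \<le> n" using \<pi>(1) k by auto
      ultimately have "2 \<le> \<bar>int (\<pi> k) - int (\<pi> (Suc k))\<bar> \<and> \<bar>int (\<pi> k) - int (\<pi> (Suc k))\<bar> \<le> int n - 1"
        using no by auto
      then have "\<sigma> (\<pi> k) \<inter> \<sigma> (\<pi> (Suc k)) = {}" using t(1) n le unfolding tiling_def by blast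
      then have "\<sigma>' k \<inter> \<sigma>' (Suc k) = {}" using \<pi>(2)[of k] \<pi>(2)[of "Suc k"] k by simp
      moreover have "\<bar>int k - int (Suc k)\<bar> \<in> {1, int n}" "k \<le> n'" "Suc k \<le> n'" "2 \<le> n'" using k n n' by auto
      then have "is_singleton (\<sigma>' k \<inter> \<sigma>' (Suc k))" using t(2) n' unfolding tiling_def by blast
      ultimately show False by (simp add: is_singleton_def)
    qed
    then have "(\<forall>k\<le>n. \<pi> k = k) \<or> (\<forall>k\<le>n. \<pi> k = reversal_index n k)"
      using cyclic_adjacency_rigid[OF n inj \<pi>(1) \<pi>0] by blast
    then show ?thesis using \<pi>(2) n by auto
  qed
qed

lemma tiling_reversal:
  assumes t: "tiling n \<sigma>" and n: "2 \<le> n"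
  shows "tiling n (\<lambda>k. \<sigma> (reversal_index n k))"
  unfolding tiling_def
proof (intro conjI impI allI)
  let ?r = "reversal_index n"
  have r0: "?r 0 = 0" by (simp add: reversal_index_def)
  show "1 \<le> n" using n by simp
  show "max_free (\<sigma> (?r k))" "\<exists>f\<in>Q. f ` \<sigma> (?r 0) = \<sigma> (?r k)" if "k \<le> n" for k
    using t reversal_index_le[OF that] unfolding tiling_def r0 by auto
  have "?r ` {..n} = {..n}"
  proof
    show "?r ` {..n} \<subseteq> {..n}" using reversal_index_le by auto
    show "{..n} \<subseteq> ?r ` {..n}"
    proof
      fix k assume "k \<in> {..n}"
      then have "k = ?r (?r k)" "?r k \<in> {..n}" using reversal_index_involutive reversal_index_le by auto
      then show "k \<in> ?r ` {..n}" by blast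
    qed
  qed
  then have "(\<Union>k\<le>n. \<sigma> (?r k)) = (\<Union>k\<le>n. \<sigma> k)" by (metis image_image)
  then show "topspace X = (\<Union>k\<le>n. \<sigma> (?r k))" using t by (simp add: tiling_def)
  fix p q assume pq: "p \<le> n" "q \<le> n"
  have le: "?r p \<le> n" "?r q \<le> n" using reversal_index_le pq by auto
  have T: "(\<bar>int p - int q\<bar> \<in> {1, int n} \<longrightarrow>
           \<sigma> p \<inter> \<sigma> q = boundary (\<sigma> p) \<inter> boundary (\<sigma> q) \<and> is_singleton (\<sigma> p \<inter> \<sigma> q)) \<and>
        (2 \<le> \<bar>int p - int q\<bar> \<and> \<bar>int p - int q\<bar> \<le> int n - 1 \<longrightarrow> \<sigma> p \<inter> \<sigma> q = {})"
    if "p \<le> n" "q \<le> n" for p q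
    using t n that unfolding tiling_def by blast
  {
    assume "\<bar>int p - int q\<bar> \<in> {1, int n}"
    moreover from this n have "p \<noteq> q" by auto
    ultimately have "\<bar>int (?r p) - int (?r q)\<bar> \<in> {1, int n}" using reversal_index_diff[OF pq] by auto
    then show "\<sigma> (?r p) \<inter> \<sigma> (?r q) = boundary (\<sigma> (?r p)) \<inter> boundary (\<sigma> (?r q))"
      "is_singleton (\<sigma> (?r p) \<inter> \<sigma> (?r q))"
      using T[OF le] by blast+
  }
  assume "2 \<le> \<bar>int p - int q\<bar> \<and> \<bar>int p - int q\<bar> \<le> int n - 1"
  moreover from this have "p \<noteq> q" by auto
  ultimately have "2 \<le> \<bar>int (?r p) - int (?r q)\<bar> \<and> \<bar>int (?r p) - int (?r q)\<bar> \<le> int n - 1"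
    using reversal_index_diff[OF pq] by auto
  then show "\<sigma> (?r p) \<inter> \<sigma> (?r q) = {}" using T[OF le] by blast
qed (use n in auto)

end

section \<open>Existence of tilings\<close>

context free_circle_action
begin

text \<open>The tiles are the arcs between consecutive stops of \<open>closed_walk\<close>. By
  \<open>arc_Int_arc\<close> neighbours share a stop, and the first and last tile share
  \<open>e a\<close>, which is also \<open>e (a + 1)\<close>.\<close>

lemma ex_tiling:
  assumes max: "max_free \<Sigma>"
  shows "\<exists>n \<sigma>. tiling n \<sigma> \<and> \<sigma> 0 = \<Sigma>"
proof -
  obtain a b where \<Sigma>: "\<Sigma> = e ` {a..b}" and ab: "a < b" "b < a + 1" using max_free_arc[OF max] by blast
  note max' = max[unfolded \<Sigma>]
  obtain n and t :: "nat \<Rightarrow> real" and f where n: "1 \<le> n"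
    and t: "t 0 = a" "t (Suc 0) = b" "t (Suc n) = a + 1" "strict_mono t" "\<And>k. t (Suc k) < t k + 1"
    and f: "\<And>k. f k \<in> Q" "\<And>k. f k ` e ` {a..b} = e ` {t k..t (Suc k)}"
    using closed_walk[OF max' ab] by metis
  have lt: "t i < t j \<longleftrightarrow> i < j" and eq: "t i = t j \<longleftrightarrow> i = j" and le: "t i \<le> t j \<longleftrightarrow> i \<le> j" for i j
    using t(4) by (auto simp: strict_mono_less strict_mono_eq strict_mono_less_eq)
  define \<sigma> where "\<sigma> = (\<lambda>k. e ` {t k..t (Suc k)})"
  have \<sigma>0: "\<sigma> 0 = \<Sigma>" by (simp add: \<sigma>_def t \<Sigma>)
  have bd: "boundary (\<sigma> k) = {e (t k), e (t (Suc k))}" for k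
    unfolding \<sigma>_def by (rule boundary_arc) (use t(5) lt in auto)
  have e1: "e (t (Suc n)) = e (t 0)" unfolding t using e_plus_int[of a 1] by simp
  have inter: "\<sigma> p \<inter> \<sigma> q =
      (if q = Suc p then {e (t q)} else {}) \<union> (if p = 0 \<and> q = n then {e (t 0)} else {})"
    if "p < q" "q \<le> n" for p q
  proof -
    have "e ` {t p..t (Suc p)} \<inter> e ` {t q..t (Suc q)} =
      (if t (Suc p) = t q then {e (t (Suc p))} else {}) \<union> (if t p = a \<and> t (Suc q) = a + 1 then {e a} else {})"
    proof (rule arc_Int_arc)
      show "a \<le> t p" using le[of 0 p] t(1) by simp
      show "t (Suc q) \<le> a + 1" using le[of "Suc q" "Suc n"] t(3) that by simp
    qed (use that lt le in auto)
    moreover have "t p = a \<longleftrightarrow> p = 0" "t (Suc q) = a + 1 \<longleftrightarrow> q = n" "t (Suc p) = t q \<longleftrightarrow> q = Suc p"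
      using eq[of p 0] eq[of "Suc q" "Suc n"] eq[of "Suc p" q] t(1,3) by auto
    ultimately show ?thesis unfolding \<sigma>_def using t(1) by (auto split: if_splits)
  qed
  \<comment> \<open>For \<open>2 \<le> n\<close> the indices 0 and \<open>n\<close> are not
    consecutive, so exactly one of the two sets in \<open>inter\<close> is nonempty.\<close>
  have pair: "\<sigma> p \<inter> \<sigma> q = boundary (\<sigma> p) \<inter> boundary (\<sigma> q) \<and> is_singleton (\<sigma> p \<inter> \<sigma> q)"
    if "p < q" "q \<le> n" "q = Suc p \<or> p = 0 \<and> q = n" "2 \<le> n" for p q
  proof -
    have sub: "boundary (\<sigma> p) \<inter> boundary (\<sigma> q) \<subseteq> \<sigma> p \<inter> \<sigma> q" by (auto simp: boundary_def)
    show ?thesis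
    proof (cases "q = Suc p")
      case True
      then have "\<sigma> p \<inter> \<sigma> q = {e (t q)}" using inter[OF that(1,2)] that(4) by auto
      moreover have "e (t q) \<in> boundary (\<sigma> p) \<inter> boundary (\<sigma> q)" unfolding bd True by simp
      ultimately show ?thesis using sub by auto
    next
      case False
      then have pq: "p = 0" "q = n" using that(3) by auto
      then have "\<sigma> p \<inter> \<sigma> q = {e (t 0)}" using inter[OF that(1,2)] False by auto
      moreover have "e (t 0) \<in> boundary (\<sigma> p) \<inter> boundary (\<sigma> q)" unfolding bd pq using e1 by simp
      ultimately show ?thesis using sub by auto
    qed
  qed
  have "tiling n \<sigma>"
    unfolding tiling_def
  proof (intro conjI impI allI)
    show "1 \<le> n" by (rule n)
    show "max_free (\<sigma> k)" for k
      using max_free_Q_image[OF max' f(1)[of k]] unfolding f(2) \<sigma>_def .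
    show "\<exists>f\<in>Q. f ` \<sigma> 0 = \<sigma> k" for k
      using f(1)[of k] f(2)[of k] unfolding \<sigma>_def t by blast
    show "topspace X = (\<Union>k\<le>n. \<sigma> k)"
    proof
      show "(\<Union>k\<le>n. \<sigma> k) \<subseteq> topspace X" by (auto simp: \<sigma>_def)
      show "topspace X \<subseteq> (\<Union>k\<le>n. \<sigma> k)"
      proof
        fix x assume "x \<in> topspace X"
        then obtain s where s: "a \<le> s" "s < a + 1" "e s = x" by (rule e_lift)
        \<comment> \<open>The first tile whose right end lies beyond \<open>s\<close>; by minimality
          its left end does not.\<close>
        define k where "k = (LEAST k. s < t (Suc k))"
        have ex: "s < t (Suc n)" using s(2) t(3) by simp
        then have k: "s < t (Suc k)" "k \<le> n" unfolding k_def by (auto intro: LeastI Least_le)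
        have "t k \<le> s"
        proof (cases k)
          case (Suc j)
          then have "\<not> s < t (Suc j)" unfolding k_def using not_less_Least[of j "\<lambda>k. s < t (Suc k)"] by simp
          then show ?thesis using Suc by simp
        qed (use s(1) t(1) in simp)
        then have "x \<in> \<sigma> k" using k(1) s(3) by (auto simp: \<sigma>_def)
        then show "x \<in> (\<Union>k\<le>n. \<sigma> k)" using k(2) by blast
      qed
    qed
    {
      assume n1: "n = 1"
      \<comment> \<open>For \<open>n = 1\<close> both sets in \<open>inter\<close> are present: the
        two tiles meet at both ends.\<close>
      have I: "\<sigma> 0 \<inter> \<sigma> 1 = {e (t 0), e (t 1)}" using inter[of 0 1] n1 by auto
      show "\<sigma> 0 \<inter> \<sigma> 1 = boundary (\<sigma> 0)" unfolding I bd by simp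
      show "\<sigma> 0 \<inter> \<sigma> 1 = boundary (\<sigma> 1)" unfolding I bd using e1 n1 by auto
      have "e (t 0) \<noteq> e (t 1)"
        using e_eq_iff[of "t 1" "t 0"] Ints_nonzero_abs_less1[of "t 1 - t 0"] t ab by auto
      then show "card (\<sigma> 0 \<inter> \<sigma> 1) = 2" unfolding I by simp
    }
    fix p q assume n2: "2 \<le> n" and pq: "p \<le> n" "q \<le> n"
    {
      assume A: "\<bar>int p - int q\<bar> \<in> {1, int n}"
      show "\<sigma> p \<inter> \<sigma> q = boundary (\<sigma> p) \<inter> boundary (\<sigma> q)" "is_singleton (\<sigma> p \<inter> \<sigma> q)"
      proof -
        have "\<sigma> p \<inter> \<sigma> q = boundary (\<sigma> p) \<inter> boundary (\<sigma> q) \<and> is_singleton (\<sigma> p \<inter> \<sigma> q)"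
        proof (cases p q rule: linorder_cases)
          case less
          then show ?thesis using pair[OF less pq(2) _ n2] A pq by auto
        next
          case greater
          then show ?thesis using pair[OF greater pq(1) _ n2] A pq by (auto simp: Int_commute)
        qed (use A n2 in auto)
        then show "\<sigma> p \<inter> \<sigma> q = boundary (\<sigma> p) \<inter> boundary (\<sigma> q)" "is_singleton (\<sigma> p \<inter> \<sigma> q)" by auto
      qed
    }
    assume A: "2 \<le> \<bar>int p - int q\<bar> \<and> \<bar>int p - int q\<bar> \<le> int n - 1"
    show "\<sigma> p \<inter> \<sigma> q = {}"
    proof (cases p q rule: linorder_cases)
      case less
      then show ?thesis using inter[OF less pq(2)] A by auto
    next
      case greater
      then show ?thesis using inter[OF greater pq(1)] A by (auto simp: Int_commute)
    qed (use A in auto)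
  qed
  then show ?thesis using \<sigma>0 by blast
qed

end

section \<open>Symmetries of an analytic circle\<close>

locale analytic_circle_action = circle_parametrization "mtop S" e
  for S :: "'s manifold" and e +
  fixes G :: "'g monoid" (structure) and M :: "'m manifold" and act :: "'g \<Rightarrow> 'm \<Rightarrow> 'm" and \<iota> :: "'s \<Rightarrow> 'm"
  assumes manifold: "analytic_manifold M"
    and action: "group_action G (topspace (mtop M)) act"
    and non_contractive: "non_contractive G act M"
    and submanifold: "analytic_1_submanifold S \<iota> M"
begin

abbreviation (input) "X \<equiv> mtop S"
abbreviation (input) "\<iota>S \<equiv> \<iota> ` topspace (mtop S)"
abbreviation (input) "G\<^sub>S \<equiv> curve_stabilizer G act S \<iota>"

lemma group: "group G"
  using action by (simp add: group_action_def group_hom_def)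

lemma act_analytic: "g \<in> carrier G \<Longrightarrow> analytic_map M M (act g)"
  using non_contractive by (simp add: non_contractive_def analytic_in_manifold_def)

lemma act_continuous: "g \<in> carrier G \<Longrightarrow> continuous_map (mtop M) (mtop M) (act g)"
  using act_analytic by (simp add: analytic_map_def)

lemma iota_continuous: "continuous_map X (mtop M) \<iota>"
  using submanifold by (simp add: analytic_1_submanifold_def analytic_map_def)

lemma iota_in: "z \<in> topspace X \<Longrightarrow> \<iota> z \<in> topspace (mtop M)"
  using iota_continuous continuous_map_image_subset_topspace by blast

lemma iota_inj: "inj_on \<iota> (topspace X)"
  using submanifold by (simp add: analytic_1_submanifold_def)

text \<open>The circle is compact and \<open>M\<close> is Hausdorff. This supplies the embedding
  clauses of the overlap relation and the control of branches in the extension argument.\<close>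

lemma iota_embedding: "embedding_map X (mtop M) \<iota>"
  using continuous_imp_embedding_map[OF iota_continuous compact_space] manifold iota_inj
  by (simp add: analytic_manifold_def)

lemma act_inv: "g \<in> carrier G \<Longrightarrow> x \<in> topspace (mtop M) \<Longrightarrow> act (inv g) (act g x) = x"
  using group_action.orbit_sym_aux[OF action] by blast

lemma act_mult: "g \<in> carrier G \<Longrightarrow> h \<in> carrier G \<Longrightarrow> x \<in> topspace (mtop M) \<Longrightarrow> act (g \<otimes> h) x = act g (act h x)"
  using group_action.composition_rule[OF action] by blast

lemma act_one: "x \<in> topspace (mtop M) \<Longrightarrow> act \<one> x = x"
  using group_action.id_eq_one[OF action] by (metis restrict_apply')

lemma curve_stabilizer_iff:
  "g \<in> G\<^sub>S \<longleftrightarrow> g \<in> carrier G \<and> (\<forall>z\<in>topspace X. act g (\<iota> z) = \<iota> z)"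
  by (auto simp: curve_stabilizer_def stabilizer_def)

definition curve_symmetries :: "'g set" where
  "curve_symmetries = {g \<in> carrier G. act g ` \<iota>S = \<iota>S}"

text \<open>The extension by the identity makes the induced homeomorphisms bijections of the whole type, so that
  inverses and the identity can be expressed by equations between functions.\<close>

definition induced :: "'g \<Rightarrow> 's \<Rightarrow> 's" where
  "induced g z = (if z \<in> topspace X then inv_into (topspace X) \<iota> (act g (\<iota> z)) else z)"

lemma curve_symmetriesD: "g \<in> curve_symmetries \<Longrightarrow> g \<in> carrier G" "g \<in> curve_symmetries \<Longrightarrow> act g ` \<iota>S = \<iota>S"
  by (auto simp: curve_symmetries_def)

lemma induced_in: "g \<in> curve_symmetries \<Longrightarrow> z \<in> topspace X \<Longrightarrow> induced g z \<in> topspace X"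
  using curve_symmetriesD(2)[of g] by (auto simp: induced_def intro!: inv_into_into)

lemma iota_induced: "g \<in> curve_symmetries \<Longrightarrow> z \<in> topspace X \<Longrightarrow> \<iota> (induced g z) = act g (\<iota> z)"
  using curve_symmetriesD(2)[of g] by (auto simp: induced_def intro!: f_inv_into_f)

lemma induced_eqI:
  assumes "g \<in> curve_symmetries" "z \<in> topspace X" "w \<in> topspace X" "act g (\<iota> z) = \<iota> w"
  shows "induced g z = w"
  using inj_onD[OF iota_inj] iota_induced[OF assms(1,2)] induced_in[OF assms(1,2)] assms(3,4) by simp

lemma symmetries_mult:
  assumes "g \<in> curve_symmetries" "h \<in> curve_symmetries"
  shows "g \<otimes> h \<in> curve_symmetries" "induced (g \<otimes> h) = induced g \<circ> induced h"
proof -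
  have gh: "g \<in> carrier G" "h \<in> carrier G" using assms curve_symmetriesD by auto
  have eq: "act (g \<otimes> h) (\<iota> z) = act g (act h (\<iota> z))" if "z \<in> topspace X" for z
    using act_mult[OF gh iota_in[OF that]] .
  have "act (g \<otimes> h) ` \<iota>S = act g ` act h ` \<iota>S" using eq by (force simp: image_iff)
  also have "\<dots> = \<iota>S" using assms curve_symmetriesD(2) by simp
  finally show gh': "g \<otimes> h \<in> curve_symmetries"
    using gh group by (simp add: curve_symmetries_def group.is_monoid monoid.m_closed)
  show "induced (g \<otimes> h) = induced g \<circ> induced h"
  proof
    fix z show "induced (g \<otimes> h) z = (induced g \<circ> induced h) z"
    proof (cases "z \<in> topspace X")
      case True
      have "act (g \<otimes> h) (\<iota> z) = \<iota> (induced g (induced h z))"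
        using True assms by (simp add: eq iota_induced induced_in)
      then show ?thesis using True assms induced_in induced_eqI[OF gh'] by simp
    qed (simp add: induced_def)
  qed
qed

lemma stabilizer_symmetries:
  assumes "g \<in> G\<^sub>S"
  shows "g \<in> curve_symmetries" "induced g = id"
proof -
  have g: "g \<in> carrier G" "\<And>z. z \<in> topspace X \<Longrightarrow> act g (\<iota> z) = \<iota> z"
    using assms curve_stabilizer_iff by auto
  then have "act g ` \<iota>S = \<iota>S" by force
  with g show sym: "g \<in> curve_symmetries" by (simp add: curve_symmetries_def)
  show "induced g = id"
  proof
    fix z show "induced g z = id z"
      using induced_eqI[OF sym _ _ g(2)] by (cases "z \<in> topspace X") (auto simp: induced_def)
  qed
qed

text \<open>The stabilizer is the kernel of \<open>induced\<close>; hence lying outside it turns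
  into \<open>f \<noteq> id\<close> in the definition of \<open>free\<close>.\<close>

lemma induced_eq_id_iff:
  assumes "g \<in> curve_symmetries"
  shows "induced g = id \<longleftrightarrow> g \<in> G\<^sub>S"
proof
  assume "induced g = id"
  then have "act g (\<iota> z) = \<iota> z" if "z \<in> topspace X" for z
    using iota_induced[OF assms that] by simp
  then show "g \<in> G\<^sub>S" using curve_symmetriesD(1)[OF assms] by (simp add: curve_stabilizer_iff)
qed (rule stabilizer_symmetries(2))

lemma one_symmetry: "\<one> \<in> G\<^sub>S"
  using group act_one iota_in by (auto simp: curve_stabilizer_iff group.is_monoid monoid.one_closed)

lemma symmetries_inv:
  assumes "g \<in> curve_symmetries"
  shows "inv g \<in> curve_symmetries" "induced (inv g) \<circ> induced g = id" "induced g \<circ> induced (inv g) = id"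
proof -
  interpret G: group G by (rule group)
  have g: "g \<in> carrier G" "inv g \<in> carrier G" using assms curve_symmetriesD by auto
  have "act (inv g) ` \<iota>S = act (inv g) ` act g ` \<iota>S" using assms curve_symmetriesD(2) by simp
  also have "\<dots> = \<iota>S" using act_inv[OF g(1)] iota_in by (force simp: image_iff)
  finally show inv: "inv g \<in> curve_symmetries" using g(2) by (simp add: curve_symmetries_def)
  have "induced \<one> = id" using stabilizer_symmetries(2) one_symmetry by blast
  then show "induced (inv g) \<circ> induced g = id" "induced g \<circ> induced (inv g) = id"
    using symmetries_mult(2)[OF inv assms] symmetries_mult(2)[OF assms inv] g by simp_all
qed

lemma induced_continuous:
  assumes "g \<in> curve_symmetries"
  shows "continuous_map X X (induced g)"
proof -
  have g: "g \<in> carrier G" using assms curve_symmetriesD by blast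
  obtain k where k: "homeomorphic_maps X (subtopology (mtop M) \<iota>S) \<iota> k"
    using iota_embedding unfolding embedding_map_def homeomorphic_map_maps by blast
  have "continuous_map X (mtop M) (act g \<circ> \<iota>)"
    by (rule continuous_map_compose[OF iota_continuous act_continuous[OF g]])
  moreover have "act g \<circ> \<iota> \<in> topspace X \<rightarrow> \<iota>S"
    using curve_symmetriesD(2)[OF assms] by (intro Pi_I) auto
  ultimately have "continuous_map X (subtopology (mtop M) \<iota>S) (act g \<circ> \<iota>)"
    unfolding continuous_map_in_subtopology by (rule conjI)
  moreover have "continuous_map (subtopology (mtop M) \<iota>S) X k" using k by (simp add: homeomorphic_maps_def)
  ultimately have "continuous_map X X (k \<circ> (act g \<circ> \<iota>))" by (rule continuous_map_compose)
  then show ?thesis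
  proof (rule continuous_map_eq)
    fix z assume z: "z \<in> topspace X"
    have "k (\<iota> (induced g z)) = induced g z"
      using k induced_in[OF assms z] by (simp add: homeomorphic_maps_def)
    then show "(k \<circ> (act g \<circ> \<iota>)) z = induced g z" using iota_induced[OF assms z] by simp
  qed
qed

lemma induced_homeomorphic:
  assumes "g \<in> curve_symmetries"
  shows "homeomorphic_map X X (induced g)"
proof -
  have "homeomorphic_maps X X (induced g) (induced (inv g))"
    unfolding homeomorphic_maps_def
    using induced_continuous[OF assms] induced_continuous[OF symmetries_inv(1)[OF assms]]
      fun_cong[OF symmetries_inv(2)[OF assms]] fun_cong[OF symmetries_inv(3)[OF assms]] by simp
  then show ?thesis using homeomorphic_map_maps by blast
qed

sublocale circle_action "mtop S" e "induced ` curve_symmetries"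
proof
  fix f assume "f \<in> induced ` curve_symmetries"
  then show "homeomorphic_map X X f" using induced_homeomorphic by blast
next
  show "id \<in> induced ` curve_symmetries"
    using stabilizer_symmetries[OF one_symmetry] by force
next
  fix f g assume "f \<in> induced ` curve_symmetries" "g \<in> induced ` curve_symmetries"
  then obtain f' g' where fg: "f' \<in> curve_symmetries" "g' \<in> curve_symmetries" "f = induced f'" "g = induced g'"
    by (elim imageE)
  have "induced (f' \<otimes> g') \<in> induced ` curve_symmetries" using symmetries_mult(1)[OF fg(1,2)] by (rule imageI)
  then show "f \<circ> g \<in> induced ` curve_symmetries" using symmetries_mult(2)[OF fg(1,2)] fg(3,4) by simp
next
  fix f assume "f \<in> induced ` curve_symmetries"
  then obtain g where "g \<in> curve_symmetries" "f = induced g" by blast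
  then show "\<exists>g\<in>induced ` curve_symmetries. g \<circ> f = id \<and> f \<circ> g = id"
    using symmetries_inv[of g] by blast
qed

lemma image_act_iota:
  assumes "g \<in> curve_symmetries" "A \<subseteq> topspace X"
  shows "act g ` \<iota> ` A = \<iota> ` induced g ` A"
  unfolding image_image using assms iota_induced by (intro image_cong) auto

text \<open>\<open>analytic_overlap_extends\<close> gives one inclusion for \<open>g\<close> and,
  applied to the inverse element on \<open>B\<close>, the other. Sets with nonempty interior are
  allowed so that the lemma serves compact tiles as well as open overlaps.\<close>

lemma overlap_imp_symmetry:
  assumes g: "g \<in> carrier G" and AB: "A \<subseteq> topspace X" "B \<subseteq> topspace X"
    "X interior_of A \<noteq> {}" "X interior_of B \<noteq> {}" "act g ` \<iota> ` A = \<iota> ` B"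
  shows "g \<in> curve_symmetries" "induced g ` A = B"
proof -
  interpret G: group G by (rule group)
  have ext: "act h ` \<iota>S \<subseteq> \<iota>S"
    if h: "h \<in> carrier G" and C: "X interior_of C \<noteq> {}" "act h ` \<iota> ` C \<subseteq> \<iota>S" for h C
  proof (rule analytic_overlap_extends[OF _ submanifold manifold act_analytic[OF h] iota_embedding _ C(1)])
    show "circle_parametrization X e" ..
    show "openin X (X interior_of C)" by simp
    show "act h ` \<iota> ` (X interior_of C) \<subseteq> \<iota>S" using C(2) interior_of_subset[of X C] by blast
  qed
  have 1: "act g ` \<iota>S \<subseteq> \<iota>S" using AB by (intro ext[OF g AB(3)]) auto
  have "act (inv g) ` \<iota> ` B = act (inv g) ` act g ` \<iota> ` A" using AB(5) by simp
  also have "\<dots> = \<iota> ` A" using act_inv[OF g] iota_in AB(1) by (force simp: image_iff)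
  finally have 2: "act (inv g) ` \<iota>S \<subseteq> \<iota>S" using AB g by (intro ext[OF _ AB(4)]) auto
  have "\<iota>S \<subseteq> act g ` \<iota>S"
  proof
    fix y assume y: "y \<in> \<iota>S"
    then have "act (inv g) y \<in> \<iota>S" using 2 by blast
    moreover have "y \<in> topspace (mtop M)" using y iota_in by auto
    then have "act g (act (inv g) y) = y" using act_inv[of "inv g" y] g by simp
    ultimately show "y \<in> act g ` \<iota>S" by (metis imageI)
  qed
  with 1 g show sym: "g \<in> curve_symmetries" by (auto simp: curve_symmetries_def)
  have "\<iota> ` induced g ` A = \<iota> ` B" using image_act_iota[OF sym AB(1)] AB(5) by simp
  moreover have "induced g ` A \<subseteq> topspace X" using AB(1) induced_in[OF sym] by auto
  ultimately show "induced g ` A = B" using inj_on_image_eq_iff[OF iota_inj _ AB(2)] by simp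
qed

section \<open>Free segments in terms of the induced symmetries\<close>

lemma segments_eq: "segments S = {\<Sigma>. segment \<Sigma>}"
  by (simp add: segments_def segment_def)

lemma iota_embedding_subset:
  assumes "P \<subseteq> topspace X"
  shows "embedding_map (subtopology X P) (mtop M) \<iota>"
proof -
  have sub: "\<iota> ` P \<subseteq> \<iota>S" "\<iota> ` P \<subseteq> topspace (mtop M)" using assms iota_in by auto
  have "homeomorphic_map X (subtopology (mtop M) \<iota>S) \<iota>"
    using iota_embedding by (simp add: embedding_map_def)
  then have "homeomorphic_map (subtopology X P) (subtopology (subtopology (mtop M) \<iota>S) (\<iota> ` P)) \<iota>"
    by (rule homeomorphic_map_subtopologies) (use assms sub in auto)
  moreover have "\<iota>S \<inter> \<iota> ` P = \<iota> ` P" "topspace (subtopology X P) = P" using sub(1) assms by auto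
  ultimately show ?thesis by (simp add: embedding_map_def subtopology_subtopology)
qed

text \<open>An overlap makes \<open>g\<close> a symmetry by \<open>overlap_imp_symmetry\<close>.
  Conversely, if an interior point is moved to an interior point, continuity gives a small open
  segment around it whose image is an open segment in the interior of \<Sigma>'.\<close>

lemma locally_overlap_iff:
  assumes g: "g \<in> carrier G"
  shows "locally_overlap M S \<iota> act g \<Sigma> \<Sigma>' \<longleftrightarrow>
    g \<in> curve_symmetries \<and> induced g ` (X interior_of \<Sigma>) \<inter> X interior_of \<Sigma>' \<noteq> {}"
proof
  assume "locally_overlap M S \<iota> act g \<Sigma> \<Sigma>'"
  then obtain P P' where P: "segment P" "segment P'" "openin X P" "openin X P'" "P \<subseteq> \<Sigma>" "P' \<subseteq> \<Sigma>'"
    "act g ` \<iota> ` P = \<iota> ` P'"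
    unfolding locally_overlap_def segments_eq by blast
  have sym: "g \<in> curve_symmetries" "induced g ` P = P'"
    using overlap_imp_symmetry[OF g _ _ _ _ P(7)] P(1,2) segment_subset_topspace segment_interior_nonempty
    by blast+
  moreover have "P \<subseteq> X interior_of \<Sigma>" "P' \<subseteq> X interior_of \<Sigma>'"
    by (rule interior_of_maximal[OF P(5,3)], rule interior_of_maximal[OF P(6,4)])
  moreover have "P \<noteq> {}" using P(1) by (auto simp: segment_def)
  ultimately show "g \<in> curve_symmetries \<and> induced g ` (X interior_of \<Sigma>) \<inter> X interior_of \<Sigma>' \<noteq> {}" by blast
next
  assume R: "g \<in> curve_symmetries \<and> induced g ` (X interior_of \<Sigma>) \<inter> X interior_of \<Sigma>' \<noteq> {}"
  then obtain x where x: "x \<in> X interior_of \<Sigma>" "induced g x \<in> X interior_of \<Sigma>'" by blast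
  define U where "U = X interior_of \<Sigma> \<inter> {x \<in> topspace X. induced g x \<in> X interior_of \<Sigma>'}"
  have "openin X U" unfolding U_def
    by (intro openin_Int openin_interior_of
        openin_continuous_map_preimage[OF induced_continuous openin_interior_of] conjunct1[OF R])
  moreover have "x \<in> U" using x interior_of_subset_topspace[of X \<Sigma>] by (auto simp: U_def)
  ultimately obtain P where P: "segment P" "openin X P" "P \<subseteq> U" using openin_contains_segment by metis
  have PX: "P \<subseteq> topspace X" using P(1) by (rule segment_subset_topspace)
  have hom: "homeomorphic_map X X (induced g)" using R induced_homeomorphic by blast
  have "openin X (induced g ` P)"
    using homeomorphic_imp_open_map[OF hom] P(2) by (simp add: open_map_def)
  moreover have "segment (induced g ` P)"
  proof -
    have "connectedin X (induced g ` P)"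
      using P(1) homeomorphic_map_connectedness[OF hom PX] by (simp add: segment_def)
    moreover have "inj_on (induced g) P"
      using homeomorphic_imp_injective_map[OF hom] PX inj_on_subset by blast
    ultimately show ?thesis using P(1) unfolding segment_def by (meson image_eqI inj_onD)
  qed
  moreover have "induced g ` P \<subseteq> X interior_of \<Sigma>'" "P \<subseteq> X interior_of \<Sigma>" using P(3) by (auto simp: U_def)
  moreover from this have "induced g ` P \<subseteq> \<Sigma>'" "P \<subseteq> \<Sigma>" "induced g ` P \<subseteq> topspace X"
    using interior_of_subset[of X] interior_of_subset_topspace[of X] by blast+
  moreover have "act g ` \<iota> ` P = \<iota> ` induced g ` P" using R image_act_iota PX by blast
  ultimately show "locally_overlap M S \<iota> act g \<Sigma> \<Sigma>'"
    unfolding locally_overlap_def segments_eq using P(1,2) iota_embedding_subset PX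
    by (intro bexI[of _ P] bexI[of _ "induced g ` P"] conjI) auto
qed

text \<open>Elements of the stabilizer always produce an overlap, because a segment has interior
  points. So the equivalence in the definition is a condition on the remaining elements.\<close>

lemma free_segments_eq: "free_segments G act M S \<iota> = {\<Sigma>. free \<Sigma>}"
proof -
  have "(locally_overlap M S \<iota> act g \<Sigma> \<Sigma> \<longleftrightarrow> g \<in> G\<^sub>S) \<longleftrightarrow>
      (g \<in> curve_symmetries \<longrightarrow> induced g \<noteq> id \<longrightarrow> induced g ` (X interior_of \<Sigma>) \<inter> X interior_of \<Sigma> = {})"
    if "segment \<Sigma>" "g \<in> carrier G" for \<Sigma> g
  proof (cases "g \<in> G\<^sub>S")
    case True
    then show ?thesis
      using locally_overlap_iff[OF that(2)] stabilizer_symmetries segment_interior_nonempty[OF that(1)] by simp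
  next
    case False
    then show ?thesis using locally_overlap_iff[OF that(2)] induced_eq_id_iff by blast
  qed
  then have "(\<forall>g\<in>carrier G. locally_overlap M S \<iota> act g \<Sigma> \<Sigma> \<longleftrightarrow> g \<in> G\<^sub>S) \<longleftrightarrow>
    (\<forall>f\<in>induced ` curve_symmetries. f \<noteq> id \<longrightarrow> f ` (X interior_of \<Sigma>) \<inter> X interior_of \<Sigma> = {})"
    if "segment \<Sigma>" for \<Sigma>
    using that curve_symmetriesD(1) by (simp add: Ball_def) blast
  then show ?thesis unfolding free_segments_def free_def segments_eq by blast
qed

lemma max_free_segments_eq: "max_free_segments G act M S \<iota> = {\<Sigma>. max_free \<Sigma>}"
  unfolding max_free_segments_def free_segments_eq max_free_def by blast

lemma seg_boundary_eq: "seg_boundary S \<Sigma> = boundary \<Sigma>"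
  by (simp add: seg_boundary_def boundary_def)

section \<open>Translates and cosets of the stabilizer\<close>

lemma l_coset_eqI:
  assumes "g \<in> curve_symmetries" "h \<in> curve_symmetries" "induced g = induced h"
  shows "g <# G\<^sub>S = h <# G\<^sub>S"
proof -
  interpret G: group G by (rule group)
  have "g <# G\<^sub>S \<subseteq> h <# G\<^sub>S"
    if gh: "g \<in> curve_symmetries" "h \<in> curve_symmetries" "induced g = induced h" for g h
  proof
    fix x assume "x \<in> g <# G\<^sub>S"
    then obtain s where s: "s \<in> G\<^sub>S" "x = g \<otimes> s" by (auto simp: l_coset_def)
    have c: "g \<in> carrier G" "h \<in> carrier G" "s \<in> carrier G"
      using gh s(1) curve_symmetriesD(1) curve_stabilizer_iff by auto
    have inv: "inv h \<in> curve_symmetries" using symmetries_inv(1) gh(2) by blast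
    have hg: "inv h \<otimes> g \<in> curve_symmetries" using symmetries_mult(1)[OF inv gh(1)] .
    have ss: "s \<in> curve_symmetries" "induced s = id" using stabilizer_symmetries[OF s(1)] by auto
    have "induced (inv h \<otimes> g) = id"
      using symmetries_mult(2)[OF inv gh(1)] gh(3) symmetries_inv(2)[OF gh(2)] by simp
    then have "induced (inv h \<otimes> g \<otimes> s) = id" using symmetries_mult(2)[OF hg ss(1)] ss(2) by simp
    then have "inv h \<otimes> g \<otimes> s \<in> G\<^sub>S" using induced_eq_id_iff[OF symmetries_mult(1)[OF hg ss(1)]] by simp
    moreover have "x = h \<otimes> (inv h \<otimes> g \<otimes> s)" using s(2) c by (simp flip: G.m_assoc)
    ultimately show "x \<in> h <# G\<^sub>S" by (auto simp: l_coset_def)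
  qed
  from this[OF assms] this[OF assms(2,1) assms(3)[symmetric]] show ?thesis by (rule subset_antisym)
qed

definition coset_of_translate :: "'s set \<Rightarrow> 's set \<Rightarrow> 'g set \<Rightarrow> bool" where
  "coset_of_translate \<Sigma> \<Sigma>' C \<longleftrightarrow> (\<exists>g\<in>curve_symmetries. C = g <# G\<^sub>S \<and> induced g ` \<Sigma> = \<Sigma>')"

text \<open>Equal translates have overlapping interiors, so both elements induce the same map and
  lie in the same coset. Uniqueness of a decomposition thus reduces to uniqueness of its
  tiles.\<close>

lemma coset_of_translate_unique:
  assumes "free \<Sigma>" "coset_of_translate \<Sigma> \<Sigma>' C" "coset_of_translate \<Sigma> \<Sigma>' D"
  shows "C = D"
proof -
  obtain g where g: "g \<in> curve_symmetries" "C = g <# G\<^sub>S" "induced g ` \<Sigma> = \<Sigma>'"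
    using assms(2) unfolding coset_of_translate_def by (elim bexE conjE)
  obtain h where h: "h \<in> curve_symmetries" "D = h <# G\<^sub>S" "induced h ` \<Sigma> = \<Sigma>'"
    using assms(3) unfolding coset_of_translate_def by (elim bexE conjE)
  have \<Sigma>: "\<Sigma> \<subseteq> topspace X" using assms(1) free_segment segment_subset_topspace by blast
  have "induced g ` (X interior_of \<Sigma>) = induced h ` (X interior_of \<Sigma>)"
    using interior_of_Q_image[OF imageI[OF g(1)] \<Sigma>] interior_of_Q_image[OF imageI[OF h(1)] \<Sigma>] g(3) h(3) by simp
  then have "induced g ` (X interior_of \<Sigma>) \<inter> induced h ` (X interior_of \<Sigma>) \<noteq> {}"
    using segment_interior_nonempty[OF free_segment[OF assms(1)]] by simp
  then have "induced g = induced h" by (rule translates_disjoint[OF assms(1) imageI[OF g(1)] imageI[OF h(1)]])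
  then show ?thesis unfolding g(2) h(2) by (rule l_coset_eqI[OF g(1) h(1)])
qed

end

lemma Diff_singleton_eq_singleton:
  "b \<in> A \<Longrightarrow> b \<noteq> a \<Longrightarrow> (\<And>x. x \<in> A \<Longrightarrow> x = a \<or> x = b) \<Longrightarrow> A - {a} = {b}"
  by blast

locale free_analytic_circle_action = analytic_circle_action +
  assumes free_submanifold: "free_submanifold G act M S \<iota>"
    and not_free_segment: "topspace (mtop S) \<notin> free_segments G act M S \<iota>"
begin

sublocale free_circle_action "mtop S" e "induced ` curve_symmetries"
proof
  fix c d x assume cd: "c \<in> topspace X" "d \<in> topspace X" "c \<noteq> d" and x: "x \<in> topspace X - {c, d}"
  have "\<iota> c \<noteq> \<iota> d" "\<iota> x \<notin> {\<iota> c, \<iota> d}" using inj_onD[OF iota_inj] cd x by auto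
  then have C: "{\<iota> c, \<iota> d} \<subseteq> topspace (mtop M) \<and> (\<exists>a\<in>{\<iota> c, \<iota> d}. \<exists>b\<in>{\<iota> c, \<iota> d}. a \<noteq> b) \<and>
      \<iota> x \<in> topspace (mtop M) - {\<iota> c, \<iota> d}"
    using iota_in cd x by auto
  from mp[OF spec[OF spec[OF conjunct2[OF non_contractive[unfolded non_contractive_def]]]] C]
  obtain U where U: "openin (mtop M) U" "\<iota> x \<in> U" "\<forall>g\<in>carrier G. \<not> act g ` {\<iota> c, \<iota> d} \<subseteq> U"
    by (elim exE conjE)
  \<comment> \<open>The neighbourhood is pulled back along \<iota>. As
    \<open>curve_symmetries\<close> is part of \<open>carrier G\<close>, the condition in
    \<open>M\<close> covers every element of \<open>Q\<close>.\<close>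
  let ?V = "{z \<in> topspace X. \<iota> z \<in> U}"
  have "\<not> induced g ` {c, d} \<subseteq> ?V" if g: "g \<in> curve_symmetries" for g
  proof
    assume "induced g ` {c, d} \<subseteq> ?V"
    then have "act g ` {\<iota> c, \<iota> d} \<subseteq> U" using iota_induced[OF g] cd(1,2) by auto
    then show False using U(3) curve_symmetriesD(1)[OF g] by blast
  qed
  moreover have "openin X ?V" by (rule openin_continuous_map_preimage[OF iota_continuous U(1)])
  moreover have "x \<in> ?V" using x U(2) by simp
  ultimately show "\<exists>U. openin X U \<and> x \<in> U \<and> (\<forall>f\<in>induced ` curve_symmetries. \<not> f ` {c, d} \<subseteq> U)"
    by (intro exI[of _ ?V]) simp
next
  show "\<exists>\<Sigma>. free \<Sigma>"
    using free_submanifold unfolding free_submanifold_def free_segments_eq by auto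
  show "\<not> free (topspace X)" using not_free_segment unfolding free_segments_eq by simp
qed

lemma max_free_properties:
  assumes "max_free \<Sigma>"
  shows "compactin X \<Sigma>" "\<Sigma> \<subset> topspace X"
proof -
  obtain a b where "\<Sigma> = e ` {a..b}" using max_free_arc[OF assms] .
  then show "compactin X \<Sigma>" using compactin_arc by simp
  have "\<Sigma> \<noteq> topspace X" using max_free_free[OF assms] not_free by auto
  then show "\<Sigma> \<subset> topspace X"
    using segment_subset_topspace[OF free_segment[OF max_free_free[OF assms]]] by blast
qed

text \<open>Maximal free segments have interior points, so carrying one onto another already makes
  \<open>g\<close> a symmetry of the whole curve.\<close>

lemma coset_of_translate_iff:
  assumes "max_free \<Sigma>" "max_free \<Sigma>'"
  shows "(\<exists>g\<in>carrier G. C = g <# G\<^sub>S \<and> act g ` \<iota> ` \<Sigma> = \<iota> ` \<Sigma>') \<longleftrightarrow> coset_of_translate \<Sigma> \<Sigma>' C"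
proof -
  have sub: "\<Sigma> \<subseteq> topspace X" "\<Sigma>' \<subseteq> topspace X" using assms max_free_properties(2) by auto
  have ne: "X interior_of \<Sigma> \<noteq> {}" "X interior_of \<Sigma>' \<noteq> {}"
    using assms segment_interior_nonempty free_segment max_free_free by blast+
  have "g \<in> carrier G \<and> act g ` \<iota> ` \<Sigma> = \<iota> ` \<Sigma>' \<longleftrightarrow> g \<in> curve_symmetries \<and> induced g ` \<Sigma> = \<Sigma>'" for g
  proof (intro iffI conjI; elim conjE)
    assume "g \<in> carrier G" "act g ` \<iota> ` \<Sigma> = \<iota> ` \<Sigma>'"
    then show "g \<in> curve_symmetries" "induced g ` \<Sigma> = \<Sigma>'"
      using overlap_imp_symmetry[OF _ sub ne] by auto
  next
    assume "g \<in> curve_symmetries" "induced g ` \<Sigma> = \<Sigma>'"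
    then show "g \<in> carrier G" "act g ` \<iota> ` \<Sigma> = \<iota> ` \<Sigma>'"
      using curve_symmetriesD(1) image_act_iota[OF _ sub(1)] by auto
  qed
  then show ?thesis unfolding coset_of_translate_def by blast
qed

text \<open>Separates the geometry of the tiles from the choice of cosets, so that the results on
  tilings apply. The only clause that involves \<open>act\<close> is converted by
  \<open>coset_of_translate_iff\<close>.\<close>

lemma decompositions_iff:
  assumes "max_free \<Sigma>"
  shows "(n, \<sigma>, c) \<in> decompositions G act M S \<iota> \<Sigma> \<longleftrightarrow>
    \<sigma> \<in> extensional {..n} \<and> c \<in> extensional {..n} \<and> tiling n \<sigma> \<and> \<sigma> 0 = \<Sigma> \<and>
    (\<forall>k\<le>n. coset_of_translate \<Sigma> (\<sigma> k) (c k))" (is "?L \<longleftrightarrow> ?R")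
proof
  assume L: ?L
  note L' = L[unfolded decompositions_def mem_Collect_eq case_prod_conv max_free_segments_eq seg_boundary_eq]
  have ext: "\<sigma> \<in> extensional {..n}" "c \<in> extensional {..n}" and mf: "\<And>k. k \<le> n \<Longrightarrow> max_free (\<sigma> k)"
    and \<sigma>0: "\<sigma> 0 = \<Sigma>"
    using L' by (auto simp: PiE_iff)
  have cos: "coset_of_translate \<Sigma> (\<sigma> k) (c k)" if "k \<le> n" for k
  proof -
    have "\<exists>g\<in>carrier G. c k = g <# G\<^sub>S \<and> act g ` \<iota> ` \<Sigma> = \<iota> ` \<sigma> k"
      using L' that unfolding \<sigma>0 by (elim conjE) simp
    then show ?thesis using coset_of_translate_iff[OF assms mf[OF that]] by simp
  qed
  have translates: "\<exists>f\<in>induced ` curve_symmetries. f ` \<sigma> 0 = \<sigma> k" if "k \<le> n" for k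
    using cos[OF that] unfolding coset_of_translate_def \<sigma>0 by (elim bexE conjE) (rule bexI, auto)
  have "tiling n \<sigma>"
    unfolding tiling_def
  proof (intro conjI)
    show "1 \<le> n" by (rule L'[THEN conjunct1])
    show "\<forall>k\<le>n. max_free (\<sigma> k) \<and> (\<exists>f\<in>induced ` curve_symmetries. f ` \<sigma> 0 = \<sigma> k)"
      using mf translates by blast
    show "topspace X = (\<Union>k\<le>n. \<sigma> k)" by (rule L'[THEN conjunct2, THEN conjunct2, THEN conjunct2, THEN conjunct2, THEN conjunct2, THEN conjunct2, THEN conjunct2, THEN conjunct1])
    show "n = 1 \<longrightarrow> \<sigma> 0 \<inter> \<sigma> 1 = boundary (\<sigma> 0) \<and> \<sigma> 0 \<inter> \<sigma> 1 = boundary (\<sigma> 1) \<and> card (\<sigma> 0 \<inter> \<sigma> 1) = 2"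
      by (rule impI, rule L'[THEN conjunct2, THEN conjunct2, THEN conjunct2, THEN conjunct2, THEN conjunct2, THEN conjunct2, THEN conjunct2, THEN conjunct2, THEN conjunct2, THEN conjunct1, THEN mp, THEN conjunct2])
  qed (rule L'[THEN conjunct2, THEN conjunct2, THEN conjunct2, THEN conjunct2, THEN conjunct2, THEN conjunct2, THEN conjunct2, THEN conjunct2, THEN conjunct2, THEN conjunct2])
  with ext cos \<sigma>0 show ?R by simp
next
  assume R: ?R
  then have t: "tiling n \<sigma>" and \<sigma>0: "\<sigma> 0 = \<Sigma>" and ext: "\<sigma> \<in> extensional {..n}" "c \<in> extensional {..n}" by auto
  have mf: "max_free (\<sigma> k)" if "k \<le> n" for k using t that by (simp add: tiling_def)
  have cos: "\<exists>g\<in>carrier G. c k = g <# G\<^sub>S \<and> act g ` \<iota> ` \<sigma> 0 = \<iota> ` \<sigma> k" if "k \<le> n" for k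
    using R that coset_of_translate_iff[OF assms mf[OF that]] \<sigma>0 by simp
  have c: "c \<in> {..n} \<rightarrow>\<^sub>E lcosets\<^bsub>G\<^esub> G\<^sub>S"
  proof (rule PiE_I)
    fix k assume "k \<in> {..n}"
    then obtain g where "g \<in> carrier G" "c k = g <# G\<^sub>S"
      using cos[of k] by auto
    then show "c k \<in> lcosets\<^bsub>G\<^esub> G\<^sub>S" by (auto simp: LCOSETS_def)
  qed (rule extensional_arb[OF ext(2)])
  have \<sigma>: "\<sigma> \<in> {..n} \<rightarrow>\<^sub>E {\<Sigma>. max_free \<Sigma>}" using mf ext(1) by (auto simp: PiE_iff)
  note T = t[unfolded tiling_def]
  show ?L
    unfolding decompositions_def mem_Collect_eq case_prod_conv max_free_segments_eq seg_boundary_eq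
  proof (intro conjI)
    show "1 \<le> n" by (rule T[THEN conjunct1])
    show "max_free \<Sigma>" by (rule assms)
    show "\<Sigma> \<subset> topspace X" by (rule max_free_properties(2)[OF assms])
    show "\<forall>k\<le>n. compactin X (\<sigma> k)" using mf max_free_properties(1) by blast
    show "\<forall>k\<le>n. \<exists>g\<in>carrier G. c k = g <# G\<^sub>S \<and> act g ` \<iota> ` \<sigma> 0 = \<iota> ` \<sigma> k" using cos by blast
    show "topspace X = (\<Union>k\<le>n. \<sigma> k)" by (rule T[THEN conjunct2, THEN conjunct2, THEN conjunct1])
    show "n = 1 \<longrightarrow> \<sigma> 0 \<inter> \<sigma> 1 = boundary (\<sigma> 0) \<inter> boundary (\<sigma> 1) \<and>
        \<sigma> 0 \<inter> \<sigma> 1 = boundary (\<sigma> 0) \<and> \<sigma> 0 \<inter> \<sigma> 1 = boundary (\<sigma> 1) \<and> card (\<sigma> 0 \<inter> \<sigma> 1) = 2"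
    proof
      assume "n = 1"
      with T[THEN conjunct2, THEN conjunct2, THEN conjunct2, THEN conjunct1]
      have b: "\<sigma> 0 \<inter> \<sigma> 1 = boundary (\<sigma> 0)" "\<sigma> 0 \<inter> \<sigma> 1 = boundary (\<sigma> 1)" "card (\<sigma> 0 \<inter> \<sigma> 1) = 2"
        by blast+
      have "\<sigma> 0 \<inter> \<sigma> 1 = boundary (\<sigma> 0) \<inter> boundary (\<sigma> 1)"
        unfolding b(1)[symmetric] b(2)[symmetric] by (rule Int_absorb[symmetric])
      with b show "\<sigma> 0 \<inter> \<sigma> 1 = boundary (\<sigma> 0) \<inter> boundary (\<sigma> 1) \<and>
        \<sigma> 0 \<inter> \<sigma> 1 = boundary (\<sigma> 0) \<and> \<sigma> 0 \<inter> \<sigma> 1 = boundary (\<sigma> 1) \<and> card (\<sigma> 0 \<inter> \<sigma> 1) = 2"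
        by (intro conjI)
    qed
  qed (rule \<sigma> c \<sigma>0 T[THEN conjunct2, THEN conjunct2, THEN conjunct2, THEN conjunct2])+
qed

lemma decompositions_nonempty:
  assumes "max_free \<Sigma>"
  shows "decompositions G act M S \<iota> \<Sigma> \<noteq> {}"
proof -
  obtain n \<sigma> where t: "tiling n \<sigma>" "\<sigma> 0 = \<Sigma>" using ex_tiling[OF assms] by blast
  have "\<exists>C. k \<le> n \<longrightarrow> coset_of_translate \<Sigma> (\<sigma> k) C" for k
  proof (cases "k \<le> n")
    case True
    then have "\<exists>f\<in>induced ` curve_symmetries. f ` \<Sigma> = \<sigma> k" using t by (simp add: tiling_def)
    then obtain g where "g \<in> curve_symmetries" "induced g ` \<Sigma> = \<sigma> k" by blast
    then have "coset_of_translate \<Sigma> (\<sigma> k) (g <# G\<^sub>S)" unfolding coset_of_translate_def by blast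
    then show ?thesis by blast
  qed simp
  then obtain c where c: "\<And>k. k \<le> n \<Longrightarrow> coset_of_translate \<Sigma> (\<sigma> k) (c k)" by metis
  have "tiling n (restrict \<sigma> {..n})" by (rule tiling_cong[OF _ t(1)]) simp
  then have "(n, restrict \<sigma> {..n}, restrict c {..n}) \<in> decompositions G act M S \<iota> \<Sigma>"
    unfolding decompositions_iff[OF assms] using c t(2) by simp
  then show ?thesis by blast
qed

lemma decomposition_card:
  assumes "max_free \<Sigma>" "(n, \<sigma>, c) \<in> decompositions G act M S \<iota> \<Sigma>"
  shows "card (induced ` curve_symmetries) = Suc n"
  using assms(2) tiling_card unfolding decompositions_iff[OF assms(1)] by blast

text \<open>\<open>tiling_unique\<close> leaves two families of tiles, and
  \<open>coset_of_translate_unique\<close> fixes the cosets. Extensionality turns agreement on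
  \<open>{..n}\<close> into equality.\<close>

lemma decompositions_minus:
  assumes max: "max_free \<Sigma>" and D: "(n, \<sigma>, c) \<in> decompositions G act M S \<iota> \<Sigma>"
  shows "decompositions G act M S \<iota> \<Sigma> - {(n, \<sigma>, c)} =
    (if 2 \<le> n then {reversed_decomposition (n, \<sigma>, c)} else {})"
proof -
  let ?D = "decompositions G act M S \<iota> \<Sigma>"
  have fr: "free \<Sigma>" using max by (rule max_free_free)
  have R: "\<sigma> \<in> extensional {..n}" "c \<in> extensional {..n}" "tiling n \<sigma>" "\<sigma> 0 = \<Sigma>"
    "\<And>k. k \<le> n \<Longrightarrow> coset_of_translate \<Sigma> (\<sigma> k) (c k)"
    using D unfolding decompositions_iff[OF max] by auto
  have other: "x = (n, \<sigma>, c) \<or> (2 \<le> n \<and> x = reversed_decomposition (n, \<sigma>, c))" if "x \<in> ?D" for x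
  proof -
    obtain n' \<sigma>' c' where x: "x = (n', \<sigma>', c')" by (cases x)
    have R': "\<sigma>' \<in> extensional {..n'}" "c' \<in> extensional {..n'}" "tiling n' \<sigma>'" "\<sigma>' 0 = \<Sigma>"
      "\<And>k. k \<le> n' \<Longrightarrow> coset_of_translate \<Sigma> (\<sigma>' k) (c' k)"
      using that unfolding x decompositions_iff[OF max] by auto
    have 0: "\<sigma>' 0 = \<sigma> 0" using R(4) R'(4) by simp
    have n': "n' = n" using tiling_unique(1)[OF R(3) R'(3) 0] .
    have "(\<forall>k\<le>n. \<sigma>' k = \<sigma> k) \<or> (2 \<le> n \<and> (\<forall>k\<le>n. \<sigma>' k = \<sigma> (reversal_index n k)))"
      using tiling_unique(2)[OF R(3) R'(3) 0] .
    then show ?thesis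
    proof
      assume eq: "\<forall>k\<le>n. \<sigma>' k = \<sigma> k"
      have "\<sigma>' = \<sigma>" by (rule extensionalityI[of _ "{..n}"]) (use R(1) R'(1) n' eq in auto)
      moreover have "c' = c"
      proof (rule extensionalityI[of _ "{..n}"])
        fix k assume "k \<in> {..n}"
        then show "c' k = c k"
          using coset_of_translate_unique[OF fr R'(5)[of k]] R(5)[of k] eq n' by simp
      qed (use R(2) R'(2) n' in auto)
      ultimately show ?thesis using x n' by simp
    next
      assume *: "2 \<le> n \<and> (\<forall>k\<le>n. \<sigma>' k = \<sigma> (reversal_index n k))"
      have "\<sigma>' = (\<lambda>k\<in>{..n}. \<sigma> (reversal_index n k))"
        by (rule extensionalityI[of _ "{..n}"]) (use R'(1) n' * in auto)
      moreover have "c' = (\<lambda>k\<in>{..n}. c (reversal_index n k))"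
      proof (rule extensionalityI[of _ "{..n}"])
        fix k assume k: "k \<in> {..n}"
        then show "c' k = (\<lambda>k\<in>{..n}. c (reversal_index n k)) k"
          using coset_of_translate_unique[OF fr R'(5)[of k]] R(5)[OF reversal_index_le[of k n]] * n' by simp
      qed (use R'(2) n' in auto)
      ultimately show ?thesis using x n' * by (simp add: reversed_decomposition_def)
    qed
  qed
  show ?thesis
  proof (cases "2 \<le> n")
    case True
    have "reversed_decomposition (n, \<sigma>, c) \<in> ?D"
      unfolding reversed_decomposition_def case_prod_conv decompositions_iff[OF max]
    proof (intro conjI allI impI)
      show "tiling n (\<lambda>k\<in>{..n}. \<sigma> (reversal_index n k))"
        by (rule tiling_cong[OF _ tiling_reversal[OF R(3) True]]) simp
      show "(\<lambda>k\<in>{..n}. \<sigma> (reversal_index n k)) 0 = \<Sigma>" using R(4) by (simp add: reversal_index_def)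
      show "coset_of_translate \<Sigma> ((\<lambda>k\<in>{..n}. \<sigma> (reversal_index n k)) k) ((\<lambda>k\<in>{..n}. c (reversal_index n k)) k)"
        if "k \<le> n" for k
        using R(5)[OF reversal_index_le[OF that]] that by simp
    qed auto
    moreover have "reversed_decomposition (n, \<sigma>, c) \<noteq> (n, \<sigma>, c)"
    proof
      assume "reversed_decomposition (n, \<sigma>, c) = (n, \<sigma>, c)"
      \<comment> \<open>Reversal sends index 1 to \<open>n\<close>, and distinct indices carry
        distinct tiles.\<close>
      then have "(\<lambda>k\<in>{..n}. \<sigma> (reversal_index n k)) 1 = \<sigma> 1" by (simp add: reversed_decomposition_def)
      then have "\<sigma> n = \<sigma> 1" using True by (simp add: reversal_index_def)
      then show False using inj_onD[OF tiling_inj_on[OF R(3)], of n 1] True by simp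
    qed
    moreover have "x = (n, \<sigma>, c) \<or> x = reversed_decomposition (n, \<sigma>, c)" if "x \<in> ?D" for x
      using other[OF that] by blast
    ultimately have "?D - {(n, \<sigma>, c)} = {reversed_decomposition (n, \<sigma>, c)}"
      by (rule Diff_singleton_eq_singleton)
    with True show ?thesis by simp
  next
    case False
    then have "x = (n, \<sigma>, c)" if "x \<in> ?D" for x using other[OF that] by blast
    then have "?D - {(n, \<sigma>, c)} = {}" by blast
    with False show ?thesis by simp
  qed
qed

end

theorem proposition3:
  fixes G :: "'g monoid" and L :: "'g manifold"
    and M :: "'m manifold" and act :: "'g \<Rightarrow> 'm \<Rightarrow> 'm"
    and S :: "'s manifold" and \<iota> :: "'s \<Rightarrow> 'm"
  assumes "lie_group G L"
    and "analytic_manifold M"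
    and "group_action G (topspace (mtop M)) act"
    and "continuous_in_group G L act M"
    and "non_contractive G act M"
    and "analytic_1_submanifold S \<iota> M"
    and "free_submanifold G act M S \<iota>"
    and "mtop S homeomorphic_space top_of_set (sphere (0::complex) 1)"
    and "topspace (mtop S) \<notin> free_segments G act M S \<iota>"
  shows
    "(max_free_segments G act M S \<iota> \<noteq> {} \<and>
      (\<forall>\<Sigma>\<in>max_free_segments G act M S \<iota>.
         compactin (mtop S) \<Sigma> \<and> \<Sigma> \<subset> topspace (mtop S) \<and>
         topspace (mtop S) = mtop S interior_of topspace (mtop S))) \<and>
     (\<forall>\<Sigma>\<in>max_free_segments G act M S \<iota>.
        decompositions G act M S \<iota> \<Sigma> \<noteq> {} \<and>
        (\<forall>(n, \<sigma>, c)\<in>decompositions G act M S \<iota> \<Sigma>.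
           (n = 1 \<longrightarrow> decompositions G act M S \<iota> \<Sigma> - {(n, \<sigma>, c)} = {}) \<and>
           (2 \<le> n \<longrightarrow> decompositions G act M S \<iota> \<Sigma> - {(n, \<sigma>, c)} =
                        {reversed_decomposition (n, \<sigma>, c)}))) \<and>
     ((\<exists>!n. is_length G act M S \<iota> n) \<and>
      1 \<le> submanifold_length G act M S \<iota> \<and>
      (\<forall>\<Sigma>\<in>max_free_segments G act M S \<iota>. \<forall>(n, \<sigma>, c)\<in>decompositions G act M S \<iota> \<Sigma>.
         n = submanifold_length G act M S \<iota>))"
proof -
  have S: "Hausdorff_space (mtop S)"
    using assms(6) by (simp add: analytic_1_submanifold_def analytic_1_manifold_with_boundary_def)
  obtain e where circle: "circle_parametrization (mtop S) e"
    using ex_circle_parametrization[OF assms(8) S] by blast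
  interpret free_analytic_circle_action S e G M act \<iota>
    by (intro free_analytic_circle_action.intro analytic_circle_action.intro
        analytic_circle_action_axioms.intro free_analytic_circle_action_axioms.intro circle assms)
  let ?D = "decompositions G act M S \<iota>"
  \<comment> \<open>The common length is one less than the order of \<open>Q\<close>, which depends
    neither on the segment nor on the decomposition.\<close>
  let ?n = "card (induced ` curve_symmetries) - 1"
  have ex: "\<exists>\<Sigma>. max_free \<Sigma>" using ex_free ex_max_free by blast
  have card: "n = ?n" if "max_free \<Sigma>" "(n, \<sigma>, c) \<in> ?D \<Sigma>" for n \<sigma> c \<Sigma>
    using decomposition_card[OF that] by simp
  have length_iff: "is_length G act M S \<iota> n \<longleftrightarrow> n = ?n" for n
  proof
    assume "is_length G act M S \<iota> n"
    then show "n = ?n" unfolding is_length_def max_free_segments_eq using card by blast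
  next
    assume n: "n = ?n"
    obtain \<Sigma> where \<Sigma>: "max_free \<Sigma>" using ex by blast
    then obtain n' \<sigma> c where D: "(n', \<sigma>, c) \<in> ?D \<Sigma>" using decompositions_nonempty by fast
    then have "n' = n" using card[OF \<Sigma>] n by simp
    with \<Sigma> D show "is_length G act M S \<iota> n" unfolding is_length_def max_free_segments_eq by blast
  qed
  have length_eq: "submanifold_length G act M S \<iota> = ?n"
    unfolding submanifold_length_def length_iff by simp
  have "1 \<le> ?n"
  proof -
    obtain \<Sigma> where \<Sigma>: "max_free \<Sigma>" using ex by blast
    then obtain n \<sigma> c where D: "(n, \<sigma>, c) \<in> ?D \<Sigma>" using decompositions_nonempty by fast
    then have "1 \<le> n" unfolding decompositions_iff[OF \<Sigma>] tiling_def by blast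
    then show ?thesis using card[OF \<Sigma> D] by simp
  qed
  then have part3: "(\<exists>!n. is_length G act M S \<iota> n) \<and> 1 \<le> submanifold_length G act M S \<iota> \<and>
      (\<forall>\<Sigma>\<in>max_free_segments G act M S \<iota>. \<forall>(n, \<sigma>, c)\<in>?D \<Sigma>. n = submanifold_length G act M S \<iota>)"
    unfolding length_eq length_iff max_free_segments_eq using card by auto
  have part1: "max_free_segments G act M S \<iota> \<noteq> {} \<and>
      (\<forall>\<Sigma>\<in>max_free_segments G act M S \<iota>.
         compactin (mtop S) \<Sigma> \<and> \<Sigma> \<subset> topspace (mtop S) \<and>
         topspace (mtop S) = mtop S interior_of topspace (mtop S))"
    unfolding max_free_segments_eq using ex max_free_properties by auto
  have part2: "?D \<Sigma> \<noteq> {} \<and>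
      (\<forall>(n, \<sigma>, c)\<in>?D \<Sigma>. (n = 1 \<longrightarrow> ?D \<Sigma> - {(n, \<sigma>, c)} = {}) \<and>
         (2 \<le> n \<longrightarrow> ?D \<Sigma> - {(n, \<sigma>, c)} = {reversed_decomposition (n, \<sigma>, c)}))"
    if "\<Sigma> \<in> max_free_segments G act M S \<iota>" for \<Sigma>
  proof -
    have \<Sigma>: "max_free \<Sigma>" using that unfolding max_free_segments_eq by simp
    have "(n = 1 \<longrightarrow> ?D \<Sigma> - {(n, \<sigma>, c)} = {}) \<and>
         (2 \<le> n \<longrightarrow> ?D \<Sigma> - {(n, \<sigma>, c)} = {reversed_decomposition (n, \<sigma>, c)})"
      if "(n, \<sigma>, c) \<in> ?D \<Sigma>" for n \<sigma> c
      unfolding decompositions_minus[OF \<Sigma> that] by simp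
    then show ?thesis using decompositions_nonempty[OF \<Sigma>] by blast
  qed
  from part1 conjI[OF ballI[OF part2] part3] show ?thesis by (rule conjI)
qed

end
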